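(* Let $K$ be a primitive triangulation of a smooth $(n+1)$-dimensional lattice polytope $P$, let $\varepsilon\in C^0(K;\mathbb F_2)$ be a sign distribution, and let $X$, $\partial_\varepsilon$, $\nabla^2$, $f_{\sigma}$, $\chi_\sigma$ be as defined in the context. For every interior simplex $\sigma^p$ of $K$ (with $0\le p\le n$), $$\partial_\varepsilon[f_{\sigma^p}]=\nabla^2(\varepsilon+\chi_{\sigma^p})\cap[f_{\sigma^p}]\quad\text{in } H_{p+1,n-p-1}(X;\mathbb F_2).$$
   Context: Polytope and triangulation. $M,N$ are dual lattices of rank $n+1$, $n\ge 1$, with pairing $\langle-,-\rangle$; $M_2=M\otimes\mathbb F_2$, $N_2=N\otimes\mathbb F_2$, $M_{\mathbb R}=M\otimes\mathbb R$. A full-dimensional lattice polytope $P\subset M_{\mathbb R}$ is smooth if it is simple and at each vertex the primitive edge directions form a basis of $M$. A primitive triangulation $K$ of $P$ is a triangulation into lattice simplices whose maximal simplices have volume $1/(n+1)!$ (unit volume = parallelepiped on a basis of $M$); its vertices are exactly $P\cap M$. $\sigma^p$ denotes a $p$-simplex, $\sigma\le\tau$ means $\sigma$ is a face of $\tau$; a simplex is interior if it is not contained in $\partial P$. $T\sigma$, $TQ$ denote linear tangent spaces. Complexes. For simplices $\sigma\le\tau$, $[\sigma,\tau]$ is the cell of the cubical subdivision of $K$ formed by the simplices of the barycentric subdivision given by flags between $\sigma$ and $\tau$ (dimension $\dim\tau-\dim\sigma$; its faces are the $[\sigma',\tau']$ with $\sigma\le\sigma'\le\tau'\le\tau$). For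 $\sigma$ contained in a face $Q$ of $P$, the dual cell $[\sigma,Q]=\bigcup_{\sigma\le\tau\subset Q}[\sigma,\tau]$ is a ball of dimension $\dim Q-\dim\sigma$. These are the closed cells of a regular CW structure $Y$ on $P$ (coarse structure), with $[\sigma',Q']\le[\sigma,Q]$ iff $\sigma'\ge\sigma$ and $Q'\subset Q$. $X\le Y$ is the subcomplex of cells $[\sigma,Q]$ with $\dim\sigma\ge1$. Put $\sigma^*=[\sigma,P]$. The cubical subdivision is the fine structure; a (co)sheaf on the coarse structure is viewed on the fine one by giving $[\sigma,\tau]$ the value at $[\sigma,Q]$, $Q$ the smallest face containing $\tau$; this does not change (co)homology. Cellular (co)sheaves of $\mathbb F_2$-vector spaces: a sheaf $\mathcal G$ has functorial maps $\mathcal G(e')\to\mathcal G(e)$ for $e'\le e$, a cosheaf $\mathcal F$ has maps $\mathcal F(e)\to\mathcal F(e')$. $H^q(-;\mathcal G)$ and $H_q(-;\mathcal F)$ are the cellular (co)homologies, with (co)boundaries given by sums over incident cells. Tropical homology. $\mathrm{Sed}(Q)=(TQ^\perp\cap N)\otimes\mathbb F_2\subset N_2$ and $\mathrm{Sed}([\sigma,Q])=\mathrm{Sed}(Q)$. For a cell $[\sigma,Q]$ of $X$, $\mathcal F^X_p(\sigma,Q)=\sum_{\sigma^1\le\sigma}\bigwedge^p\big(((T\sigma^1)^\perp\cap N)\otimes\mathbb F_2/\mathrm{Sed}(Q)\big)\subset\bigwedge^p(N_2/\mathrm{Sed}(Q))$, the sum being over edges of $\sigma$, with transition maps induced by projections.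 $H_{p,q}(X;\mathbb F_2)=H_q(X;\mathcal F^X_p)$. Face cycles. $\omega(\sigma^p)\in\bigwedge^pM_2$ is the unique non-zero element of $\bigwedge^p\big((T\sigma^p\cap M)\otimes\mathbb F_2\big)$. Choose a decomposable $\omega^*(\sigma^p)=u_1\wedge\dots\wedge u_p\in\bigwedge^pN_2$ with $\langle\omega(\sigma^p),\omega^*(\sigma^p)\rangle=1$. For an interior simplex $\sigma^p$, $f_{\sigma^p}=\omega^*(\sigma^p)\otimes\partial(\sigma^p)^*=\sum_{\sigma^{p+1}\ge\sigma^p}\omega^*(\sigma^p)\otimes(\sigma^{p+1})^*\in C_{n-p}(X;\mathcal F^X_p)$; it is a cycle whose class $[f_{\sigma^p}]\in H_{p,n-p}(X;\mathbb F_2)$ does not depend on the choice. $\chi_{\sigma^p}\in C^0(K;\mathbb F_2)$ is $1$ on the vertices of $\sigma^p$ and $0$ elsewhere. Waves. $\mathcal W_p$ is the sheaf on $X$ with $\mathcal W_p(\sigma,Q)=\bigwedge^p\big(((T\sigma)^\perp\cap N)\otimes\mathbb F_2\big)\subset\bigwedge^pN_2$ and inclusions as transition maps. For fine (co)chains $w$ of degree $q_1$ with values in $\mathcal W_{p_1}$ and $c$ of degree $q_2$ with values in $\mathcal F^X_{p_2}$, the cap-product is $(w\cap c)_{[\sigma^k,\sigma^l]}=\sum_{\sigma^m\ge\sigma^l}c_{[\sigma^k,\sigma^m]}\wedge w([\sigma^l,\sigma^m])$, with $m-l=q_1$, $m-k=q_2$, each term being projected to $\mathcal F^X_{p_1+p_2}([\sigma^k,\sigma^l])$;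 it induces $H^{q_1}(X;\mathcal W_{p_1})\otimes H_{p_2,q_2}(X;\mathbb F_2)\to H_{p_1+p_2,q_2-q_1}(X;\mathbb F_2)$. Hessian wave. Let $\mathcal Z^1$ be the sheaf $[\sigma,Q]\mapsto Z^1(\sigma;\mathbb F_2)$ (simplicial 1-cocycles, transition maps = restrictions). There is a short exact sequence $0\to\mathcal W_1\to N_2\xrightarrow{z}\mathcal Z^1|_X\to0$ with $N_2$ constant and $z(u)(\sigma^1)=\langle\omega(\sigma^1),u\rangle$. For $\varepsilon\in C^0(K;\mathbb F_2)$, $\nabla^2\varepsilon\in H^1(X;\mathcal W_1)$ is the image under the connecting morphism $H^0(X;\mathcal Z^1)\to H^1(X;\mathcal W_1)$ of the section $[\sigma,Q]\mapsto \mathrm d\varepsilon|_\sigma$. T-hypersurface and $\partial_\varepsilon$. A sign distribution is an element of $C^0(K;\mathbb F_2)$. Let $\mathbb RY$ be the quotient of $N_2\times P$ by $(u,x)\sim(u',x)$ iff $u-u'\in\mathrm{Sed}(Q_x)$, $Q_x$ the smallest face containing $x$, and let $u\cdot E$ be the image of $\{u\}\times E$. $\mathbb RX_\varepsilon\subset\mathbb RY$ is the union of the cells $u\cdot(\sigma^1)^*$ over edges $\sigma^1$ of $K$ with vertices $v_0,v_1$ and $u\in N_2$ with $\langle v_0-v_1,u\rangle+\varepsilon(v_0)+\varepsilon(v_1)=1$. For a cell $e$ of $X$, $\mathcal K(e)$ is the subspace of the group algebra $\mathbb F_2[N_2/\mathrm{Sed}(e)]$ (generators $\mathrm x^u$)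 spanned by the $\mathrm x^u$ with $u\cdot e\subset\mathbb RX_\varepsilon$, and $\mathcal K_p(e)$ is the intersection of $\mathcal K(e)$ with the $p$-th power of the augmentation ideal. This is a filtration of the cosheaf $\mathcal K$ and the map $\mathrm x^{u_0}\prod_{i=1}^p(1+\mathrm x^{u_i})\mapsto u_1\wedge\dots\wedge u_p$, defined on the $p$-th power of the augmentation ideal, restricts to a surjection $\mathrm{bv}_p:\mathcal K_p\to\mathcal F^X_p$ with kernel $\mathcal K_{p+1}$. The operator $\partial_\varepsilon:H_{p,q}(X;\mathbb F_2)\to H_{p+1,q-1}(X;\mathbb F_2)$ is the boundary operator of the first page of the spectral sequence of this filtration (the Renaudineau–Shaw spectral sequence), transported by $\mathrm{bv}$: if $\tilde c$ is a $\mathcal K_p$-chain with $\mathrm{bv}_p(\tilde c)=c$ a cycle, then $\partial_\varepsilon[c]=[\mathrm{bv}_{p+1}(\partial\tilde c)]$. *)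

theory Defs
  imports
    "HOL-Analysis.Analysis"
    "HOL-Library.Z2"
    "HOL-Library.Poly_Mapping"
    "HOL-Library.Set_Algebras"
begin

section \<open>Lattices and their reductions modulo two\<close>

text \<open>
  A basis of the lattice is fixed: \<open>M = N = int ^ 'n\<close>, with pairing \<open>\<Sum>i. m $ i * u $ i\<close>, so that
  \<open>M \<otimes> \<real> = real ^ 'n\<close> and \<open>M\<^sub>2 = N\<^sub>2 = bit ^ 'n\<close>. The rank \<open>n + 1\<close> is \<open>CARD('n)\<close>.
\<close>

definition lat :: "int ^ 'n \<Rightarrow> real ^ 'n" where
  "lat m = (\<chi> i. of_int (m $ i))"

definition mod2 :: "int ^ 'n \<Rightarrow> bit ^ 'n" where
  "mod2 m = (\<chi> i. of_int (m $ i))"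

definition pair :: "'a::comm_ring_1 ^ 'i \<Rightarrow> 'a ^ 'i \<Rightarrow> 'a" where
  "pair x y = (\<Sum>i\<in>UNIV. x $ i * y $ i)"

definition tangent :: "(real ^ 'n) set \<Rightarrow> (real ^ 'n) set" where
  "tangent A = span {x - y | x y. x \<in> A \<and> y \<in> A}"

text \<open>
  \<open>(TA \<inter> M) \<otimes> F\<^sub>2\<close> and \<open>((TA)\<^sup>\<bottom> \<inter> N) \<otimes> F\<^sub>2\<close>. The two sublattices are saturated, so these
  vector spaces are the images of the sublattices in \<open>M\<^sub>2\<close> and \<open>N\<^sub>2\<close>.
\<close>

definition tangent2 :: "(real ^ 'n) set \<Rightarrow> (bit ^ 'n) set" where
  "tangent2 A = mod2 ` {m. lat m \<in> tangent A}"

definition conormal2 :: "(real ^ 'n) set \<Rightarrow> (bit ^ 'n) set" where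
  "conormal2 A = mod2 ` {u. \<forall>t\<in>tangent A. t \<bullet> lat u = 0}"

abbreviation sed :: "(real ^ 'n) set \<Rightarrow> (bit ^ 'n) set" where
  "sed Q \<equiv> conormal2 Q"

section \<open>Exterior algebra over the field with two elements\<close>

text \<open>
  An element of the exterior algebra of \<open>bit ^ 'n\<close> is given by its coordinates in the basis
  \<open>e\<^sub>A\<close> (\<open>A \<subseteq> 'n\<close>), \<open>e\<^sub>A\<close> being the product of the \<open>e\<^sub>i\<close> with \<open>i \<in> A\<close>. No ordering is needed, since
  there are no signs; \<open>e\<^sub>A \<and> e\<^sub>B\<close> is \<open>e\<^bsub>A \<union> B\<^esub>\<close> if \<open>A\<close> and \<open>B\<close> are disjoint and \<open>0\<close> otherwise. The
  bases \<open>e\<^sub>A\<close> for \<open>M\<^sub>2\<close> and \<open>N\<^sub>2\<close> are dual for the determinant pairing, which is therefore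
  \<^const>\<open>pair\<close>.
\<close>

type_synonym 'n ext = "bit ^ 'n set"

definition ext_one :: "'n::finite ext" where
  "ext_one = (\<chi> A. of_bool (A = {}))"

definition ext_vec :: "bit ^ 'n \<Rightarrow> 'n::finite ext" where
  "ext_vec u = (\<chi> A. \<Sum>i | A = {i}. u $ i)"

definition wedge :: "'n::finite ext \<Rightarrow> 'n ext \<Rightarrow> 'n ext" where
  "wedge x y = (\<chi> C. \<Sum>A\<in>Pow C. x $ A * y $ (C - A))"

definition wedge_list :: "(bit ^ 'n) list \<Rightarrow> 'n::finite ext" where
  "wedge_list us = foldr (\<lambda>u x. wedge (ext_vec u) x) us ext_one"

definition ext_power :: "nat \<Rightarrow> (bit ^ 'n) set \<Rightarrow> ('n::finite ext) set" where
  "ext_power p V = vec.span {wedge_list us | us. length us = p \<and> set us \<subseteq> V}"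

text \<open>
  The exterior algebra of a quotient \<open>N\<^sub>2 / S\<close> is the quotient of that of \<open>N\<^sub>2\<close> by the ideal
  generated by \<open>S\<close>; its elements are cosets \<open>x +o ext_ideal S\<close>, added with \<open>+\<close> on sets.
\<close>

definition ext_ideal :: "(bit ^ 'n) set \<Rightarrow> ('n::finite ext) set" where
  "ext_ideal S = vec.span {wedge (ext_vec s) x | s x. s \<in> S}"

section \<open>Smooth polytopes and primitive triangulations\<close>

definition lattice_polytope :: "(real ^ 'n) set \<Rightarrow> bool" where
  "lattice_polytope P \<longleftrightarrow> (\<exists>S. finite S \<and> P = convex hull (lat ` S))"

definition simple_polytope :: "(real ^ 'n) set \<Rightarrow> bool" where
  "simple_polytope P \<longleftrightarrow> polytope P \<and>
     (\<forall>v. v extreme_point_of P \<longrightarrow> int (card {F. F facet_of P \<and> v \<in> F}) = aff_dim P)"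

definition lattice_basis :: "(int ^ 'n) set \<Rightarrow> bool" where
  "lattice_basis B \<longleftrightarrow> \<not> module.dependent (*s) B \<and> module.span (*s) B = UNIV"

definition edge_directions :: "(real ^ 'n) set \<Rightarrow> real ^ 'n \<Rightarrow> (int ^ 'n) set" where
  "edge_directions P v = {w. Gcd (range (($) w)) = 1 \<and>
     (\<exists>E. E edge_of P \<and> v \<in> E \<and> (\<exists>t>0. v + t *\<^sub>R lat w \<in> E))}"

definition smooth_polytope :: "(real ^ 'n) set \<Rightarrow> bool" where
  "smooth_polytope P \<longleftrightarrow> lattice_polytope P \<and> aff_dim P = int CARD('n) \<and> simple_polytope P \<and>
     (\<forall>v. v extreme_point_of P \<longrightarrow> lattice_basis (edge_directions P v))"

text \<open>
  A \<^const>\<open>simplicial_complex\<close> also contains the empty set as a face. Below it is always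
  excluded by a condition on dimensions.
\<close>

definition primitive_triangulation :: "(real ^ 'n) set \<Rightarrow> (real ^ 'n) set set \<Rightarrow> bool" where
  "primitive_triangulation P K \<longleftrightarrow> simplicial_complex K \<and> \<Union> K = P \<and>
     (\<forall>\<sigma>\<in>K. \<forall>v. v extreme_point_of \<sigma> \<longrightarrow> v \<in> range lat) \<and>
     (\<forall>\<sigma>\<in>K. (\<forall>\<tau>\<in>K. \<sigma> \<subseteq> \<tau> \<longrightarrow> \<tau> = \<sigma>) \<longrightarrow> measure lebesgue \<sigma> = 1 / fact CARD('n))"

definition min_face :: "(real ^ 'n) set \<Rightarrow> (real ^ 'n) set \<Rightarrow> (real ^ 'n) set" where
  "min_face P A = \<Inter> {Q. Q face_of P \<and> A \<subseteq> Q}"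

section \<open>Coarse and fine cells\<close>

text \<open>
  A pair \<open>(\<sigma>, Q)\<close> stands for the coarse cell \<open>[\<sigma>, Q]\<close>, a pair \<open>(\<sigma>, \<tau>)\<close> of simplices for the fine cell
  \<open>[\<sigma>, \<tau>]\<close>. Only the cells of \<open>X\<close> are considered, i.e. \<open>\<sigma>\<close> has dimension at least one. Degrees
  are integers; there are no cells of negative degree.
\<close>

type_synonym 'n cell = "(real ^ 'n) set \<times> (real ^ 'n) set"

definition coarse_cells ::
    "(real ^ 'n) set \<Rightarrow> (real ^ 'n) set set \<Rightarrow> int \<Rightarrow> ('n::finite cell) set" where
  "coarse_cells P K q =
     {(\<sigma>, Q). \<sigma> \<in> K \<and> Q face_of P \<and> \<sigma> \<subseteq> Q \<and> 1 \<le> aff_dim \<sigma> \<and> aff_dim Q - aff_dim \<sigma> = q}"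

definition fine_cells :: "(real ^ 'n) set set \<Rightarrow> int \<Rightarrow> ('n::finite cell) set" where
  "fine_cells K q =
     {(\<sigma>, \<tau>). \<sigma> \<in> K \<and> \<tau> \<in> K \<and> \<sigma> face_of \<tau> \<and> 1 \<le> aff_dim \<sigma> \<and> aff_dim \<tau> - aff_dim \<sigma> = q}"

definition fine_face :: "'n::finite cell \<Rightarrow> 'n cell \<Rightarrow> bool" where
  "fine_face e' e \<longleftrightarrow>
     fst e face_of fst e' \<and> fst e' face_of snd e' \<and> snd e' face_of snd e"

definition coarse_of :: "(real ^ 'n) set \<Rightarrow> 'n::finite cell \<Rightarrow> 'n cell" where
  "coarse_of P e = (fst e, min_face P (snd e))"

text \<open>The underlying point sets of the cells.\<close>

definition barycenter :: "(real ^ 'n) set \<Rightarrow> real ^ 'n" where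
  "barycenter \<sigma> = (1 / real (card {v. v extreme_point_of \<sigma>})) *\<^sub>R \<Sum> {v. v extreme_point_of \<sigma>}"

definition cube ::
    "(real ^ 'n) set set \<Rightarrow> (real ^ 'n) set \<Rightarrow> (real ^ 'n) set \<Rightarrow> (real ^ 'n) set" where
  "cube K \<sigma> \<tau> = \<Union> {convex hull (barycenter ` C) | C.
     C \<subseteq> {\<rho>\<in>K. \<sigma> face_of \<rho> \<and> \<rho> face_of \<tau>} \<and>
     (\<forall>\<rho>\<in>C. \<forall>\<rho>'\<in>C. \<rho> face_of \<rho>' \<or> \<rho>' face_of \<rho>)}"

definition dual_cell ::
    "(real ^ 'n) set set \<Rightarrow> (real ^ 'n) set \<Rightarrow> (real ^ 'n) set \<Rightarrow> (real ^ 'n) set" where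
  "dual_cell K \<sigma> Q = (\<Union>\<tau>\<in>{\<tau>\<in>K. \<sigma> face_of \<tau> \<and> \<tau> \<subseteq> Q}. cube K \<sigma> \<tau>)"

section \<open>Cellular homology and cohomology\<close>

text \<open>
  A cosheaf of \<open>F\<^sub>2\<close>-vector spaces. The stalks may be quotients, whose elements are cosets
  (added as sets), so the zero vector is part of the data; it is added to all sums in order that
  empty sums come out right.
\<close>

record ('c, 'v) cosheaf =
  stalk :: "'c \<Rightarrow> 'v set"
  zero_at :: "'c \<Rightarrow> 'v"
  trans_map :: "'c \<Rightarrow> 'c \<Rightarrow> 'v \<Rightarrow> 'v"

text \<open>
  (Co)homology is computed on the fine structure, where the cap-product is defined; this does not
  change it. The (co)sheaves are defined on the coarse cells and then viewed on the fine ones: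
  the value at \<open>[\<sigma>, \<tau>]\<close> is that at the coarse cell \<open>[\<sigma>, Q]\<close>, \<open>Q\<close> the smallest face containing \<open>\<tau>\<close>.
\<close>

definition on_fine ::
    "(real ^ 'n) set \<Rightarrow> ('n::finite cell, 'v) cosheaf \<Rightarrow> ('n cell, 'v) cosheaf" where
  "on_fine P F = \<lparr> stalk = (\<lambda>e. stalk F (coarse_of P e)),
                   zero_at = (\<lambda>e. zero_at F (coarse_of P e)),
                   trans_map = (\<lambda>e e'. trans_map F (coarse_of P e) (coarse_of P e')) \<rparr>"

definition chains ::
    "(real ^ 'n) set set \<Rightarrow> ('n::finite cell, 'v) cosheaf \<Rightarrow> int \<Rightarrow> ('n cell \<Rightarrow> 'v) set" where
  "chains K F q = PiE (fine_cells K q) (stalk F)"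

definition boundary ::
    "(real ^ 'n) set set \<Rightarrow> ('n::finite cell, 'v::comm_monoid_add) cosheaf \<Rightarrow> int
       \<Rightarrow> ('n cell \<Rightarrow> 'v) \<Rightarrow> 'n cell \<Rightarrow> 'v" where
  "boundary K F q c = (\<lambda>e'\<in>fine_cells K (q - 1).
     zero_at F e' + (\<Sum>e | e \<in> fine_cells K q \<and> fine_face e' e. trans_map F e e' (c e)))"

definition cycles ::
    "(real ^ 'n) set set \<Rightarrow> ('n::finite cell, 'v::comm_monoid_add) cosheaf \<Rightarrow> int
       \<Rightarrow> ('n cell \<Rightarrow> 'v) set" where
  "cycles K F q =
     {c \<in> chains K F q. boundary K F q c = restrict (zero_at F) (fine_cells K (q - 1))}"

definition hom_class ::
    "(real ^ 'n) set set \<Rightarrow> ('n::finite cell, 'v::comm_monoid_add) cosheaf \<Rightarrow> int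
       \<Rightarrow> ('n cell \<Rightarrow> 'v) \<Rightarrow> ('n cell \<Rightarrow> 'v) set" where
  "hom_class K F q c =
     {\<lambda>e\<in>fine_cells K q. c e + boundary K F (q + 1) b e | b. b \<in> chains K F (q + 1)}"

definition homology ::
    "(real ^ 'n) set set \<Rightarrow> ('n::finite cell, 'v::comm_monoid_add) cosheaf \<Rightarrow> int
       \<Rightarrow> ('n cell \<Rightarrow> 'v) set set" where
  "homology K F q = hom_class K F q ` cycles K F q"

text \<open>
  A coarse chain as a fine chain: a coarse \<open>q\<close>-cell is replaced by the sum of the fine \<open>q\<close>-cells it
  contains. A fine cell \<open>[\<sigma>, \<tau>]\<close> whose coarse cell \<open>[\<sigma>, Q]\<close> has larger dimension is not
  contained in any coarse \<open>q\<close>-cell.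
\<close>

definition subdivide ::
    "(real ^ 'n) set \<Rightarrow> (real ^ 'n) set set \<Rightarrow> ('n::finite cell, 'v) cosheaf \<Rightarrow> int
       \<Rightarrow> ('n cell \<Rightarrow> 'v) \<Rightarrow> 'n cell \<Rightarrow> 'v" where
  "subdivide P K F q c = (\<lambda>e\<in>fine_cells K q.
     if coarse_of P e \<in> coarse_cells P K q then c (coarse_of P e) else zero_at F (coarse_of P e))"

text \<open>
  The sheaves whose cochains are needed are sheaves of subgroups of one fixed group, with
  inclusions as transition maps; such a sheaf is given by its stalks.
\<close>

definition cochains ::
    "(real ^ 'n) set set \<Rightarrow> ('n::finite cell \<Rightarrow> 'v set) \<Rightarrow> int \<Rightarrow> ('n cell \<Rightarrow> 'v) set" where
  "cochains K G q = PiE (fine_cells K q) G"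

definition coboundary ::
    "(real ^ 'n) set set \<Rightarrow> int \<Rightarrow> ('n::finite cell \<Rightarrow> 'v::comm_monoid_add) \<Rightarrow> 'n cell \<Rightarrow> 'v" where
  "coboundary K q w = (\<lambda>e\<in>fine_cells K (q + 1).
     \<Sum>e' | e' \<in> fine_cells K q \<and> fine_face e' e. w e')"

definition cohom_class ::
    "(real ^ 'n) set set \<Rightarrow> ('n::finite cell \<Rightarrow> 'v::comm_monoid_add set) \<Rightarrow> int
       \<Rightarrow> ('n cell \<Rightarrow> 'v) \<Rightarrow> ('n cell \<Rightarrow> 'v) set" where
  "cohom_class K G q w =
     {\<lambda>e\<in>fine_cells K q. w e + coboundary K (q - 1) b e | b. b \<in> cochains K G (q - 1)}"

section \<open>Tropical homology and face cycles\<close>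

definition trop :: "nat \<Rightarrow> ('n::finite cell, 'n ext set) cosheaf" where
  "trop p = \<lparr> stalk = (\<lambda>(\<sigma>, Q). (\<lambda>x. x +o ext_ideal (sed Q)) `
                  vec.span (\<Union>e\<in>{e. e edge_of \<sigma>}. ext_power p (conormal2 e))),
              zero_at = (\<lambda>(\<sigma>, Q). ext_ideal (sed Q)),
              trans_map = (\<lambda>_ (\<sigma>', Q') y. y + ext_ideal (sed Q')) \<rparr>"

abbreviation trop_class ::
    "(real ^ 'n) set \<Rightarrow> (real ^ 'n) set set \<Rightarrow> nat \<Rightarrow> int
       \<Rightarrow> ('n::finite cell \<Rightarrow> 'n ext set) \<Rightarrow> ('n cell \<Rightarrow> 'n ext set) set" where
  "trop_class P K p q \<equiv> hom_class K (on_fine P (trop p)) q"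

abbreviation trop_homology ::
    "(real ^ 'n) set \<Rightarrow> (real ^ 'n) set set \<Rightarrow> nat \<Rightarrow> int
       \<Rightarrow> ('n::finite cell \<Rightarrow> 'n ext set) set set" where
  "trop_homology P K p q \<equiv> homology K (on_fine P (trop p)) q"

definition omega :: "(real ^ 'n) set \<Rightarrow> 'n::finite ext" where
  "omega \<sigma> = (THE w. w \<in> ext_power (nat (aff_dim \<sigma>)) (tangent2 \<sigma>) \<and> w \<noteq> 0)"

text \<open>\<open>us\<close> is a list of factors \<open>u\<^sub>1, \<dots>, u\<^sub>p\<close> of a possible choice of \<open>\<omega>\<^sup>*(\<sigma>)\<close>.\<close>

definition omega_dual :: "(real ^ 'n) set \<Rightarrow> (bit ^ 'n::finite) list \<Rightarrow> bool" where
  "omega_dual \<sigma> us \<longleftrightarrow> int (length us) = aff_dim \<sigma> \<and> pair (omega \<sigma>) (wedge_list us) = 1"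

definition face_chain ::
    "(real ^ 'n) set \<Rightarrow> (real ^ 'n) set set \<Rightarrow> (real ^ 'n) set \<Rightarrow> (bit ^ 'n) list
       \<Rightarrow> 'n::finite cell \<Rightarrow> 'n ext set" where
  "face_chain P K \<sigma> us = (\<lambda>(\<rho>, Q)\<in>coarse_cells P K (aff_dim P - aff_dim \<sigma> - 1).
     (if Q = P \<and> \<sigma> face_of \<rho> then wedge_list us else 0) +o ext_ideal (sed Q))"

definition face_cycle ::
    "(real ^ 'n) set \<Rightarrow> (real ^ 'n) set set \<Rightarrow> (real ^ 'n) set \<Rightarrow> (bit ^ 'n) list
       \<Rightarrow> 'n::finite cell \<Rightarrow> 'n ext set" where
  "face_cycle P K \<sigma> us =
     subdivide P K (trop (length us)) (aff_dim P - aff_dim \<sigma> - 1) (face_chain P K \<sigma> us)"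

text \<open>The class \<open>[f\<^sub>\<sigma>]\<close>, for \<open>us\<close> as in \<^const>\<open>omega_dual\<close>.\<close>

definition face_class ::
    "(real ^ 'n) set \<Rightarrow> (real ^ 'n) set set \<Rightarrow> (real ^ 'n) set \<Rightarrow> (bit ^ 'n) list
       \<Rightarrow> ('n::finite cell \<Rightarrow> 'n ext set) set" where
  "face_class P K \<sigma> us =
     trop_class P K (length us) (aff_dim P - aff_dim \<sigma> - 1) (face_cycle P K \<sigma> us)"

definition chi :: "(real ^ 'n) set \<Rightarrow> real ^ 'n \<Rightarrow> bit" where
  "chi \<sigma> v = of_bool (v extreme_point_of \<sigma>)"

section \<open>Waves, cap-product and the Hessian wave\<close>

definition wave :: "nat \<Rightarrow> 'n::finite cell \<Rightarrow> 'n ext set" where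
  "wave p = (\<lambda>(\<sigma>, Q). ext_power p (conormal2 \<sigma>))"

definition cap_chain ::
    "(real ^ 'n) set \<Rightarrow> (real ^ 'n) set set \<Rightarrow> int \<Rightarrow> int
       \<Rightarrow> ('n::finite cell \<Rightarrow> 'n ext) \<Rightarrow> ('n cell \<Rightarrow> 'n ext set) \<Rightarrow> 'n cell \<Rightarrow> 'n ext set" where
  "cap_chain P K q1 q2 w c = (\<lambda>(\<sigma>, \<tau>)\<in>fine_cells K (q2 - q1).
     ext_ideal (sed (min_face P \<tau>)) +
     (\<Sum>\<rho> | \<rho> \<in> K \<and> \<tau> face_of \<rho> \<and> aff_dim \<rho> - aff_dim \<tau> = q1.
        (\<lambda>x. wedge x (w (\<tau>, \<rho>))) ` c (\<sigma>, \<rho>)))"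

text \<open>
  Here and below, an operation on (co)homology classes is defined from representatives as the
  union of the classes obtained, which is that class when the operation is well defined.
\<close>

definition cap ::
    "(real ^ 'n) set \<Rightarrow> (real ^ 'n) set set \<Rightarrow> nat \<Rightarrow> int \<Rightarrow> nat \<Rightarrow> int
       \<Rightarrow> ('n::finite cell \<Rightarrow> 'n ext) set \<Rightarrow> ('n cell \<Rightarrow> 'n ext set) set
       \<Rightarrow> ('n cell \<Rightarrow> 'n ext set) set" where
  "cap P K p1 q1 p2 q2 W H =
     (\<Union>w\<in>W. \<Union>c\<in>H. trop_class P K (p1 + p2) (q2 - q1) (cap_chain P K q1 q2 w c))"

definition edge_eval :: "(real ^ 'n) set \<Rightarrow> 'n::finite ext \<Rightarrow> (real ^ 'n) set \<Rightarrow> bit" where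
  "edge_eval \<sigma> u = (\<lambda>e\<in>{e. e edge_of \<sigma>}. pair (omega e) u)"

definition differential ::
    "(real ^ 'n \<Rightarrow> bit) \<Rightarrow> (real ^ 'n) set \<Rightarrow> (real ^ 'n) set \<Rightarrow> bit" where
  "differential \<epsilon> \<sigma> = (\<lambda>e\<in>{e. e edge_of \<sigma>}. \<Sum>v | v extreme_point_of e. \<epsilon> v)"

text \<open>
  The connecting morphism of \<open>0 \<rightarrow> \<W>\<^sub>1 \<rightarrow> N\<^sub>2 \<rightarrow> \<Z>\<^sup>1 \<rightarrow> 0\<close>, the second map being \<^const>\<open>edge_eval\<close>
  and \<open>N\<^sub>2\<close> being identified with its first exterior power. A section of \<open>\<Z>\<^sup>1\<close> is given by its values
  on the cells of dimension zero.
\<close>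

definition connecting ::
    "(real ^ 'n) set \<Rightarrow> (real ^ 'n) set set \<Rightarrow> ('n::finite cell \<Rightarrow> (real ^ 'n) set \<Rightarrow> bit)
       \<Rightarrow> ('n cell \<Rightarrow> 'n ext) set" where
  "connecting P K s =
     (\<Union>b\<in>{b \<in> cochains K (\<lambda>_. ext_power 1 UNIV) 0.
            \<forall>e\<in>fine_cells K 0. edge_eval (fst e) (b e) = s e}.
        cohom_class K (wave 1 \<circ> coarse_of P) 1 (coboundary K 0 b))"

definition hessian ::
    "(real ^ 'n) set \<Rightarrow> (real ^ 'n) set set \<Rightarrow> (real ^ 'n \<Rightarrow> bit)
       \<Rightarrow> ('n::finite cell \<Rightarrow> 'n ext) set" where
  "hessian P K \<epsilon> = connecting P K (\<lambda>e. differential \<epsilon> (fst e))"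

section \<open>T-hypersurfaces and the Renaudineau-Shaw operator\<close>

text \<open>
  Points of the real locus are classes of \<open>N\<^sub>2 \<times> P\<close>. As \<open>u\<close> and \<open>u'\<close> are glued over \<open>x\<close> modulo
  \<open>Sed\<close> of the smallest face containing \<open>x\<close>, \<open>copy P u E\<close> depends only on the coset of \<open>u\<close> modulo
  \<open>sed Q\<close> when \<open>E \<subseteq> Q\<close>.
\<close>

definition real_glue ::
    "(real ^ 'n) set \<Rightarrow> (((bit ^ 'n) \<times> (real ^ 'n)) \<times> ((bit ^ 'n) \<times> (real ^ 'n))) set" where
  "real_glue P = {((u, x), (u', x')). x \<in> P \<and> x' = x \<and> u - u' \<in> sed (min_face P {x})}"

text \<open>\<open>u \<cdot> E\<close>, as a set of points of \<open>\<real>Y = (N\<^sub>2 \<times> P) // real_glue P\<close>.\<close>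

definition copy ::
    "(real ^ 'n) set \<Rightarrow> bit ^ 'n \<Rightarrow> (real ^ 'n) set \<Rightarrow> ((bit ^ 'n) \<times> (real ^ 'n)) set set" where
  "copy P u E = (\<lambda>x. real_glue P `` {(u, x)}) ` E"

definition T_hypersurface ::
    "(real ^ 'n) set \<Rightarrow> (real ^ 'n) set set \<Rightarrow> (real ^ 'n \<Rightarrow> bit)
       \<Rightarrow> ((bit ^ 'n) \<times> (real ^ 'n)) set set" where
  "T_hypersurface P K \<epsilon> = \<Union> {copy P u (dual_cell K (closed_segment v0 v1) P) | u v0 v1 m.
     closed_segment v0 v1 \<in> K \<and> v0 \<noteq> v1 \<and> v0 - v1 = lat m \<and>
     pair (mod2 m) u + \<epsilon> v0 + \<epsilon> v1 = 1}"

text \<open>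
  The group algebra \<open>F\<^sub>2[N\<^sub>2 / S]\<close> consists of the formal sums of cosets of \<open>S\<close>. Its product is the
  one of \<^typ>\<open>(bit ^ 'n) set \<Rightarrow>\<^sub>0 bit\<close>, as the group law of \<open>N\<^sub>2 / S\<close> is addition of
  sets; but its unit is \<open>gen S\<close>, not \<open>1\<close>.
\<close>

type_synonym 'n galg = "(bit ^ 'n) set \<Rightarrow>\<^sub>0 bit"

definition gen :: "(bit ^ 'n) set \<Rightarrow> 'n::finite galg" where
  "gen U = Poly_Mapping.single U 1"

definition group_algebra :: "(bit ^ 'n) set \<Rightarrow> ('n::finite galg) set" where
  "group_algebra S = {a. Poly_Mapping.keys a \<subseteq> range (\<lambda>u. u +o S)}"

definition galg_proj :: "(bit ^ 'n) set \<Rightarrow> 'n::finite galg \<Rightarrow> 'n galg" where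
  "galg_proj S' a =
     (\<Sum>U\<in>Poly_Mapping.keys a. Poly_Mapping.single (U + S') (Poly_Mapping.lookup a U))"

definition aug_ideal :: "(bit ^ 'n) set \<Rightarrow> ('n::finite galg) set" where
  "aug_ideal S =
     {a \<in> group_algebra S. (\<Sum>U\<in>Poly_Mapping.keys a. Poly_Mapping.lookup a U) = 0}"

fun aug_power :: "nat \<Rightarrow> (bit ^ 'n) set \<Rightarrow> ('n::finite galg) set" where
  "aug_power 0 S = group_algebra S"
| "aug_power (Suc p) S = {(\<Sum>i<k. a i * b i) | (k::nat) a b.
     \<forall>i<k. a i \<in> aug_ideal S \<and> b i \<in> aug_power p S}"

definition sign_cosheaf ::
    "(real ^ 'n) set \<Rightarrow> (real ^ 'n) set set \<Rightarrow> (real ^ 'n \<Rightarrow> bit) \<Rightarrow> nat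
       \<Rightarrow> ('n::finite cell, 'n galg) cosheaf" where
  "sign_cosheaf P K \<epsilon> p =
     \<lparr> stalk = (\<lambda>(\<sigma>, Q). {a \<in> aug_power p (sed Q). Poly_Mapping.keys a \<subseteq>
          {u +o sed Q | u. copy P u (dual_cell K \<sigma> Q) \<subseteq> T_hypersurface P K \<epsilon>}}),
       zero_at = (\<lambda>_. 0),
       trans_map = (\<lambda>_ (\<sigma>', Q'). galg_proj (sed Q')) \<rparr>"

text \<open>The linear map defined by its values on the products \<open>x(u0) (1 + x(u1)) ... (1 + x(up))\<close>, \<open>1 = x(0)\<close>
  is \<^term>\<open>gen S\<close>.\<close>

definition bv :: "nat \<Rightarrow> (bit ^ 'n) set \<Rightarrow> 'n::finite galg \<Rightarrow> 'n ext set" where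
  "bv p S = (THE f. f \<in> extensional (aug_power p S) \<and>
     (\<forall>a\<in>aug_power p S. \<forall>b\<in>aug_power p S. f (a + b) = f a + f b) \<and>
     (\<forall>u0 us. length us = p \<longrightarrow>
        f (gen (u0 +o S) * (\<Prod>u\<leftarrow>us. gen S + gen (u +o S))) = wedge_list us +o ext_ideal S))"

definition bv_chain ::
    "(real ^ 'n) set \<Rightarrow> (real ^ 'n) set set \<Rightarrow> nat \<Rightarrow> int
       \<Rightarrow> ('n::finite cell \<Rightarrow> 'n galg) \<Rightarrow> 'n cell \<Rightarrow> 'n ext set" where
  "bv_chain P K p q c = (\<lambda>(\<sigma>, \<tau>)\<in>fine_cells K q. bv p (sed (min_face P \<tau>)) (c (\<sigma>, \<tau>)))"

definition partial_eps ::
    "(real ^ 'n) set \<Rightarrow> (real ^ 'n) set set \<Rightarrow> (real ^ 'n \<Rightarrow> bit) \<Rightarrow> nat \<Rightarrow> int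
       \<Rightarrow> ('n::finite cell \<Rightarrow> 'n ext set) set \<Rightarrow> ('n cell \<Rightarrow> 'n ext set) set" where
  "partial_eps P K \<epsilon> p q H =
     (\<Union>c\<in>{c \<in> chains K (on_fine P (sign_cosheaf P K \<epsilon> p)) q. bv_chain P K p q c \<in> H}.
        trop_class P K (p + 1) (q - 1)
          (bv_chain P K (p + 1) (q - 1) (boundary K (on_fine P (sign_cosheaf P K \<epsilon> p)) q c)))"

end

theory Submission
  imports Defs
begin

text \<open>
  Choose for every simplex \<open>\<rho>\<close> a vector \<open>b \<rho>\<close> of \<open>N\<^sub>2\<close> whose differences along the edges of \<open>\<rho>\<close> are
  those of \<open>\<epsilon> + \<chi>\<^sub>\<sigma>\<close>; the Hessian wave is the coboundary of \<open>b\<close>. As \<open>\<omega>\<^sup>*(\<sigma>) = u\<^sub>1 \<and> \<dots> \<and> u\<^sub>p\<close> pairs to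
  one with \<open>\<omega>(\<sigma>)\<close>, the only element of the span of the \<open>u\<^sub>i\<close> orthogonal to \<open>\<sigma>\<close> is zero. Hence all
  points of the affine space \<open>b \<tau> + \<langle>u\<^sub>1, \<dots>, u\<^sub>p\<rangle>\<close> satisfy the sign condition for some edge of any
  \<open>\<rho> \<le> \<tau>\<close> that properly contains \<open>\<sigma>\<close>, and the elements \<open>x(b \<tau>) (1 + x(u\<^sub>1)) \<dots> (1 + x(u\<^sub>p))\<close> on the cells
  \<open>[\<rho>, \<tau>]\<close> with \<open>\<rho> \<ge> \<sigma>\<close> and \<open>\<tau>\<close> maximal form a lift of the face cycle. An interior simplex of
  codimension one has exactly two cofacets \<open>\<tau>\<^sub>1\<close>, \<open>\<tau>\<^sub>2\<close>, so that the boundary of this lift is made of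
  the elements \<open>x(b \<tau>\<^sub>1) (1 + x(b \<tau>\<^sub>1 + b \<tau>\<^sub>2)) (1 + x(u\<^sub>1)) \<dots> (1 + x(u\<^sub>p))\<close>. Their leading terms
  \<open>(b \<tau>\<^sub>1 + b \<tau>\<^sub>2) \<and> u\<^sub>1 \<and> \<dots> \<and> u\<^sub>p\<close> are exactly the values of the cap-product: the two sides agree already
  as chains.

  That both operations do not depend on the representatives is linear algebra over the field with
  two elements. The group algebra \<open>F\<^sub>2[N\<^sub>2]\<close> is identified with the exterior algebra by
  \<open>x(u) \<mapsto> \<Prod> (1 + e\<^sub>i)\<close>, the product over the \<open>i\<close> with \<open>u\<^sub>i = 1\<close>. This is an isomorphism of rings that
  turns the powers of the augmentation ideal into the filtration by degree and \<open>bv\<close> into taking the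
  leading term.
\<close>

text \<open>The summand \<chi> of \<sigma> settles a conflict. At \<open>b \<tau>\<close> + u with u
  \<noteq> 0 some edge inside \<sigma> detects u, and along it the prescribed differences must be
  those of \<epsilon>. At \<open>b \<tau>\<close> itself all edges inside \<sigma> then fail the
  sign condition, so an edge leaving \<sigma> has to satisfy it; \<chi> is constant on \<sigma> and
  jumps by one along exactly the edges that leave it. The vectors \<open>b \<rho>\<close> exist
  because the simplices are unimodular: any integers on the vertices are the values of an integral
  affine function.

  Independence of the lift needs that \<open>bv\<close> maps the sign cosheaf both into F_p and onto
  F_p over each cell. The first is not formal: the support of an element is a union of affine
  hyperplanes, and its leading term has to be split into one term for each edge. This is done by
  induction on the number of edge conditions. Quotients by Sed are avoided by computing with
  representatives over N_2, transported along an additive choice of one representative in each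
  coset.\<close>

declare add_bit_eq_xor [simp del] mult_bit_eq_and [simp del]

section \<open>Vector spaces over the field with two elements\<close>

instance bit :: finite
proof
  have "(UNIV :: bit set) = {0, 1}" by (auto simp: UNIV_eq_I)
  then show "finite (UNIV :: bit set)" by (metis finite.simps)
qed

lemma bit_add_self [simp]: "(x :: bit) + x = 0"
  by (cases x) simp_all

lemma bit_vec_add_self [simp]: "(x :: bit ^ 'a) + x = 0"
  by (simp add: vec_eq_iff)

lemma bit_pm_add_self [simp]: "(a :: 'a \<Rightarrow>\<^sub>0 bit) + a = 0"
  by (rule poly_mapping_eqI) (simp add: lookup_add)

lemma bit_vec_add_self_left [simp]: "(x :: bit ^ 'a) + (x + y) = y"
  by (simp flip: add.assoc)

lemma bit_vec_two [simp]: "(2 :: bit ^ 'a) = 0"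
  using bit_vec_add_self[of "1 :: bit ^ 'a"] by (simp only: one_add_one)

lemma bit_pm_two [simp]: "(2 :: 'a::comm_monoid_add \<Rightarrow>\<^sub>0 bit) = 0"
  using bit_pm_add_self[of "1 :: 'a \<Rightarrow>\<^sub>0 bit"] by (simp only: one_add_one)

lemma bit_vec_subspaceI:
  assumes "0 \<in> V" "\<And>x y. x \<in> V \<Longrightarrow> y \<in> V \<Longrightarrow> x + y \<in> V"
  shows "vec.subspace (V :: (bit ^ 'a) set)"
proof -
  have "c *s x \<in> V" if "x \<in> V" for c x
    using assms that by (cases c) auto
  with assms show ?thesis by (simp add: vec.subspace_def)
qed

lemma bit_span_induct [consumes 1, case_names base zero add]:
  assumes "x \<in> vec.span (B :: (bit ^ 'a) set)" and "\<And>b. b \<in> B \<Longrightarrow> P b" and "P 0"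
    and "\<And>x y. x \<in> vec.span B \<Longrightarrow> y \<in> vec.span B \<Longrightarrow> P x \<Longrightarrow> P y \<Longrightarrow> P (x + y)"
  shows "P x"
proof -
  have "vec.subspace {x \<in> vec.span B. P x}"
    by (rule bit_vec_subspaceI) (auto simp: assms vec.span_zero vec.span_add)
  then have "vec.span B \<subseteq> {x \<in> vec.span B. P x}"
    by (intro vec.span_minimal) (auto simp: assms vec.span_base)
  with assms(1) show ?thesis by auto
qed

text \<open>A basis of \<open>S\<close> is extended to the whole space; \<pi> kills the basis of
  \<open>S\<close> and fixes the added vectors. Thus \<pi> chooses additively one representative in
  each coset of \<open>S\<close>.\<close>

lemma exists_projection:
  assumes "vec.subspace (S :: (bit ^ 'n) set)"
  obtains \<pi> :: "bit ^ 'n \<Rightarrow> bit ^ 'n"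
  where "\<And>u v. \<pi> (u + v) = \<pi> u + \<pi> v" "\<And>u. u + \<pi> u \<in> S" "\<And>s. s \<in> S \<Longrightarrow> \<pi> s = 0"
proof -
  obtain B where B: "B \<subseteq> S" "vec.independent B" "S \<subseteq> vec.span B"
    using vec.basis_exists by metis
  define B' where "B' = vec.extend_basis B"
  have B': "B \<subseteq> B'" "vec.independent B'" "vec.span B' = UNIV"
    using vec.extend_basis_superset vec.independent_extend_basis vec.span_extend_basis B(2)
    unfolding B'_def by blast+
  obtain \<pi> where \<pi>: "Vector_Spaces.linear (*s) (*s) \<pi>" "\<forall>x\<in>B'. \<pi> x = (if x \<in> B then 0 else x)"
    using vec.linear_independent_extend[OF B'(2), of "\<lambda>x. if x \<in> B then 0 else x"] by metis
  interpret \<pi>: Vector_Spaces.linear "(*s)" "(*s)" \<pi> by (rule \<pi>(1))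
  have "u + \<pi> u \<in> S" for u
  proof -
    have "u \<in> vec.span B'" using B'(3) by auto
    then show ?thesis
    proof (induction rule: bit_span_induct)
      case (base b)
      then show ?case using \<pi>(2) B(1) assms by (auto simp: vec.subspace_0)
    next
      case (add x y)
      then have "(x + \<pi> x) + (y + \<pi> y) \<in> S" using assms vec.subspace_add by blast
      then show ?case by (simp add: \<pi>.add algebra_simps)
    qed (use assms in \<open>auto simp: \<pi>.zero vec.subspace_0\<close>)
  qed
  moreover have "\<pi> s = 0" if "s \<in> S" for s
  proof -
    have "s \<in> vec.span B" using that B by auto
    then show ?thesis
      by (induction rule: bit_span_induct) (use \<pi>(2) B' in \<open>auto simp: \<pi>.add \<pi>.zero\<close>)
  qed
  ultimately show ?thesis using that \<pi>.add by blast
qed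

lemma coset_add:
  assumes "vec.subspace (S :: (bit ^ 'n) set)"
  shows "(x +o S) + (y +o S) = (x + y) +o S"
proof -
  have "S + S = S"
    using assms vec.subspace_0 vec.subspace_add by (force simp: set_plus_def)
  then show ?thesis by (simp add: set_plus_rearrange)
qed

lemma coset_add_subspace:
  assumes "vec.subspace (S :: (bit ^ 'n) set)" "vec.subspace S'" "S \<subseteq> S'"
  shows "(x +o S) + S' = x +o S'"
proof -
  have "S + S' = S'"
    using assms vec.subspace_0[of S'] vec.subspace_0[of S] vec.subspace_add[of S']
    by (auto simp: set_plus_def) (metis add_0)
  then show ?thesis by (simp add: set_plus_rearrange3)
qed

lemma coset_eq_iff:
  assumes "vec.subspace (S :: (bit ^ 'n) set)"
  shows "x +o S = y +o S \<longleftrightarrow> x + y \<in> S"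
proof
  assume "x +o S = y +o S"
  moreover have "x \<in> x +o S"
    using assms vec.subspace_0 by (force simp: elt_set_plus_def)
  ultimately show "x + y \<in> S"
    by (auto simp: elt_set_plus_def ac_simps)
next
  assume *: "x + y \<in> S"
  have "x +o S \<subseteq> y +o S" if "x + y \<in> S" for x y
  proof
    fix z assume "z \<in> x +o S"
    then obtain s where s: "s \<in> S" "z = x + s" by (auto simp: elt_set_plus_def)
    have "(x + y) + s = y + (x + s)" by (simp only: ac_simps)
    then have "z = y + ((x + y) + s)" using s by (simp only: bit_vec_add_self_left)
    moreover have "(x + y) + s \<in> S" using s that assms vec.subspace_add by blast
    ultimately show "z \<in> y +o S" unfolding elt_set_plus_def by blast
  qed
  from this[OF *] this[of y x] * show "x +o S = y +o S" by (auto simp: add.commute)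
qed

text \<open>An empty sum of sets is \<open>{0}\<close>, not the zero coset; the extra summand
  \<open>S\<close> repairs this case and is absorbed in all others.\<close>

lemma coset_sum:
  assumes "vec.subspace (S :: (bit ^ 'n) set)"
  shows "S + (\<Sum>i\<in>I. x i +o S) = (\<Sum>i\<in>I. x i) +o S"
proof (induction I rule: infinite_finite_induct)
  case (insert i I)
  have "S + ((x i +o S) + (\<Sum>i\<in>I. x i +o S)) = (x i +o S) + (S + (\<Sum>i\<in>I. x i +o S))"
    by (simp add: ac_simps)
  with insert show ?case by (simp add: coset_add[OF assms])
qed (simp_all)

section \<open>Linear extension from the basis of group elements\<close>

definition bit_scale :: "bit \<Rightarrow> 'a::zero \<Rightarrow> 'a" where
  "bit_scale c x = (if c = 1 then x else 0)"

lemma bit_scale_simps [simp]: "bit_scale 0 x = 0" "bit_scale 1 x = x" "bit_scale c 0 = 0"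
  by (simp_all add: bit_scale_def)

lemma bit_scale_add:
  assumes "x + x = (0::'a::comm_monoid_add)"
  shows "bit_scale (c + d) x = bit_scale c x + bit_scale d x"
  by (cases c; cases d) (auto simp: assms)

lemma bit_scale_mult: "bit_scale c x * bit_scale d y = bit_scale (c * d) (x * y :: 'a::mult_zero)"
  by (cases c; cases d) simp_all

text \<open>Linear extension of a map given on group elements. For additivity every element of the
  target has to be its own negative, which \<open>bit_lin_add\<close> assumes.\<close>

definition bit_lin :: "('k::finite \<Rightarrow> 'a::comm_monoid_add) \<Rightarrow> ('k \<Rightarrow>\<^sub>0 bit) \<Rightarrow> 'a" where
  "bit_lin g a = (\<Sum>u\<in>UNIV. bit_scale (Poly_Mapping.lookup a u) (g u))"

lemma bit_lin_0 [simp]: "bit_lin g 0 = 0"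
  by (simp add: bit_lin_def)

lemma bit_lin_add:
  assumes "\<And>x :: 'a::comm_monoid_add. x + x = 0"
  shows "bit_lin (g :: _ \<Rightarrow> 'a) (a + b) = bit_lin g a + bit_lin g b"
  by (simp add: bit_lin_def lookup_add bit_scale_add[OF assms] sum.distrib)

lemma bit_lin_single [simp]: "bit_lin g (Poly_Mapping.single u 1) = g u"
proof -
  have "bit_lin g (Poly_Mapping.single u 1) = (\<Sum>v\<in>UNIV. if v = u then g u else 0)"
    unfolding bit_lin_def by (intro sum.cong) (auto simp: lookup_single when_def)
  then show ?thesis by simp
qed

lemma bit_lin_keys: "bit_lin g a = (\<Sum>u\<in>Poly_Mapping.keys a. g u)"
  unfolding bit_lin_def
  by (rule sum.mono_neutral_cong_right) (auto simp: in_keys_iff bit_scale_def)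

lemma pm_bit_expansion: "a = (\<Sum>u\<in>Poly_Mapping.keys (a :: 'k \<Rightarrow>\<^sub>0 bit). Poly_Mapping.single u 1)"
proof (rule poly_mapping_eqI)
  fix k
  have "Poly_Mapping.lookup (\<Sum>u\<in>Poly_Mapping.keys a. Poly_Mapping.single u 1) k
      = (\<Sum>u\<in>Poly_Mapping.keys a. if u = k then 1 else 0)"
    unfolding lookup_sum by (intro sum.cong) (auto simp: lookup_single when_def)
  also have "\<dots> = Poly_Mapping.lookup a k"
    by (cases "k \<in> Poly_Mapping.keys a") (auto simp: in_keys_iff)
  finally show "Poly_Mapping.lookup a k = Poly_Mapping.lookup (\<Sum>u\<in>Poly_Mapping.keys a. Poly_Mapping.single u 1) k"
    by simp
qed

lemma pm_bit_induct [case_names zero single add]: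
  assumes "P 0" "\<And>u. P (Poly_Mapping.single u 1)" "\<And>a b. P a \<Longrightarrow> P b \<Longrightarrow> P (a + b)"
  shows "P (a :: 'k \<Rightarrow>\<^sub>0 bit)"
proof -
  have "P (\<Sum>u\<in>A. Poly_Mapping.single u 1)" if "finite A" for A
    using that by induction (auto simp: assms)
  then show ?thesis using pm_bit_expansion[of a] finite_keys by metis
qed

lemma pm_bit_induct_keys [consumes 1, case_names zero single add]:
  assumes "Poly_Mapping.keys a \<subseteq> A" and "P 0" "\<And>u. u \<in> A \<Longrightarrow> P (Poly_Mapping.single u 1)"
    "\<And>a b. P a \<Longrightarrow> P b \<Longrightarrow> P (a + b)"
  shows "P (a :: 'k \<Rightarrow>\<^sub>0 bit)"
proof -
  have "P (\<Sum>u\<in>B. Poly_Mapping.single u 1)" if "finite B" "B \<subseteq> A" for B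
    using that by induction (auto simp: assms)
  then show ?thesis using pm_bit_expansion[of a] finite_keys assms(1) by metis
qed

section \<open>The group algebra and the exterior algebra\<close>

type_synonym 'n grp_alg = "(bit ^ 'n) \<Rightarrow>\<^sub>0 bit"

definition xpow :: "bit ^ 'n \<Rightarrow> 'n::finite grp_alg" where
  "xpow u = Poly_Mapping.single u 1"

lemma xpow_add: "xpow (u + v) = xpow u * xpow v"
  by (simp add: xpow_def mult_single)

lemma xpow_0 [simp]: "xpow 0 = 1"
  by (simp add: xpow_def)

lemma xpow_mult_self [simp]: "xpow u * xpow u = 1"
  by (simp flip: xpow_add)

lemma bit_lin_xpow [simp]: "bit_lin g (xpow u) = g u"
  by (simp add: xpow_def)

lemma grp_alg_induct [case_names zero xpow add]:
  assumes "P 0" "\<And>u. P (xpow u)" "\<And>a b. P a \<Longrightarrow> P b \<Longrightarrow> P (a + b)"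
  shows "P (a :: 'n::finite grp_alg)"
  using pm_bit_induct[of P a] assms unfolding xpow_def by blast

lemma bit_lin_mult:
  fixes g :: "bit ^ 'n::finite \<Rightarrow> 'a::comm_semiring_0"
  assumes "\<And>x :: 'a. x + x = 0" and "\<And>u v. g (u + v) = g u * g v"
  shows "bit_lin g (a * b) = bit_lin g a * bit_lin g b"
proof (induction a rule: grp_alg_induct)
  case (xpow u)
  show ?case
    by (induction b rule: grp_alg_induct) (simp_all add: assms bit_lin_add[OF assms(1)] distrib_left flip: xpow_add)
qed (simp_all add: bit_lin_add[OF assms(1)] distrib_right)

text \<open>Coordinates of the product of the 1 + e_i with u_i = 1: the coefficient at e_A is one
  exactly if A lies in the support of u.\<close>

definition sqfree :: "bit ^ 'n \<Rightarrow> 'n::finite ext" where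
  "sqfree u = (\<chi> A. \<Prod>i\<in>A. u $ i)"

definition to_ext :: "'n::finite grp_alg \<Rightarrow> 'n ext" where
  "to_ext = bit_lin sqfree"

lemma to_ext_0 [simp]: "to_ext 0 = 0" and to_ext_add [simp]: "to_ext (a + b) = to_ext a + to_ext b"
  and to_ext_xpow [simp]: "to_ext (xpow u) = sqfree u"
  by (simp_all add: to_ext_def bit_lin_add)

lemma wedge_0 [simp]: "wedge 0 x = 0" "wedge x 0 = 0"
  by (simp_all add: wedge_def vec_eq_iff)

lemma wedge_add: "wedge (x + y) z = wedge x z + wedge y z" "wedge z (x + y) = wedge z x + wedge z y"
  by (simp_all add: wedge_def vec_eq_iff distrib_left distrib_right sum.distrib)

lemma wedge_sum: "wedge (sum f I) z = (\<Sum>i\<in>I. wedge (f i) z)" "wedge z (sum f I) = (\<Sum>i\<in>I. wedge z (f i))"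
  by (induction I rule: infinite_finite_induct) (simp_all add: wedge_add)

lemma wedge_nth: "wedge x y $ C = (\<Sum>A\<in>Pow C. x $ A * y $ (C - A))"
  by (simp add: wedge_def)

text \<open>Expanding the product of the u_i + v_i over C by distributivity gives the sum over the
  splittings of C that defines \<open>wedge\<close>.\<close>

lemma sqfree_add: "sqfree (u + v) = wedge (sqfree u) (sqfree v)"
  by (simp add: sqfree_def wedge_def vec_eq_iff prod_add[OF finite])

lemma to_ext_mult: "to_ext (a * b) = wedge (to_ext a) (to_ext b)"
proof (induction a rule: grp_alg_induct)
  case (xpow u)
  show ?case
    by (induction b rule: grp_alg_induct) (simp_all add: wedge_add distrib_left sqfree_add flip: xpow_add)
qed (simp_all add: wedge_add distrib_right)

lemma to_ext_1: "to_ext 1 = ext_one"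
proof -
  have "(\<Prod>i\<in>A. (0::bit)) = of_bool (A = {})" for A :: "'a set"
    by (cases "A = {}") (simp_all add: card_gt_0_iff)
  then have "sqfree (0 :: bit ^ 'a) = ext_one"
    by (simp add: sqfree_def ext_one_def vec_eq_iff)
  then show ?thesis by (metis xpow_0 to_ext_xpow)
qed

lemma wedge_axis:
  "wedge (axis A 1) (axis B 1) = (if A \<inter> B = {} then axis (A \<union> B) 1 else (0 :: 'n::finite ext))"
proof -
  have "(\<Sum>D\<in>Pow C. axis A 1 $ D * axis B 1 $ (C - D))
      = (if A \<inter> B = {} \<and> C = A \<union> B then 1 else (0::bit))" for C
  proof -
    have "(\<Sum>D\<in>Pow C. axis A 1 $ D * axis B 1 $ (C - D))
        = (\<Sum>D\<in>Pow C. if D = A then axis B 1 $ (C - A) else (0::bit))"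
      by (intro sum.cong) (auto simp: axis_def)
    also have "\<dots> = (if A \<subseteq> C then axis B 1 $ (C - A) else 0)"
      by (simp add: sum.delta)
    also have "\<dots> = (if A \<inter> B = {} \<and> C = A \<union> B then 1 else (0::bit))"
      by (auto simp: axis_def)
    finally show ?thesis .
  qed
  then show ?thesis by (auto simp: wedge_def vec_eq_iff axis_def)
qed

text \<open>The preimage of e_A under \<open>to_ext\<close>, since 1 + x(e_i) is sent to
  e_i.\<close>

definition aug_monomial :: "'n set \<Rightarrow> 'n::finite grp_alg" where
  "aug_monomial A = (\<Prod>i\<in>A. 1 + xpow (axis i 1))"

lemma ext_one_axis: "ext_one = axis {} 1"
  by (auto simp: ext_one_def axis_def vec_eq_iff)

lemma to_ext_aug_monomial: "to_ext (aug_monomial A) = axis A 1"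
proof (induction A rule: infinite_finite_induct)
  case (insert i A)
  have "to_ext (1 + xpow (axis i 1)) $ B = (axis {i} 1 :: 'a ext) $ B" for B
  proof -
    consider "B = {}" | "B = {i}" | j where "j \<in> B" "j \<noteq> i" by blast
    then show ?thesis
    proof cases
      case 3
      then have "(\<Prod>k\<in>B. axis i (1::bit) $ k) = 0"
        by (intro prod_zero) (auto simp: axis_def intro!: bexI[of _ j])
      with 3 show ?thesis by (auto simp: to_ext_1 sqfree_def ext_one_def axis_def)
    qed (auto simp: to_ext_1 sqfree_def ext_one_def axis_def)
  qed
  then have "to_ext (1 + xpow (axis i 1)) = axis {i} 1" by (simp add: vec_eq_iff)
  with insert show ?case by (simp add: aug_monomial_def to_ext_mult wedge_axis)
qed (simp_all add: aug_monomial_def to_ext_1 ext_one_axis)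

definition of_ext :: "'n::finite ext \<Rightarrow> 'n grp_alg" where
  "of_ext x = (\<Sum>A\<in>UNIV. bit_scale (x $ A) (aug_monomial A))"

lemma of_ext_0 [simp]: "of_ext 0 = 0" and of_ext_add [simp]: "of_ext (x + y) = of_ext x + of_ext y"
  by (simp_all add: of_ext_def bit_scale_add sum.distrib)

lemma of_ext_axis [simp]: "of_ext (axis A 1) = aug_monomial A"
proof -
  have "of_ext (axis A 1) = (\<Sum>B\<in>UNIV. if B = A then aug_monomial A else 0)"
    unfolding of_ext_def by (intro sum.cong) (auto simp: axis_def)
  then show ?thesis by simp
qed

lemma ext_expansion: "x = (\<Sum>A\<in>UNIV. bit_scale (x $ A) (axis A 1 :: 'n::finite ext))"
proof -
  have "(\<Sum>A\<in>UNIV. bit_scale (x $ A) (axis A (1::bit)) $ B) = x $ B" for B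
  proof -
    have "(\<Sum>A\<in>UNIV. bit_scale (x $ A) (axis A (1::bit)) $ B) = (\<Sum>A\<in>UNIV. if A = B then x $ B else 0)"
      by (intro sum.cong) (auto simp: axis_def bit_scale_def)
    then show ?thesis by simp
  qed
  then show ?thesis by (simp add: vec_eq_iff)
qed

lemma ext_induct [case_names zero axis add]:
  assumes "P 0" "\<And>A. P (axis A 1)" "\<And>x y. P x \<Longrightarrow> P y \<Longrightarrow> P (x + y)"
  shows "P (x :: 'n::finite ext)"
proof -
  have "P (\<Sum>A\<in>\<A>. bit_scale (x $ A) (axis A 1))" for \<A>
    by (induction \<A> rule: infinite_finite_induct) (auto simp: assms bit_scale_def)
  then show ?thesis by (metis ext_expansion)
qed

lemma to_ext_of_ext [simp]: "to_ext (of_ext x) = x"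
  by (induction x rule: ext_induct) (simp_all add: to_ext_aug_monomial)

lemma of_ext_to_ext [simp]: "of_ext (to_ext a) = a"
proof (induction a rule: grp_alg_induct)
  case (xpow u)
  \<comment> \<open>x(u) is the product of the x(e_i) over the support of u, and x(e_i) = 1 + (1 +
    x(e_i)); expanding this product produces the coefficients of \<open>sqfree u\<close>.\<close>
  have "xpow u = (\<Prod>i\<in>UNIV. 1 + bit_scale (u $ i) (1 + xpow (axis i 1)))"
  proof -
    have *: "xpow (\<Sum>i\<in>I. bit_scale (u $ i) (axis i 1)) = (\<Prod>i\<in>I. 1 + bit_scale (u $ i) (1 + xpow (axis i 1)))" if "finite I" for I
      using that by induction (auto simp: xpow_add bit_scale_def)
    have "(\<Sum>i\<in>UNIV. bit_scale (u $ i) (axis i 1)) = u"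
    proof -
      have "(\<Sum>i\<in>UNIV. bit_scale (u $ i) (axis i (1::bit)) $ j) = u $ j" for j
      proof -
        have "(\<Sum>i\<in>UNIV. bit_scale (u $ i) (axis i (1::bit)) $ j) = (\<Sum>i\<in>UNIV. if i = j then u $ j else 0)"
          by (intro sum.cong) (auto simp: axis_def bit_scale_def)
        then show ?thesis by simp
      qed
      then show ?thesis by (simp add: vec_eq_iff)
    qed
    with *[OF finite[of UNIV]] show ?thesis by simp
  qed
  also have "\<dots> = (\<Prod>i\<in>UNIV. bit_scale (u $ i) (1 + xpow (axis i 1)) + 1)" by (simp add: add.commute)
  also have "\<dots> = (\<Sum>A\<in>UNIV. \<Prod>i\<in>A. bit_scale (u $ i) (1 + xpow (axis i 1)))"
    by (subst prod_add) auto
  also have "\<dots> = of_ext (sqfree u)"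
    unfolding of_ext_def
  proof (intro sum.cong refl)
    fix A
    show "(\<Prod>i\<in>A. bit_scale (u $ i) (1 + xpow (axis i 1))) = bit_scale (sqfree u $ A) (aug_monomial A)"
    proof (induction A rule: infinite_finite_induct)
      case (insert i A)
      then show ?case by (simp add: sqfree_def aug_monomial_def bit_scale_mult)
    qed (auto simp: sqfree_def aug_monomial_def)
  qed
  finally show ?case by simp
qed simp_all

text \<open>The product is transported by a bijective ring map, so commutativity and associativity
  of \<open>wedge\<close> are inherited from the convolution product.\<close>

lemma wedge_eq_to_ext: "wedge x y = to_ext (of_ext x * of_ext y)"
  by (simp add: to_ext_mult)

lemma wedge_commute: "wedge x y = wedge y x"
  by (simp add: wedge_eq_to_ext mult.commute)

lemma wedge_assoc: "wedge (wedge x y) z = wedge x (wedge y z)"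
  by (simp add: wedge_eq_to_ext mult.assoc)

lemma wedge_left_commute: "wedge x (wedge y z) = wedge y (wedge x z)"
  by (metis wedge_assoc wedge_commute)

lemma wedge_one [simp]: "wedge ext_one x = x" "wedge x ext_one = x"
  by (metis mult_1 to_ext_1 to_ext_mult to_ext_of_ext) (metis mult_1_right to_ext_1 to_ext_mult to_ext_of_ext)

section \<open>Filtration by degree and leading terms\<close>

definition aug_filt :: "nat \<Rightarrow> 'n::finite grp_alg set" where
  "aug_filt p = {a. \<forall>A. card A < p \<longrightarrow> to_ext a $ A = 0}"

definition lead_part :: "nat \<Rightarrow> 'n::finite grp_alg \<Rightarrow> 'n ext" where
  "lead_part p a = (\<chi> A. if card A = p then to_ext a $ A else 0)"

lemma aug_filt_0 [simp]: "aug_filt 0 = UNIV"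
  by (simp add: aug_filt_def)

lemma aug_filt_antimono: "p \<le> q \<Longrightarrow> aug_filt q \<subseteq> aug_filt p"
  by (auto simp: aug_filt_def)

lemma zero_in_aug_filt [simp]: "0 \<in> aug_filt p"
  by (simp add: aug_filt_def)

lemma aug_filt_add: "a \<in> aug_filt p \<Longrightarrow> b \<in> aug_filt p \<Longrightarrow> a + b \<in> aug_filt p"
  by (simp add: aug_filt_def)

lemma aug_filt_sum: "(\<And>i. i \<in> I \<Longrightarrow> f i \<in> aug_filt p) \<Longrightarrow> sum f I \<in> aug_filt p"
  by (induction I rule: infinite_finite_induct) (auto intro: aug_filt_add)

lemma lead_part_0 [simp]: "lead_part p 0 = 0" and lead_part_add [simp]: "lead_part p (a + b) = lead_part p a + lead_part p b"
  by (auto simp: lead_part_def vec_eq_iff)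

lemma lead_part_sum: "lead_part p (sum f I) = (\<Sum>i\<in>I. lead_part p (f i))"
  by (induction I rule: infinite_finite_induct) simp_all

lemma aug_filt_Suc_iff: "a \<in> aug_filt (Suc p) \<longleftrightarrow> a \<in> aug_filt p \<and> lead_part p a = 0"
  by (auto simp: aug_filt_def lead_part_def vec_eq_iff less_Suc_eq)

lemma aug_filt_mult:
  assumes "a \<in> aug_filt p" "b \<in> aug_filt q"
  shows "a * b \<in> aug_filt (p + q)"
proof -
  have "to_ext a $ B * to_ext b $ (C - B) = 0" if "card C < p + q" "B \<subseteq> C" for B C
  proof -
    have "card C = card B + card (C - B)"
      using that(2) by (metis card_Diff_subset card_mono finite le_add_diff_inverse)
    then have "card B < p \<or> card (C - B) < q" using that by linarith
    then show ?thesis using assms by (auto simp: aug_filt_def)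
  qed
  then show ?thesis by (auto simp: aug_filt_def to_ext_mult wedge_nth intro!: sum.neutral)
qed

lemma aug_filt_mult_left: "b \<in> aug_filt q \<Longrightarrow> a * b \<in> aug_filt q"
  using aug_filt_mult[of a 0 b q] by simp

text \<open>If C has p + q elements, only its splittings into parts of sizes p and q contribute: in
  any other, one part is too small for the filtration.\<close>

lemma lead_part_mult:
  assumes "a \<in> aug_filt p" "b \<in> aug_filt q"
  shows "lead_part (p + q) (a * b) = wedge (lead_part p a) (lead_part q b)"
proof -
  have "(if card C = p + q then to_ext (a * b) $ C else 0) = wedge (lead_part p a) (lead_part q b) $ C" for C
  proof (cases "card C = p + q")
    case True
    have "to_ext a $ B * to_ext b $ (C - B) = lead_part p a $ B * lead_part q b $ (C - B)" if "B \<subseteq> C" for B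
    proof -
      have "card C = card B + card (C - B)"
        using that by (metis card_Diff_subset card_mono finite le_add_diff_inverse)
      then have "card B < p \<or> card (C - B) < q \<or> card B = p \<and> card (C - B) = q"
        using True by linarith
      then show ?thesis using assms by (auto simp: aug_filt_def lead_part_def)
    qed
    with True show ?thesis by (auto simp: to_ext_mult wedge_nth intro!: sum.cong)
  next
    case False
    have "lead_part p a $ B * lead_part q b $ (C - B) = 0" if "B \<subseteq> C" for B
    proof -
      have "card C = card B + card (C - B)"
        using that by (metis card_Diff_subset card_mono finite le_add_diff_inverse)
      with False show ?thesis by (auto simp: lead_part_def)
    qed
    with False show ?thesis by (auto simp: wedge_nth intro!: sum.neutral)
  qed
  then show ?thesis by (simp add: lead_part_def vec_eq_iff)
qed

lemma ext_vec_0 [simp]: "ext_vec 0 = 0"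
  and ext_vec_add: "ext_vec (u + v) = ext_vec u + ext_vec v"
  by (simp_all add: ext_vec_def vec_eq_iff sum.distrib)

lemma ext_vec_nth: "ext_vec u $ {i} = u $ i" "card A \<noteq> 1 \<Longrightarrow> ext_vec u $ A = 0"
proof -
  have "{j. {i} = {j}} = {i}" by auto
  then show "ext_vec u $ {i} = u $ i" by (simp add: ext_vec_def)
  assume "card A \<noteq> 1"
  then have "{j. A = {j}} = {}" by auto
  then show "ext_vec u $ A = 0" by (simp add: ext_vec_def)
qed

lemma one_plus_xpow_aug_filt [simp]: "1 + xpow u \<in> aug_filt (Suc 0)"
  by (simp add: aug_filt_def to_ext_1 ext_one_def sqfree_def)

lemma lead_part_one_plus_xpow [simp]: "lead_part (Suc 0) (1 + xpow u) = ext_vec u"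
proof -
  have "(if card A = Suc 0 then to_ext (1 + xpow u) $ A else 0) = ext_vec u $ A" for A
  proof (cases "card A = 1")
    case True
    then obtain i where "A = {i}" by (auto simp: card_1_singleton_iff)
    then show ?thesis by (simp add: to_ext_1 ext_one_def sqfree_def ext_vec_nth)
  qed (simp add: ext_vec_nth)
  then show ?thesis by (simp add: lead_part_def vec_eq_iff)
qed

lemma lead_part_zero_xpow [simp]: "lead_part 0 (xpow u) = ext_one"
  by (auto simp: lead_part_def ext_one_def sqfree_def vec_eq_iff)

lemma lead_part_zero_one [simp]: "lead_part 0 1 = ext_one"
  using lead_part_zero_xpow[of 0] by simp

definition aug_prod :: "(bit ^ 'n::finite) list \<Rightarrow> 'n grp_alg" where
  "aug_prod us = (\<Prod>u\<leftarrow>us. 1 + xpow u)"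

lemma aug_prod_simps [simp]: "aug_prod [] = 1" "aug_prod (u # us) = (1 + xpow u) * aug_prod us"
  by (simp_all add: aug_prod_def)

lemma aug_prod_aug_filt: "aug_prod us \<in> aug_filt (length us)"
  by (induction us) (use aug_filt_mult[OF one_plus_xpow_aug_filt] in auto)

lemma lead_part_aug_prod: "lead_part (length us) (aug_prod us) = wedge_list us"
proof (induction us)
  case (Cons u us)
  then show ?case
    using lead_part_mult[OF one_plus_xpow_aug_filt[of u] aug_prod_aug_filt[of us]] by (simp add: wedge_list_def del: lead_part_add)
qed (simp add: wedge_list_def)

lemma xpow_aug_prod_aug_filt: "xpow u * aug_prod us \<in> aug_filt (length us)"
  by (simp add: aug_filt_mult_left aug_prod_aug_filt)

lemma lead_part_xpow_aug_prod: "lead_part (length us) (xpow u * aug_prod us) = wedge_list us"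
  using lead_part_mult[of "xpow u" 0 "aug_prod us" "length us", OF _ aug_prod_aug_filt] by (simp add: lead_part_aug_prod)

lemma aug_monomial_aug_prod:
  assumes "distinct is"
  shows "aug_monomial (set is) = aug_prod (map (\<lambda>i. axis i 1) is)"
  using assms by (induction "is") (simp_all add: aug_monomial_def)

text \<open>An e_A with at least p indices corresponds to p factors 1 + x(e_i) times some element of
  the group algebra, which is expanded into the x(u). Linear statements on the p-th step of the
  filtration are thereby reduced to the generators on which \<open>bv\<close> is prescribed.\<close>

lemma aug_filt_induct [consumes 1, case_names aug_prod add]:
  assumes "a \<in> aug_filt p"
    and aug_prod: "\<And>u us. length us = p \<Longrightarrow> P (xpow u * aug_prod us)"
    and add: "\<And>a b. a \<in> aug_filt p \<Longrightarrow> b \<in> aug_filt p \<Longrightarrow> P a \<Longrightarrow> P b \<Longrightarrow> P (a + b)"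
  shows "P (a :: 'n::finite grp_alg)"
proof -
  have zero: "P 0"
  proof -
    \<comment> \<open>Zero is a generator added to itself.\<close>
    have "P (xpow 0 * aug_prod (replicate p 0) + xpow 0 * aug_prod (replicate p 0))"
      by (intro add aug_prod xpow_aug_prod_aug_filt[of _ "replicate p 0", simplified]) auto
    then show ?thesis by simp
  qed
  have mult: "b * aug_prod us \<in> aug_filt p \<and> P (b * aug_prod us)" if "length us = p" for b us
  proof (induction b rule: grp_alg_induct)
    case (xpow u)
    then show ?case using aug_prod[of us u] xpow_aug_prod_aug_filt[of u us] that by simp
  qed (auto simp: zero distrib_right intro: aug_filt_add add)
  have aug_monomial: "aug_monomial A \<in> aug_filt p \<and> P (aug_monomial A)" if pA: "p \<le> card A" for A
  proof -
    obtain B where B: "B \<subseteq> A" "card B = p" using obtain_subset_with_card_n[OF pA] by blast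
    obtain xs where xs: "distinct xs" "set xs = B" using finite_distinct_list[OF finite[of B]] by blast
    have "length xs = p" using distinct_card[OF xs(1)] xs B by simp
    moreover have "aug_monomial A = aug_monomial (A - B) * aug_monomial B"
      unfolding aug_monomial_def using B by (metis finite mult.commute prod.subset_diff)
    ultimately show ?thesis
      using mult[of "map (\<lambda>i. axis i 1) xs" "aug_monomial (A - B)"] aug_monomial_aug_prod[OF xs(1)] xs by simp
  qed
  have "(\<Sum>A\<in>\<A>. bit_scale (to_ext a $ A) (aug_monomial A)) \<in> aug_filt p \<and> P (\<Sum>A\<in>\<A>. bit_scale (to_ext a $ A) (aug_monomial A))" for \<A>
  proof (induction \<A> rule: infinite_finite_induct)
    case (insert A \<A>)
    have "bit_scale (to_ext a $ A) (aug_monomial A) \<in> aug_filt p \<and> P (bit_scale (to_ext a $ A) (aug_monomial A))"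
    proof (cases "card A < p")
      case True
      then show ?thesis using assms(1) zero by (simp add: aug_filt_def)
    next
      case False
      then show ?thesis using aug_monomial[of A] zero by (simp add: bit_scale_def)
    qed
    with insert show ?case by (simp add: add aug_filt_add)
  qed (simp_all add: zero)
  then show ?thesis using of_ext_to_ext[of a] unfolding of_ext_def by metis
qed

section \<open>Push-forward along additive maps\<close>

definition pushfwd :: "(bit ^ 'n \<Rightarrow> bit ^ 'n) \<Rightarrow> 'n::finite grp_alg \<Rightarrow> 'n grp_alg" where
  "pushfwd f = bit_lin (\<lambda>u. xpow (f u))"

lemma pushfwd_0 [simp]: "pushfwd f 0 = 0" and pushfwd_add [simp]: "pushfwd f (a + b) = pushfwd f a + pushfwd f b"
  and pushfwd_xpow [simp]: "pushfwd f (xpow u) = xpow (f u)"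
  by (simp_all add: pushfwd_def bit_lin_add)

lemma pushfwd_mult:
  assumes "\<And>u v. f (u + v) = f u + f v"
  shows "pushfwd f (a * b) = pushfwd f a * pushfwd f b"
  unfolding pushfwd_def by (rule bit_lin_mult) (simp_all add: assms xpow_add)

lemma pushfwd_1:
  assumes "\<And>u v. f (u + v) = f u + f v"
  shows "pushfwd f 1 = 1"
proof -
  have "f 0 = 0" using assms[of 0 0] by simp
  then show ?thesis by (metis xpow_0 pushfwd_xpow)
qed

lemma pushfwd_aug_prod:
  assumes "\<And>u v. f (u + v) = f u + f v"
  shows "pushfwd f (aug_prod us) = aug_prod (map f us)"
  by (induction us) (simp_all add: pushfwd_1[OF assms] pushfwd_mult[OF assms])

lemma pushfwd_aug_filt:
  assumes "\<And>u v. f (u + v) = f u + f v" and "a \<in> aug_filt p"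
  shows "pushfwd f a \<in> aug_filt p"
  using assms(2)
proof (induction rule: aug_filt_induct)
  case (aug_prod u us)
  then show ?case
    using xpow_aug_prod_aug_filt[of "f u" "map f us"] by (simp add: pushfwd_mult pushfwd_aug_prod assms)
qed (simp add: aug_filt_add)

lemma ext_ideal_subspace: "vec.subspace (ext_ideal S)"
  by (simp add: ext_ideal_def)

lemma ext_ideal_add: "x \<in> ext_ideal S \<Longrightarrow> y \<in> ext_ideal S \<Longrightarrow> x + y \<in> ext_ideal S"
  by (rule vec.subspace_add[OF ext_ideal_subspace])

lemma ext_ideal_0 [simp]: "0 \<in> ext_ideal S"
  by (rule vec.subspace_0[OF ext_ideal_subspace])

lemma ext_ideal_base: "s \<in> S \<Longrightarrow> wedge (ext_vec s) x \<in> ext_ideal S"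
  unfolding ext_ideal_def by (rule vec.span_base) auto

lemma ext_ideal_mono: "S \<subseteq> S' \<Longrightarrow> ext_ideal S \<subseteq> ext_ideal S'"
  unfolding ext_ideal_def by (rule vec.span_mono) auto

lemma ext_ideal_wedge: "x \<in> ext_ideal S \<Longrightarrow> wedge x y \<in> ext_ideal S"
  unfolding ext_ideal_def
proof (induction rule: bit_span_induct)
  case (base b)
  then show ?case using ext_ideal_base by (auto simp: wedge_assoc ext_ideal_def)
qed (auto simp: wedge_add vec.span_zero intro: vec.span_add)

text \<open>On generators, f changes each factor of the wedge product by an element of S; the
  factors are replaced one at a time.\<close>

lemma lead_part_pushfwd:
  assumes f: "\<And>u v. f (u + v) = f u + f v" "\<And>u. u + f u \<in> S" and "a \<in> aug_filt p"
  shows "lead_part p a + lead_part p (pushfwd f a) \<in> ext_ideal S"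
  using assms(3)
proof (induction rule: aug_filt_induct)
  case (aug_prod u us)
  have "wedge_list us + wedge_list (map f us) \<in> ext_ideal S"
  proof (induction us)
    case (Cons v us)
    have "wedge_list (v # us) + wedge_list (map f (v # us))
        = wedge (ext_vec (v + f v)) (wedge_list us)
          + wedge (wedge_list us + wedge_list (map f us)) (ext_vec (f v))"
      by (simp add: wedge_list_def wedge_add ext_vec_add wedge_commute[of _ "ext_vec (f v)"] ac_simps)
    also have "\<dots> \<in> ext_ideal S"
      using Cons f by (intro ext_ideal_add[OF ext_ideal_base ext_ideal_wedge])
    finally show ?case .
  qed (simp add: wedge_list_def)
  then show ?case
    using aug_prod lead_part_xpow_aug_prod[of us u] lead_part_xpow_aug_prod[of "map f us" "f u"]
    by (simp add: pushfwd_mult pushfwd_aug_prod f)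
next
  case (add a b)
  have "lead_part p (a + b) + lead_part p (pushfwd f (a + b))
      = (lead_part p a + lead_part p (pushfwd f a)) + (lead_part p b + lead_part p (pushfwd f b))"
    by (simp add: ac_simps)
  then show ?case using add ext_ideal_add by metis
qed

section \<open>Group algebras of quotients\<close>

definition quot :: "(bit ^ 'n) set \<Rightarrow> 'n::finite grp_alg \<Rightarrow> 'n galg" where
  "quot S = bit_lin (\<lambda>u. gen (u +o S))"

lemma quot_0 [simp]: "quot S 0 = 0" and quot_add [simp]: "quot S (a + b) = quot S a + quot S b"
  and quot_xpow [simp]: "quot S (xpow u) = gen (u +o S)"
  by (simp_all add: quot_def bit_lin_add)

lemma quot_sum: "quot S (sum f I) = (\<Sum>i\<in>I. quot S (f i))"
  by (induction I rule: infinite_finite_induct) simp_all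

lemma quot_1: "quot S 1 = gen S"
  using quot_xpow[of S 0] by simp

lemma quot_mult:
  assumes "vec.subspace S"
  shows "quot S (a * b) = quot S a * quot S b"
  unfolding quot_def
  by (rule bit_lin_mult) (simp_all add: gen_def mult_single coset_add[OF assms])

lemma quot_bit_lin:
  fixes g :: "(bit ^ 'n::finite) set \<Rightarrow> 'z::comm_monoid_add"
  assumes "\<And>x :: 'z. x + x = 0"
  shows "bit_lin g (quot S a) = bit_lin (\<lambda>u. g (u +o S)) a"
  by (induction a rule: grp_alg_induct) (simp_all add: bit_lin_add[OF assms] gen_def)

lemma galg_proj_bit_lin: "galg_proj S' a = bit_lin (\<lambda>U. gen (U + S')) a"
proof -
  have "Poly_Mapping.lookup a U = 1" if "U \<in> Poly_Mapping.keys a" for U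
    using that by (simp add: in_keys_iff)
  then show ?thesis by (simp add: galg_proj_def bit_lin_keys gen_def)
qed

lemma galg_proj_quot:
  assumes "vec.subspace S" "vec.subspace S'" "S \<subseteq> S'"
  shows "galg_proj S' (quot S a) = quot S' a"
  unfolding galg_proj_bit_lin by (subst quot_bit_lin) (simp_all add: quot_def coset_add_subspace[OF assms])

lemma pushfwd_quot:
  assumes "vec.subspace S" "\<And>u. u + f u \<in> S"
  shows "quot S (pushfwd f a) = quot S a"
proof -
  have "f u +o S = u +o S" for u
    using assms(2)[of u] by (simp add: coset_eq_iff[OF assms(1)] add.commute)
  then show ?thesis by (induction a rule: grp_alg_induct) simp_all
qed

text \<open>As f kills S, it takes the same value at whichever element of a coset
  \<open>SOME\<close> returns. The push-forward along f therefore depends only on the image in the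
  quotient.\<close>

lemma pushfwd_eq_bit_lin_quot:
  fixes S :: "(bit ^ 'n::finite) set" and f :: "bit ^ 'n \<Rightarrow> bit ^ 'n"
  assumes S: "vec.subspace S" and f: "\<And>u v. f (u + v) = f u + f v" "\<And>s. s \<in> S \<Longrightarrow> f s = 0"
  shows "pushfwd f a = bit_lin (\<lambda>U. xpow (f (SOME u. u \<in> U))) (quot S a)"
proof -
  have "f (SOME v. v \<in> u +o S) = f u" for u
  proof -
    have "u \<in> u +o S" using vec.subspace_0[OF S] by (force simp: elt_set_plus_def)
    then have "(SOME v. v \<in> u +o S) \<in> u +o S" by (rule someI)
    then obtain s where "s \<in> S" "(SOME v. v \<in> u +o S) = u + s"
      by (auto simp: elt_set_plus_def)
    then show ?thesis by (simp add: f)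
  qed
  then show ?thesis
    using quot_bit_lin[of "\<lambda>U. xpow (f (SOME u. u \<in> U))" S a] by (simp add: pushfwd_def)
qed

lemma group_algebra_eq: "group_algebra S = range (quot S)"
proof (intro equalityI subsetI)
  fix a :: "'a galg" assume "a \<in> group_algebra S"
  then have "Poly_Mapping.keys a \<subseteq> range (\<lambda>u. u +o S)" by (simp add: group_algebra_def)
  then show "a \<in> range (quot S)"
  proof (induction rule: pm_bit_induct_keys)
    case (single U)
    then obtain u where "U = u +o S" by blast
    then have "Poly_Mapping.single U 1 = quot S (xpow u)" by (simp add: gen_def)
    then show ?case by blast
  next
    case (add a b)
    then obtain c d where "a = quot S c" "b = quot S d" by blast
    then have "a + b = quot S (c + d)" by simp
    then show ?case by blast
  next
    case zero
    have "0 = quot S 0" by simp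
    then show ?case by blast
  qed
next
  fix a :: "'a galg" assume "a \<in> range (quot S)"
  then obtain b where "a = quot S b" by auto
  moreover have "Poly_Mapping.keys (quot S b) \<subseteq> range (\<lambda>u. u +o S)"
  proof (induction b rule: grp_alg_induct)
    case (add a b)
    then show ?case using keys_add[of "quot S a" "quot S b"] by auto
  qed (auto simp: gen_def)
  ultimately show "a \<in> group_algebra S" by (simp add: group_algebra_def)
qed

lemma aug_ideal_eq: "aug_ideal S = quot S ` aug_filt (Suc 0)"
proof -
  have eps: "(\<Sum>U\<in>Poly_Mapping.keys a. Poly_Mapping.lookup a U) = bit_lin (\<lambda>_. 1) a" for a :: "'a galg"
    unfolding bit_lin_keys by (intro sum.cong) (auto simp: in_keys_iff)
  \<comment> \<open>The augmentation is the coefficient at the empty set, because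
    \<open>sqfree u\<close> has coefficient one there for every u.\<close>
  have "bit_lin (\<lambda>_. 1) a = to_ext a $ {}" for a :: "'a grp_alg"
    by (induction a rule: grp_alg_induct) (simp_all add: bit_lin_add sqfree_def)
  then have "bit_lin (\<lambda>_. 1) (quot S a) = (0::bit) \<longleftrightarrow> a \<in> aug_filt (Suc 0)" for a
    by (subst quot_bit_lin) (simp_all add: aug_filt_def)
  then show ?thesis
    unfolding aug_ideal_def group_algebra_eq eps by auto
qed

text \<open>One inclusion is the multiplicativity of the filtration. For the other, a factor 1 +
  x(v) is split off from each generator, and sums are formed by concatenating two families of
  products.\<close>

lemma aug_power_eq:
  assumes S: "vec.subspace S"
  shows "aug_power p S = quot S ` aug_filt p"
proof (induction p)
  case 0
  then show ?case by (simp add: group_algebra_eq)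
next
  case (Suc p)
  show ?case
  proof (intro equalityI subsetI)
    fix x assume "x \<in> aug_power (Suc p) S"
    then obtain k :: nat and a b where x: "x = (\<Sum>i<k. a i * b i)"
      and ab: "\<forall>i<k. a i \<in> quot S ` aug_filt (Suc 0) \<and> b i \<in> quot S ` aug_filt p"
      unfolding aug_power.simps Suc aug_ideal_eq by blast
    then obtain a' b' where "\<forall>i<k. a' i \<in> aug_filt (Suc 0) \<and> b' i \<in> aug_filt p \<and> a i = quot S (a' i) \<and> b i = quot S (b' i)"
      by (simp add: image_iff) metis
    then have "x = quot S (\<Sum>i<k. a' i * b' i)" "(\<Sum>i<k. a' i * b' i) \<in> aug_filt (Suc p)"
      using aug_filt_mult[of _ "Suc 0" _ p]
      by (auto simp: x quot_sum quot_mult[OF S] intro!: aug_filt_sum sum.cong)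
    then show "x \<in> quot S ` aug_filt (Suc p)" by blast
  next
    fix x assume "x \<in> quot S ` aug_filt (Suc p)"
    then obtain a where a: "a \<in> aug_filt (Suc p)" "x = quot S a" by auto
    from a(1) have "quot S a \<in> aug_power (Suc p) S"
    proof (induction rule: aug_filt_induct)
      case (aug_prod u us)
      then obtain v vs where us: "us = v # vs" "length vs = p" by (cases us) auto
      have "quot S (xpow u * aug_prod us) = (\<Sum>i<(1::nat). quot S (1 + xpow v) * quot S (xpow u * aug_prod vs))"
        unfolding us aug_prod_simps mult.left_commute[of "xpow u" "1 + xpow v"] by (simp only: quot_mult[OF S]) simp
      moreover have "quot S (1 + xpow v) \<in> aug_ideal S" "quot S (xpow u * aug_prod vs) \<in> aug_power p S"
        using xpow_aug_prod_aug_filt[of u vs] us by (auto simp: aug_ideal_eq Suc simp del: quot_add)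
      ultimately show ?case
        unfolding aug_power.simps
        by (intro CollectI exI[of _ 1] exI[of _ "\<lambda>_. quot S (1 + xpow v)"]
              exI[of _ "\<lambda>_. quot S (xpow u * aug_prod vs)"]) blast
    next
      case (add a b)
      from add(3) obtain k :: nat and f g where 1: "quot S a = (\<Sum>i<k. f i * g i)"
        "\<forall>i<k. f i \<in> aug_ideal S \<and> g i \<in> aug_power p S" by auto
      from add(4) obtain l :: nat and f' g' where 2: "quot S b = (\<Sum>i<l. f' i * g' i)"
        "\<forall>i<l. f' i \<in> aug_ideal S \<and> g' i \<in> aug_power p S" by auto
      define F where "F i = (if i < k then f i else f' (i - k))" for i
      define G where "G i = (if i < k then g i else g' (i - k))" for i
      have "(\<Sum>i<k + l. F i * G i) = (\<Sum>i<k. F i * G i) + (\<Sum>i=k..<k + l. F i * G i)"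
        by (simp add: lessThan_atLeast0 sum.atLeastLessThan_concat)
      also have "(\<Sum>i=k..<k + l. F i * G i) = (\<Sum>i<l. F (i + k) * G (i + k))"
        using sum.shift_bounds_nat_ivl[of "\<lambda>i. F i * G i" 0 k l]
        by (simp add: lessThan_atLeast0 add.commute)
      also have "\<dots> = quot S b" by (simp add: 2 F_def G_def)
      also have "(\<Sum>i<k. F i * G i) = quot S a" by (simp add: 1 F_def G_def)
      finally have "quot S (a + b) = (\<Sum>i<k + l. F i * G i)" by simp
      moreover have "\<forall>i<k + l. F i \<in> aug_ideal S \<and> G i \<in> aug_power p S"
        using 1 2 by (auto simp: F_def G_def)
      ultimately show ?case unfolding aug_power.simps by blast
    qed
    with a show "x \<in> aug_power (Suc p) S" by simp
  qed
qed

section \<open>Leading terms in quotients and the map \<open>bv\<close>\<close>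

text \<open>Elements with the same image in the quotient have the same push-forward along a
  projection that kills S, and each differs from its push-forward in the leading term by the ideal
  only.\<close>

lemma lead_part_well_defined:
  assumes S: "vec.subspace S" and "a \<in> aug_filt p" "b \<in> aug_filt p" "quot S a = quot S b"
  shows "lead_part p a + lead_part p b \<in> ext_ideal S"
proof -
  obtain \<pi> where \<pi>: "\<And>u v. \<pi> (u + v) = \<pi> u + \<pi> v" "\<And>u. u + \<pi> u \<in> S" "\<And>s. s \<in> S \<Longrightarrow> \<pi> s = 0"
    using exists_projection[OF S] by blast
  have "pushfwd \<pi> a = pushfwd \<pi> b"
    using pushfwd_eq_bit_lin_quot[OF S \<pi>(1,3), of a] pushfwd_eq_bit_lin_quot[OF S \<pi>(1,3), of b] assms(4) by simp
  moreover have "(lead_part p a + lead_part p (pushfwd \<pi> a)) + (lead_part p b + lead_part p (pushfwd \<pi> b)) \<in> ext_ideal S"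
    by (intro ext_ideal_add lead_part_pushfwd \<pi> assms)
  ultimately show ?thesis by (simp add: ac_simps)
qed

lemma quot_aug_prod:
  assumes S: "vec.subspace S"
  shows "quot S (xpow u * aug_prod us) = gen (u +o S) * (\<Prod>v\<leftarrow>us. gen S + gen (v +o S))"
proof -
  have "quot S (b * aug_prod us) = quot S b * (\<Prod>v\<leftarrow>us. gen S + gen (v +o S))" for b
  proof (induction us arbitrary: b)
    case (Cons v us)
    have "quot S (b * aug_prod (v # us)) = quot S ((b * (1 + xpow v)) * aug_prod us)"
      by (simp add: mult.assoc)
    also have "\<dots> = quot S b * (gen S + gen (v +o S)) * (\<Prod>v\<leftarrow>us. gen S + gen (v +o S))"
      unfolding Cons by (simp add: quot_mult[OF S] quot_1)
    finally show ?case by (simp add: mult.assoc)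
  qed simp
  then show ?thesis by simp
qed

text \<open>The description in \<open>bv\<close> singles out one map: it exists because the leading
  term is well defined modulo the ideal, and it is unique because the generators span.\<close>

theorem bv_quot:
  fixes S :: "(bit ^ 'n::finite) set"
  assumes S: "vec.subspace S" and "a \<in> aug_filt p"
  shows "bv p S (quot S a) = lead_part p a +o ext_ideal S"
proof -
  note I = ext_ideal_subspace[of S]
  define P where "P f \<longleftrightarrow> f \<in> extensional (aug_power p S) \<and>
     (\<forall>a\<in>aug_power p S. \<forall>b\<in>aug_power p S. f (a + b) = f a + f b) \<and>
     (\<forall>u0 us. length us = p \<longrightarrow>
        f (gen (u0 +o S) * (\<Prod>u\<leftarrow>us. gen S + gen (u +o S))) = wedge_list us +o ext_ideal S)" for f
  define F where "F = (\<lambda>x\<in>aug_power p S. lead_part p (SOME a. a \<in> aug_filt p \<and> quot S a = x) +o ext_ideal S)"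
  have F: "F (quot S a) = lead_part p a +o ext_ideal S" if "a \<in> aug_filt p" for a
  proof -
    define b where "b = (SOME b. b \<in> aug_filt p \<and> quot S b = quot S a)"
    have "b \<in> aug_filt p \<and> quot S b = quot S a" unfolding b_def by (rule someI) (use that in auto)
    then have "lead_part p b + lead_part p a \<in> ext_ideal S" using lead_part_well_defined[OF S] that by blast
    then show ?thesis
      using that by (auto simp: F_def aug_power_eq[OF S] coset_eq_iff[OF I] b_def)
  qed
  have "P F"
    unfolding P_def
  proof (intro conjI ballI allI impI)
    show "F \<in> extensional (aug_power p S)" by (simp add: F_def)
    fix x y assume "x \<in> aug_power p S" "y \<in> aug_power p S"
    then obtain a b where "a \<in> aug_filt p" "b \<in> aug_filt p" "x = quot S a" "y = quot S b"
      by (auto simp: aug_power_eq[OF S])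
    then show "F (x + y) = F x + F y"
      using F[of "a + b"] by (simp add: F aug_filt_add coset_add[OF I])
  next
    fix u0 and us :: "(bit ^ 'n) list" assume "length us = p"
    then show "F (gen (u0 +o S) * (\<Prod>u\<leftarrow>us. gen S + gen (u +o S))) = wedge_list us +o ext_ideal S"
      using F[of "xpow u0 * aug_prod us"] xpow_aug_prod_aug_filt[of u0 us] lead_part_xpow_aug_prod[of us u0]
      by (auto simp flip: quot_aug_prod[OF S] simp: F)
  qed
  moreover have "G = F" if "P G" for G
  proof
    fix x
    show "G x = F x"
    proof (cases "x \<in> aug_power p S")
      case True
      then obtain a where a: "a \<in> aug_filt p" "x = quot S a" by (auto simp: aug_power_eq[OF S])
      from a(1) have "G (quot S a) = F (quot S a)"
      proof (induction rule: aug_filt_induct)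
        case (aug_prod u us)
        then show ?case using that \<open>P F\<close> by (simp add: P_def quot_aug_prod[OF S])
      next
        case (add a b)
        then have "quot S a \<in> aug_power p S" "quot S b \<in> aug_power p S" by (auto simp: aug_power_eq[OF S])
        with add show ?case using that \<open>P F\<close> by (simp add: P_def)
      qed
      with a show ?thesis by simp
    next
      case False
      then show ?thesis using that by (simp add: P_def F_def extensional_def)
    qed
  qed
  ultimately have "bv p S = F" unfolding bv_def P_def[symmetric] by (rule the_equality)
  with F assms show ?thesis by simp
qed

text \<open>The kernel of \<open>bv\<close> in degree p is the next power of the augmentation ideal.
  The part of degree p of an element of the ideal is the leading term of some g that vanishes in the
  quotient; adding g to a removes the leading term of a.\<close>

lemma aug_filt_Suc_of_lead_part_ideal:
  assumes S: "vec.subspace S" and a: "a \<in> aug_filt p" "lead_part p a \<in> ext_ideal S"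
  shows "quot S a \<in> quot S ` aug_filt (Suc p)"
proof -
  \<comment> \<open>The elements spanning \<open>ext_ideal S\<close> are not homogeneous, so the
    induction has to follow their parts of degree p.\<close>
  define tp where "tp x = (\<chi> A. if card A = p then x $ A else (0::bit))" for x :: "'a ext"
  have tp_add: "tp (x + y) = tp x + tp y" for x y by (auto simp: tp_def vec_eq_iff)
  have *: "\<exists>g\<in>aug_filt p. quot S g = 0 \<and> lead_part p g = tp x" if "x \<in> ext_ideal S" for x
    using that unfolding ext_ideal_def
  proof (induction rule: bit_span_induct)
    case (base b)
    then obtain s y where s: "s \<in> S" and b: "b = wedge (ext_vec s) y" by auto
    have "\<exists>g\<in>aug_filt p. quot S g = 0 \<and> lead_part p g = tp (wedge (ext_vec s) y)"
    proof (induction y rule: ext_induct)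
      case (axis A)
      define g where "g = (1 + xpow s) * aug_monomial A"
      \<comment> \<open>x(s) becomes the unit in the quotient, so all multiples of 1 + x(s) vanish
        there.\<close>
      have "s +o S = S" using s coset_eq_iff[OF S, of s 0] by simp
      then have q: "quot S g = 0" by (simp add: g_def quot_mult[OF S] quot_1)
      have f: "aug_monomial A \<in> aug_filt (card A)" "lead_part (card A) (aug_monomial A) = axis A 1"
        by (auto simp: aug_filt_def lead_part_def to_ext_aug_monomial axis_def vec_eq_iff)
      have g: "g \<in> aug_filt (Suc (card A))"
        using aug_filt_mult[OF one_plus_xpow_aug_filt f(1)] by (simp add: g_def)
      have l: "lead_part (Suc (card A)) g = wedge (ext_vec s) (axis A 1)"
        using lead_part_mult[OF one_plus_xpow_aug_filt f(1), of s] f by (simp add: g_def del: lead_part_add)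
      show ?case
      proof (cases "p = Suc (card A)")
        case True
        have "tp (lead_part p g) = lead_part p g" by (auto simp: tp_def lead_part_def vec_eq_iff)
        with True l g q show ?thesis by auto
      next
        case False
        then have "tp (lead_part (Suc (card A)) g) = 0" by (auto simp: tp_def lead_part_def vec_eq_iff)
        with l show ?thesis by (intro bexI[of _ 0]) auto
      qed
    next
      case (add x y)
      then obtain g h where "g \<in> aug_filt p" "quot S g = 0" "lead_part p g = tp (wedge (ext_vec s) x)"
        "h \<in> aug_filt p" "quot S h = 0" "lead_part p h = tp (wedge (ext_vec s) y)" by auto
      then show ?case by (intro bexI[of _ "g + h"]) (auto simp: wedge_add tp_add aug_filt_add)
    qed (auto simp: tp_def vec_eq_iff intro!: bexI[of _ 0])
    then show ?case by (simp add: b)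
  next
    case (add x y)
    then obtain g h where "g \<in> aug_filt p" "quot S g = 0" "lead_part p g = tp x"
      "h \<in> aug_filt p" "quot S h = 0" "lead_part p h = tp y" by auto
    then show ?case by (intro bexI[of _ "g + h"]) (auto simp: tp_add aug_filt_add)
  qed (auto simp: tp_def vec_eq_iff intro!: bexI[of _ 0])
  have "tp (lead_part p a) = lead_part p a" by (auto simp: tp_def lead_part_def vec_eq_iff)
  with * a obtain g where g: "g \<in> aug_filt p" "quot S g = 0" "lead_part p g = lead_part p a" by metis
  then have "a + g \<in> aug_filt (Suc p)" using a by (simp add: aug_filt_Suc_iff aug_filt_add)
  moreover have "quot S a = quot S (a + g)" by (simp add: g)
  ultimately show ?thesis by blast
qed

section \<open>Supports\<close>

lemma pair_add: "pair (x + y) z = pair x z + pair y z" "pair z (x + y) = pair z x + pair z y"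
  for x y z :: "'a::comm_ring_1 ^ 'i::finite"
  by (simp_all add: pair_def sum.distrib algebra_simps)

lemma pair_0 [simp]: "pair 0 z = 0" "pair z 0 = 0"
  for z :: "'a::comm_ring_1 ^ 'i::finite"
  by (simp_all add: pair_def)

lemma ext_power_base: "length us = p \<Longrightarrow> set us \<subseteq> V \<Longrightarrow> wedge_list us \<in> ext_power p V"
  unfolding ext_power_def by (rule vec.span_base) auto

lemma ext_power_wedge:
  assumes "x \<in> ext_power p V" "u \<in> V"
  shows "wedge (ext_vec u) x \<in> ext_power (Suc p) V"
  using assms(1) unfolding ext_power_def
proof (induction rule: bit_span_induct)
  case (base b)
  then obtain us where "b = wedge_list us" "length us = p" "set us \<subseteq> V" by auto
  then have "wedge (ext_vec u) b = wedge_list (u # us)" "length (u # us) = Suc p" "set (u # us) \<subseteq> V"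
    using assms(2) by (auto simp: wedge_list_def)
  then show ?case by (intro vec.span_base) blast
qed (auto simp: vec.span_zero wedge_add intro: vec.span_add)

text \<open>The map D that sends x(u) to l(u) x(f u) is a derivation relative to push-forward along
  f. It uses up at most one of the p factors 1 + x(u_i), hence lowers the filtration by at most one.
  Its purpose is division by 1 + x(d) in \<open>lead_part_support\<close>.\<close>

lemma derivation_aug_filt:
  fixes f :: "bit ^ 'n::finite \<Rightarrow> bit ^ 'n"
  assumes f: "\<And>u v. f (u + v) = f u + f v" and l: "\<And>u v. l (u + v) = l u + (l v :: bit)"
    and "a \<in> aug_filt p"
  shows "bit_lin (\<lambda>u. bit_scale (l u) (xpow (f u))) a \<in> aug_filt (p - 1)"
proof -
  define D where "D = bit_lin (\<lambda>u. bit_scale (l u) (xpow (f u)))"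
  have D_simps [simp]: "D 0 = 0" "D (a + b) = D a + D b" "D (xpow u) = bit_scale (l u) (xpow (f u))" for a b u
    by (simp_all add: D_def bit_lin_add)
  have leibniz: "D (a * b) = D a * pushfwd f b + pushfwd f a * D b" for a b
  proof (induction a rule: grp_alg_induct)
    case (xpow u)
    show ?case
    proof (induction b rule: grp_alg_induct)
      case (xpow v)
      have "D (xpow u * xpow v) = bit_scale (l u + l v) (xpow (f u) * xpow (f v))"
        unfolding xpow_add[symmetric] D_simps by (simp add: l f)
      then show ?case by (cases "l u"; cases "l v") simp_all
    next
      case (add a b)
      show ?case
        unfolding distrib_left D_simps pushfwd_add add by (simp only: ac_simps)
    qed simp
  next
    case (add a b)
    show ?case
      unfolding distrib_right D_simps pushfwd_add add by (simp only: ac_simps)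
  qed simp
  have 1: "D (aug_prod us) \<in> aug_filt (length us - 1)" for us
  proof (induction us)
    case (Cons u us)
    have "D ((1 + xpow u) * aug_prod us) = D (1 + xpow u) * pushfwd f (aug_prod us) + pushfwd f (1 + xpow u) * D (aug_prod us)"
      by (rule leibniz)
    moreover have "D (1 + xpow u) * pushfwd f (aug_prod us) \<in> aug_filt (length us)"
      using pushfwd_aug_filt[OF f aug_prod_aug_filt] by (rule aug_filt_mult_left)
    moreover have "pushfwd f (1 + xpow u) * D (aug_prod us) \<in> aug_filt (length us)"
      using aug_filt_mult[OF pushfwd_aug_filt[OF f one_plus_xpow_aug_filt] Cons] by (cases us) (auto simp: aug_filt_mult_left)
    ultimately show ?case by (simp add: aug_filt_add)
  qed simp
  have 2: "D (xpow u * aug_prod us) \<in> aug_filt (length us - 1)" for u us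
  proof -
    have "D (xpow u) * pushfwd f (aug_prod us) \<in> aug_filt (length us)"
      using pushfwd_aug_filt[OF f aug_prod_aug_filt] by (rule aug_filt_mult_left)
    then have "D (xpow u) * pushfwd f (aug_prod us) \<in> aug_filt (length us - 1)"
      using aug_filt_antimono[of "length us - 1" "length us"] by auto
    moreover have "pushfwd f (xpow u) * D (aug_prod us) \<in> aug_filt (length us - 1)"
      using 1 by (rule aug_filt_mult_left)
    ultimately show ?thesis unfolding leibniz by (rule aug_filt_add)
  qed
  from assms(3) have "D a \<in> aug_filt (p - 1)"
    by (induction rule: aug_filt_induct) (use 2 in \<open>auto simp: aug_filt_add\<close>)
  then show ?thesis by (simp add: D_def)
qed

text \<open>The image of \<open>a\<close> under the projection along \<open>d k\<close> to the hyperplane \<open>m k = 0\<close> is in the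
  \<open>p\<close>-th power, and what remains is \<open>1 + xpow (d k)\<close> times the part of \<open>a\<close> on that hyperplane.\<close>

lemma lead_part_support:
  fixes m d :: "nat \<Rightarrow> bit ^ 'n::finite"
  assumes dual: "\<And>i j. i < k \<Longrightarrow> j < k \<Longrightarrow> pair (m i) (d j) = of_bool (i = j)"
    and "a \<in> aug_filt p" and "\<And>u. u \<in> Poly_Mapping.keys a \<Longrightarrow> \<exists>i<k. pair (m i) u = 1"
  shows "lead_part p a \<in> vec.span (\<Union>i<k. ext_power p {u. pair (m i) u = 0})"
  using assms
proof (induction k arbitrary: a p)
  case 0
  then have "u \<notin> Poly_Mapping.keys a" for u by blast
  then have "a = 0" by (intro poly_mapping_eqI) (simp add: in_keys_iff)
  then show ?case by (simp add: vec.span_zero)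
next
  case (Suc k)
  let ?T = "vec.span (\<Union>i<Suc k. ext_power p {u. pair (m i) u = 0})"
  define l where "l = pair (m k)"
  define f where "f u = u + bit_scale (l u) (d k)" for u
  define D where "D = bit_lin (\<lambda>u. bit_scale (l u) (xpow (f u)))"
  have l_add: "l (u + v) = l u + l v" for u v by (simp add: l_def pair_add)
  have l_d: "l (d k) = 1" using Suc.prems(1) by (simp add: l_def)
  have f_add: "f (u + v) = f u + f v" for u v
    by (simp add: f_def l_add bit_scale_add ac_simps)
  have l_f: "l (f u) = 0" for u by (cases "l u") (simp_all add: f_def l_add l_d)
  define \<alpha> where "\<alpha> = bit_lin (\<lambda>u. bit_scale (l u + 1) (xpow u)) a"
  have D [simp]: "D 0 = 0" "D (a + b) = D a + D b" "D (xpow u) = bit_scale (l u) (xpow (f u))" for a b u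
    by (simp_all add: D_def bit_lin_add)
  \<comment> \<open>The first equation is checked for l(u) = 0 and l(u) = 1 separately. By the
    second, D undoes the multiplication by 1 + x(d_k), because f maps u + d_k back to u when l(u) =
    0.\<close>
  have split: "a = pushfwd f a * xpow (d k) + \<alpha> * (1 + xpow (d k))" "D (\<alpha> * (1 + xpow (d k))) = \<alpha>"
    unfolding \<alpha>_def
  proof (induction a rule: grp_alg_induct)
    case (xpow u)
    {
      case 1
      show ?case by (cases "l u") (simp_all add: f_def xpow_add algebra_simps)
    next
      case 2
      show ?case
        by (cases "l u") (simp_all add: f_def l_add l_d distrib_left flip: xpow_add)
    }
  next
    case (add a b)
    {
      case 1
      show ?case
        by (rule trans[OF arg_cong2[where f = "(+)", OF add(1,3)]])
          (simp add: bit_lin_add distrib_left distrib_right ac_simps)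
    next
      case 2
      then show ?case using add by (simp add: bit_lin_add distrib_right)
    }
  qed simp_all
  have \<alpha>_keys: "u \<in> Poly_Mapping.keys a \<and> l u = 0" if "u \<in> Poly_Mapping.keys \<alpha>" for u
  proof -
    have "Poly_Mapping.keys (\<Sum>u\<in>K. bit_scale (l u + 1) (xpow u)) \<subseteq> {u \<in> K. l u = 0}" if "finite K" for K
      using that
    proof induction
      case (insert v K)
      have "Poly_Mapping.keys (bit_scale (l v + 1) (xpow v)) \<subseteq> (if l v = 0 then {v} else {})"
        by (cases "l v") (simp_all add: xpow_def)
      with insert show ?case
        using keys_add[of "bit_scale (l v + 1) (xpow v)" "\<Sum>u\<in>K. bit_scale (l u + 1) (xpow u)"]
        by (auto split: if_splits)
    qed simp
    from this[of "Poly_Mapping.keys a"] that show ?thesis by (auto simp: \<alpha>_def bit_lin_keys)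
  qed
  have fa: "pushfwd f a \<in> aug_filt p" by (rule pushfwd_aug_filt[OF f_add Suc.prems(2)])
  have sub: "vec.span (\<Union>i<k. ext_power p {u. pair (m i) u = 0}) \<subseteq> ?T"
    by (intro vec.span_mono UN_mono) auto
  have "lead_part p (pushfwd f a) \<in> ?T"
    using Suc.prems(2)
  proof (induction rule: aug_filt_induct)
    case (aug_prod u us)
    have "lead_part p (pushfwd f (xpow u * aug_prod us)) = wedge_list (map f us)"
      using aug_prod lead_part_xpow_aug_prod[of "map f us" "f u"] by (simp add: pushfwd_mult pushfwd_aug_prod f_add)
    also have "\<dots> \<in> ext_power p {u. pair (m k) u = 0}"
      using aug_prod l_f by (intro ext_power_base) (auto simp: l_def)
    finally show ?case by (intro vec.span_base) auto
  qed (simp add: vec.span_add)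
  moreover have "lead_part p (pushfwd f a * xpow (d k)) = lead_part p (pushfwd f a)"
    using lead_part_mult[OF fa, of "xpow (d k)" 0] by simp
  moreover have "lead_part p (\<alpha> * (1 + xpow (d k))) \<in> ?T"
  proof (cases p)
    case 0
    have "lead_part 0 (\<alpha> * (1 + xpow (d k))) = 0"
      using aug_filt_mult_left[OF one_plus_xpow_aug_filt, of \<alpha> "d k"] by (simp add: aug_filt_Suc_iff)
    then show ?thesis by (simp add: 0 vec.span_zero)
  next
    case (Suc p')
    have eq: "a + pushfwd f a * xpow (d k) = \<alpha> * (1 + xpow (d k))"
      by (subst split(1)) (simp add: ac_simps)
    have "pushfwd f a * xpow (d k) \<in> aug_filt p"
      using aug_filt_mult[OF fa, of "xpow (d k)" 0] by simp
    with Suc.prems(2) have "a + pushfwd f a * xpow (d k) \<in> aug_filt p" by (rule aug_filt_add)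
    then have "\<alpha> * (1 + xpow (d k)) \<in> aug_filt p" by (simp only: eq)
    then have \<alpha>: "\<alpha> \<in> aug_filt p'"
      using derivation_aug_filt[OF f_add l_add, of "\<alpha> * (1 + xpow (d k))" p] split(2)
      by (simp add: D_def Suc)
    \<comment> \<open>The keys of \<alpha> lie on the hyperplane of \<open>m k\<close>, so the
      condition that they satisfy belongs to an index below k.\<close>
    have "lead_part p' \<alpha> \<in> vec.span (\<Union>i<k. ext_power p' {u. pair (m i) u = 0})"
    proof (rule Suc.IH[OF _ \<alpha>])
      fix u assume "u \<in> Poly_Mapping.keys \<alpha>"
      then have "u \<in> Poly_Mapping.keys a" "l u = 0" using \<alpha>_keys by auto
      then show "\<exists>i<k. pair (m i) u = 1"
        using Suc.prems(3)[of u] by (auto simp: less_Suc_eq l_def)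
    qed (use Suc.prems(1) in auto)
    then have "wedge (ext_vec (d k)) (lead_part p' \<alpha>) \<in> vec.span (\<Union>i<k. ext_power p {u. pair (m i) u = 0})"
    proof (induction rule: bit_span_induct)
      case (base b)
      \<comment> \<open>By duality d_k lies in each hyperplane of \<open>m i\<close> with i < k, so
        the wedge product with it respects the summands.\<close>
      then obtain i where "i < k" "b \<in> ext_power p' {u. pair (m i) u = 0}" by auto
      then show ?case
        using ext_power_wedge[of b p' "{u. pair (m i) u = 0}" "d k"] Suc.prems(1)[of i k] Suc
        by (intro vec.span_base) auto
    qed (auto simp: vec.span_zero wedge_add intro: vec.span_add)
    moreover have "lead_part p (\<alpha> * (1 + xpow (d k))) = wedge (ext_vec (d k)) (lead_part p' \<alpha>)"
      using lead_part_mult[OF \<alpha> one_plus_xpow_aug_filt, of "d k"] by (simp add: Suc wedge_commute del: lead_part_add)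
    ultimately show ?thesis using sub by auto
  qed
  ultimately have "lead_part p (pushfwd f a * xpow (d k)) + lead_part p (\<alpha> * (1 + xpow (d k))) \<in> ?T"
    by (simp add: vec.span_add)
  then show ?case by (simp flip: lead_part_add split(1))
qed


section \<open>Contraction\<close>

text \<open>Interior product with s, the transpose of the wedge product with s under
  \<open>pair\<close>; modulo two it carries no signs.\<close>

definition contract :: "bit ^ 'n \<Rightarrow> 'n::finite ext \<Rightarrow> 'n ext" where
  "contract s x = (\<chi> A. \<Sum>i\<in>-A. s $ i * x $ insert i A)"

lemma contract_0 [simp]: "contract s 0 = 0"
  and contract_add: "contract s (x + y) = contract s x + contract s y"
  by (simp_all add: contract_def vec_eq_iff distrib_left sum.distrib)

lemma wedge_ext_vec_nth: "wedge (ext_vec s) y $ C = (\<Sum>i\<in>C. s $ i * y $ (C - {i}))"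
proof -
  have "wedge (ext_vec s) y $ C = (\<Sum>B\<in>(\<lambda>i. {i}) ` C. ext_vec s $ B * y $ (C - B))"
    unfolding wedge_nth
    by (rule sum.mono_neutral_right) (auto simp: card_1_singleton_iff intro!: ext_vec_nth(2))
  also have "\<dots> = (\<Sum>i\<in>C. s $ i * y $ (C - {i}))"
    by (subst sum.reindex) (auto simp: inj_on_def ext_vec_nth)
  finally show ?thesis .
qed

lemma pair_wedge_ext_vec: "pair x (wedge (ext_vec s) y) = pair (contract s x) y"
proof -
  have "pair x (wedge (ext_vec s) y) = (\<Sum>C\<in>UNIV. \<Sum>i\<in>C. x $ C * (s $ i * y $ (C - {i})))"
    by (simp add: pair_def wedge_ext_vec_nth sum_distrib_left)
  also have "\<dots> = (\<Sum>(C, i)\<in>(SIGMA C:UNIV. C). x $ C * (s $ i * y $ (C - {i})))"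
    by (rule sum.Sigma) auto
  also have "\<dots> = (\<Sum>(A, i)\<in>(SIGMA A:UNIV. -A). s $ i * x $ insert i A * y $ A)"
    by (rule sum.reindex_bij_witness[of _ "\<lambda>(A, i). (insert i A, i)" "\<lambda>(C, i). (C - {i}, i)"])
      (auto simp: insert_absorb)
  also have "\<dots> = (\<Sum>A\<in>UNIV. \<Sum>i\<in>-A. s $ i * x $ insert i A * y $ A)"
    by (rule sum.Sigma[symmetric]) auto
  also have "\<dots> = pair (contract s x) y"
    by (simp add: pair_def contract_def sum_distrib_right)
  finally show ?thesis .
qed

text \<open>Leibniz rule for the interior product. The terms with two different indices form the
  same double sum \<open>?R\<close> on both sides; the remaining terms run over the complement of A
  on one side and over A on the other, and they differ by the pairing of m and s.\<close>

lemma contract_wedge: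
  "contract s (wedge (ext_vec m) x) = bit_scale (pair m s) x + wedge (ext_vec m) (contract s x)"
proof -
  have "contract s (wedge (ext_vec m) x) $ A = (bit_scale (pair m s) x + wedge (ext_vec m) (contract s x)) $ A" for A
  proof -
    let ?R = "\<Sum>j\<in>A. \<Sum>i\<in>-A. m $ j * (s $ i * x $ (insert i A - {j}))"
    have "contract s (wedge (ext_vec m) x) $ A
        = (\<Sum>i\<in>-A. s $ i * (m $ i * x $ A + (\<Sum>j\<in>A. m $ j * x $ (insert i A - {j}))))"
      unfolding contract_def wedge_ext_vec_nth by (auto intro!: sum.cong)
    also have "\<dots> = (\<Sum>i\<in>-A. m $ i * s $ i) * x $ A
        + (\<Sum>i\<in>-A. \<Sum>j\<in>A. m $ j * (s $ i * x $ (insert i A - {j})))"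
      by (simp add: distrib_left sum.distrib sum_distrib_left sum_distrib_right ac_simps)
    also have "(\<Sum>i\<in>-A. \<Sum>j\<in>A. m $ j * (s $ i * x $ (insert i A - {j}))) = ?R"
      by (rule sum.swap)
    finally have L: "contract s (wedge (ext_vec m) x) $ A = (\<Sum>i\<in>-A. m $ i * s $ i) * x $ A + ?R" .
    have "wedge (ext_vec m) (contract s x) $ A
        = (\<Sum>j\<in>A. m $ j * (\<Sum>i\<in>insert j (-A). s $ i * x $ insert i (A - {j})))"
      unfolding contract_def wedge_ext_vec_nth
      by (auto intro!: sum.cong arg_cong2[where f = "(*)"])
    also have "\<dots> = (\<Sum>j\<in>A. m $ j * (s $ j * x $ A + (\<Sum>i\<in>-A. s $ i * x $ (insert i A - {j}))))"
    proof (rule sum.cong[OF refl])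
      fix j assume j: "j \<in> A"
      then have "(\<Sum>i\<in>insert j (-A). s $ i * x $ insert i (A - {j}))
          = s $ j * x $ A + (\<Sum>i\<in>-A. s $ i * x $ insert i (A - {j}))"
        by (subst sum.insert) (auto simp: insert_absorb)
      also have "(\<Sum>i\<in>-A. s $ i * x $ insert i (A - {j})) = (\<Sum>i\<in>-A. s $ i * x $ (insert i A - {j}))"
        using j by (intro sum.cong) (auto intro!: arg_cong2[where f = "(*)"] arg_cong[where f = "($) x"])
      finally show "m $ j * (\<Sum>i\<in>insert j (-A). s $ i * x $ insert i (A - {j}))
          = m $ j * (s $ j * x $ A + (\<Sum>i\<in>-A. s $ i * x $ (insert i A - {j})))" by simp
    qed
    also have "\<dots> = (\<Sum>j\<in>A. m $ j * s $ j) * x $ A + ?R"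
      by (simp add: distrib_left sum.distrib sum_distrib_left sum_distrib_right ac_simps)
    finally have R: "wedge (ext_vec m) (contract s x) $ A = (\<Sum>j\<in>A. m $ j * s $ j) * x $ A + ?R" .
    have P: "pair m s = (\<Sum>j\<in>A. m $ j * s $ j) + (\<Sum>i\<in>-A. m $ i * s $ i)"
      unfolding pair_def Compl_eq_Diff_UNIV by (rule sum.subset_diff[of A UNIV, simplified, unfolded add.commute[of "sum _ (UNIV - A)"]])
    have "bit_scale (pair m s) x $ A = pair m s * x $ A" by (cases "pair m s") simp_all
    then show ?thesis unfolding L vector_add_component R P
      by (cases "x $ A") (simp_all flip: add.assoc add: add.commute[of "\<Sum>j\<in>A. m $ j * s $ j"])
  qed
  then show ?thesis by (simp add: vec_eq_iff)
qed

lemma wedge_list_simps [simp]: "wedge_list [] = ext_one"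
  "wedge_list (u # us) = wedge (ext_vec u) (wedge_list us)"
  by (simp_all add: wedge_list_def)

lemma contract_one [simp]: "contract s ext_one = 0"
  by (simp add: contract_def ext_one_def vec_eq_iff)

lemma contract_wedge_list:
  assumes "\<And>m. m \<in> set ms \<Longrightarrow> pair m s = 0"
  shows "contract s (wedge_list ms) = 0"
  using assms by (induction ms) (simp_all add: contract_wedge)

lemma contract_ext_power:
  assumes "x \<in> ext_power p V" "\<And>m. m \<in> V \<Longrightarrow> pair m s = 0"
  shows "contract s x = 0"
  using assms(1) unfolding ext_power_def
proof (induction rule: bit_span_induct)
  case (base b)
  then show ?case using contract_wedge_list assms(2) by blast
qed (simp_all add: contract_add)

lemma pair_ext_one: "pair ext_one (ext_one :: 'n::finite ext) = 1"
proof -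
  have "pair ext_one (ext_one :: 'n ext) = (\<Sum>A\<in>(UNIV :: 'n set set). if A = {} then 1 else 0)"
    unfolding pair_def by (intro sum.cong) (auto simp: ext_one_def)
  then show ?thesis by simp
qed

lemma pair_ext_vec: "pair (ext_vec m) (ext_vec s) = pair m s"
proof -
  have "pair (ext_vec m) (wedge (ext_vec s) ext_one) = pair (bit_scale (pair m s) ext_one) (ext_one :: 'a ext)"
    unfolding pair_wedge_ext_vec using contract_wedge[of s m ext_one] by simp
  then show ?thesis by (cases "pair m s") (simp_all add: pair_ext_one)
qed

text \<open>The determinant of an identity matrix, computed by contracting with the first dual
  vector, which is orthogonal to all members of \<open>bs\<close> but the first.\<close>

lemma pair_wedge_list_dual:
  assumes "length bs = length ds"
    and "\<And>i j. i < length bs \<Longrightarrow> j < length bs \<Longrightarrow> pair (bs ! i) (ds ! j) = of_bool (i = j)"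
  shows "pair (wedge_list bs) (wedge_list ds) = 1"
  using assms
proof (induction bs ds rule: list_induct2)
  case (Cons b bs d ds)
  have "contract d (wedge_list bs) = 0"
  proof (rule contract_wedge_list)
    fix m assume "m \<in> set bs"
    then obtain i where "i < length bs" "m = bs ! i" by (auto simp: in_set_conv_nth)
    then show "pair m d = 0" using Cons.prems[of "Suc i" 0] by simp
  qed
  moreover have "pair b d = 1" using Cons.prems[of 0 0] by simp
  moreover have "pair (wedge_list bs) (wedge_list ds) = 1"
  proof (rule Cons.IH)
    fix i j assume "i < length bs" "j < length bs"
    then show "pair (bs ! i) (ds ! j) = of_bool (i = j)" using Cons.prems[of "Suc i" "Suc j"] by simp
  qed
  ultimately show ?case by (simp add: pair_wedge_ext_vec contract_wedge)
qed (simp add: pair_ext_one)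

section \<open>Permutations, repetitions and the top exterior power\<close>

lemma aug_prod_mset: "mset us = mset vs \<Longrightarrow> aug_prod us = aug_prod (vs :: (bit ^ 'n::finite) list)"
proof -
  have "aug_prod us = prod_mset (image_mset (\<lambda>u. 1 + xpow u) (mset us))" for us :: "(bit ^ 'n) list"
    by (simp add: aug_prod_def prod_mset_prod_list flip: mset_map)
  then show "mset us = mset vs \<Longrightarrow> aug_prod us = aug_prod vs" by simp
qed

lemma wedge_list_mset: "mset us = mset vs \<Longrightarrow> wedge_list us = wedge_list vs"
  using lead_part_aug_prod[of us] lead_part_aug_prod[of vs] aug_prod_mset[of us vs] mset_eq_length[of us vs] by simp

text \<open>A repeated factor y gives (1 + x(y))^2 = 0 in the group algebra.\<close>

lemma wedge_list_not_distinct: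
  assumes "\<not> distinct us"
  shows "wedge_list us = 0"
proof -
  obtain xs ys zs y where us: "us = xs @ [y] @ ys @ [y] @ zs"
    using not_distinct_decomp[OF assms] by blast
  have "aug_prod us = aug_prod (y # y # xs @ ys @ zs)"
    by (rule aug_prod_mset) (simp add: us)
  also have "\<dots> = ((1 + xpow y) * (1 + xpow y)) * aug_prod (xs @ ys @ zs)"
    by (simp add: mult.assoc)
  also have "(1 + xpow y) * (1 + xpow y) = 0"
    by (simp add: distrib_left distrib_right)
  finally show ?thesis using lead_part_aug_prod[of us] by simp
qed

lemma wedge_self [simp]: "wedge (ext_vec u) (ext_vec u) = 0"
  using wedge_list_not_distinct[of "[u, u]"] by simp

lemma wedge_list_multilinear:
  assumes "set us \<subseteq> vec.span B"
  shows "wedge_list us \<in> vec.span {wedge_list ms | ms. length ms = length us \<and> set ms \<subseteq> B}"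
  using assms
proof (induction us)
  case (Cons u us)
  let ?T = "vec.span {wedge_list ms | ms. length ms = length (u # us) \<and> set ms \<subseteq> B}"
  have "wedge_list us \<in> vec.span {wedge_list ms | ms. length ms = length us \<and> set ms \<subseteq> B}"
    using Cons by simp
  then have *: "wedge (ext_vec b) (wedge_list us) \<in> ?T" if "b \<in> B" for b
  proof (induction rule: bit_span_induct)
    case (base y)
    then obtain ms where "y = wedge_list ms" "length ms = length us" "set ms \<subseteq> B" by auto
    then have "wedge (ext_vec b) y = wedge_list (b # ms)" "length (b # ms) = length (u # us)"
      "set (b # ms) \<subseteq> B" using that by auto
    then show ?case by (intro vec.span_base) blast
  qed (auto simp: wedge_add vec.span_zero intro: vec.span_add)
  have "u \<in> vec.span B" using Cons.prems by simp
  then have "wedge (ext_vec u) (wedge_list us) \<in> ?T"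
    by (induction rule: bit_span_induct)
      (auto simp: *[simplified] wedge_add ext_vec_add vec.span_zero intro: vec.span_add)
  then show ?case by simp
qed (auto intro!: vec.span_base exI[of _ "[]"])

text \<open>A list of this length with entries from \<open>bs\<close> either repeats an entry and
  has product zero, or is a permutation of \<open>bs\<close>. So the top exterior power is at most a
  line, which makes the nonzero element in \<open>omega\<close> unique.\<close>

lemma ext_power_top:
  assumes "distinct bs" "x \<in> ext_power (length bs) (vec.span (set bs))"
  shows "x = 0 \<or> x = wedge_list bs"
proof -
  have base: "wedge_list ms = 0 \<or> wedge_list ms = wedge_list bs"
    if "length ms = length bs" "set ms \<subseteq> set bs" for ms
  proof (cases "distinct ms")
    case True
    then have "set ms = set bs"
      using that assms(1) by (intro card_subset_eq) (auto simp: distinct_card)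
    then show ?thesis
      using True assms(1) wedge_list_mset[of ms bs] set_eq_iff_mset_eq_distinct by blast
  qed (simp add: wedge_list_not_distinct)
  have "vec.span {wedge_list ms | ms. length ms = length bs \<and> set ms \<subseteq> set bs} \<subseteq> {0, wedge_list bs}"
    by (intro vec.span_minimal bit_vec_subspaceI) (use base in auto)
  then have "wedge_list us \<in> {0, wedge_list bs}"
    if "length us = length bs" "set us \<subseteq> vec.span (set bs)" for us
    using wedge_list_multilinear[OF that(2)] that(1) by auto
  then have "ext_power (length bs) (vec.span (set bs)) \<subseteq> {0, wedge_list bs}"
    unfolding ext_power_def by (intro vec.span_minimal bit_vec_subspaceI) auto
  with assms(2) show ?thesis by auto
qed

lemma keys_mult_xpow: "Poly_Mapping.keys (xpow u * a) = (+) u ` Poly_Mapping.keys a"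
proof -
  have "Poly_Mapping.keys (xpow u * a) \<subseteq> (+) u ` Poly_Mapping.keys a" for u and a :: "'a grp_alg"
    using keys_mult[of "xpow u" a] by (auto simp: xpow_def)
  from this[of u a] this[of u "xpow u * a"] show ?thesis
    by (force simp flip: mult.assoc)
qed

text \<open>A key is a sum of some of the factors; if it is nonzero, it can take the place of one of
  them without changing the wedge product.\<close>

lemma keys_aug_prod:
  assumes "w \<in> Poly_Mapping.keys (aug_prod us)" "w \<noteq> 0"
  shows "\<exists>y. wedge_list us = wedge (ext_vec w) y"
  using assms
proof (induction us arbitrary: w)
  case (Cons u us)
  have "w \<in> Poly_Mapping.keys (aug_prod us) \<or> w \<in> (+) u ` Poly_Mapping.keys (aug_prod us)"
    using Cons.prems(1) keys_add[of "aug_prod us" "xpow u * aug_prod us"] keys_mult_xpow[of u "aug_prod us"]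
    by (auto simp: distrib_right)
  then consider "w \<in> Poly_Mapping.keys (aug_prod us)" | "w = u"
    | w' where "w = u + w'" "w' \<in> Poly_Mapping.keys (aug_prod us)" "w' \<noteq> 0" by force
  then show ?case
  proof cases
    case 1
    then obtain y where "wedge_list us = wedge (ext_vec w) y" using Cons by blast
    then have "wedge_list (u # us) = wedge (ext_vec w) (wedge (ext_vec u) y)"
      by (simp add: wedge_left_commute)
    then show ?thesis by blast
  next
    case 2
    then show ?thesis by auto
  next
    case 3
    then obtain y where y: "wedge_list us = wedge (ext_vec w') y" using Cons.IH by blast
    have "wedge (ext_vec w') (wedge (ext_vec w') y) = 0"
      by (simp flip: wedge_assoc)
    with y have "wedge_list (u # us) = wedge (ext_vec w) (wedge (ext_vec w') y)"
      by (simp add: 3(1) ext_vec_add wedge_add)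
    then show ?thesis by blast
  qed
qed simp

section \<open>Unimodular simplices\<close>

text \<open>The library computes volumes of simplices only over well-ordered index types.\<close>

typedef ('n::finite) ordered_index = "{..<CARD('n)}"
  by (rule exI[of _ 0]) simp

instance ordered_index :: (finite) finite
proof
  have "(UNIV :: 'a ordered_index set) = Abs_ordered_index ` {..<CARD('a)}"
    using type_definition.Abs_image[OF type_definition_ordered_index] by blast
  then show "finite (UNIV :: 'a ordered_index set)" by (metis finite_imageI finite_lessThan)
qed

instantiation ordered_index :: (finite) wellorder
begin

definition "x \<le> y \<longleftrightarrow> Rep_ordered_index x \<le> Rep_ordered_index y"

definition "x < y \<longleftrightarrow> Rep_ordered_index x < Rep_ordered_index y"

instance
proof
  fix P :: "'a ordered_index \<Rightarrow> bool" and a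
  assume step: "\<And>x. (\<And>y. y < x \<Longrightarrow> P y) \<Longrightarrow> P x"
  show "P a"
    by (induction a rule: measure_induct_rule[of Rep_ordered_index])
      (rule step, simp add: less_ordered_index_def)
qed (auto simp: less_eq_ordered_index_def less_ordered_index_def Rep_ordered_index_inject)

end

lemma card_ordered_index: "CARD('n ordered_index) = CARD('n::finite)"
  using type_definition.card[OF type_definition_ordered_index] by simp

definition reindex :: "('m \<Rightarrow> 'n) \<Rightarrow> 'a ^ 'n \<Rightarrow> 'a ^ 'm" where
  "reindex h x = (\<chi> j. x $ h j)"

lemma prod_Basis_vec:
  fixes v :: "real ^ 'n::finite" and f :: "real \<Rightarrow> real"
  shows "(\<Prod>b\<in>Basis. f (v \<bullet> b)) = (\<Prod>i\<in>UNIV. f (v $ i))"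
proof -
  have B: "(Basis :: (real ^ 'n) set) = (\<lambda>i. axis i 1) ` UNIV"
    by (auto simp: Basis_vec_def)
  moreover have "inj (\<lambda>i :: 'n. axis i (1::real))"
    by (auto simp: inj_on_def axis_eq_axis)
  ultimately show ?thesis unfolding B by (subst prod.reindex) (simp_all add: inner_axis)
qed

text \<open>Lebesgue measure is determined by boxes, and the product of the side lengths does not
  depend on the names of the coordinates.\<close>

lemma lborel_reindex:
  fixes h :: "'m::finite \<Rightarrow> 'n::finite"
  assumes "bij h"
  shows "distr lborel borel (reindex h) = (lborel :: (real ^ 'm) measure)"
proof (rule lborel_eqI[symmetric])
  have linr: "linear (reindex h :: real ^ 'n \<Rightarrow> real ^ 'm)"
    by (auto simp: linear_iff reindex_def vec_eq_iff)
  then have meas: "(reindex h :: real ^ 'n \<Rightarrow> real ^ 'm) \<in> borel_measurable borel"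
    by (intro borel_measurable_continuous_onI linear_continuous_on) (simp add: linear_conv_bounded_linear)
  fix l u :: "real ^ 'm" assume lu: "\<And>b. b \<in> Basis \<Longrightarrow> l \<bullet> b \<le> u \<bullet> b"
  define g where "g = inv h"
  have hg: "h (g i) = i" "g (h j) = j" for i j
    using assms by (auto simp: g_def bij_is_surj bij_is_inj surj_f_inv_f)
  have "reindex h -` box l u = box (reindex g l) (reindex g u)"
    by (auto simp: mem_box_cart reindex_def) (metis hg)+
  then have "emeasure (distr lborel borel (reindex h)) (box l u)
      = emeasure lborel (box (reindex g l) (reindex g u))"
    using meas by (simp add: emeasure_distr)
  also have "\<dots> = (\<Prod>b\<in>Basis. (reindex g u - reindex g l) \<bullet> b)"
  proof (rule emeasure_lborel_box)
    fix b :: "real ^ 'n" assume "b \<in> Basis"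
    then obtain i where b: "b = axis i 1" by (auto simp: Basis_vec_def)
    have "l \<bullet> axis (g i) 1 \<le> u \<bullet> axis (g i) 1" by (rule lu) (auto simp: Basis_vec_def)
    then show "reindex g l \<bullet> b \<le> reindex g u \<bullet> b" by (simp add: b inner_axis reindex_def)
  qed
  also have "(\<Prod>b\<in>Basis. (reindex g u - reindex g l) \<bullet> b) = (\<Prod>i\<in>UNIV. u $ g i - l $ g i)"
    using prod_Basis_vec[of "\<lambda>x. x" "reindex g u - reindex g l"] by (simp add: reindex_def)
  also have "\<dots> = (\<Prod>j\<in>UNIV. u $ j - l $ j)"
    by (rule prod.reindex_bij_witness[of _ h g]) (auto simp: hg)
  also have "\<dots> = (\<Prod>b\<in>Basis. (u - l) \<bullet> b)"
    using prod_Basis_vec[of "\<lambda>x. x" "u - l"] by simp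
  finally show "emeasure (distr lborel borel (reindex h)) (box l u) = ennreal (\<Prod>b\<in>Basis. (u - l) \<bullet> b)" .
qed simp

lemma measure_reindex:
  fixes h :: "'m::finite \<Rightarrow> 'n::finite" and A :: "(real ^ 'n) set"
  assumes h: "bij h" and "A \<in> sets borel" "reindex h ` A \<in> sets borel"
  shows "measure lebesgue (reindex h ` A) = measure lebesgue A"
proof -
  have linr: "linear (reindex h :: real ^ 'n \<Rightarrow> real ^ 'm)"
    by (auto simp: linear_iff reindex_def vec_eq_iff)
  then have meas: "(reindex h :: real ^ 'n \<Rightarrow> real ^ 'm) \<in> borel_measurable borel"
    by (intro borel_measurable_continuous_onI linear_continuous_on) (simp add: linear_conv_bounded_linear)
  have inj: "inj (reindex h :: real ^ 'n \<Rightarrow> real ^ 'm)"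
    using h by (auto simp: inj_on_def reindex_def vec_eq_iff) (metis bij_pointE)
  have "measure lborel (reindex h ` A) = measure (distr lborel borel (reindex h)) (reindex h ` A)"
    by (simp add: lborel_reindex[OF h])
  also have "\<dots> = measure lborel (reindex h -` (reindex h ` A))"
    using meas assms(3) by (simp add: measure_distr)
  also have "reindex h -` (reindex h ` A) = A" using inj by (simp add: inj_vimage_image_eq)
  finally show ?thesis using assms(2,3) by simp
qed

lemma det_Ints:
  fixes A :: "'a::comm_ring_1 ^ 'm ^ 'm::finite"
  assumes "\<And>i j. A $ i $ j \<in> \<int>"
  shows "det A \<in> \<int>"
  unfolding det_def using assms by (intro Ints_sum Ints_mult Ints_prod) auto

text \<open>Cramer's rule: the coordinates of the solution are integral determinants divided by a
  unit.\<close>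

lemma unimodular_solve:
  fixes A :: "real ^ 'm ^ 'm::finite"
  assumes A: "\<And>i j. A $ i $ j \<in> \<int>" and d: "\<bar>det A\<bar> = 1" and b: "\<And>i. b $ i \<in> \<int>"
  obtains x where "A *v x = b" "\<And>i. x $ i \<in> \<int>"
proof
  let ?x = "\<chi> k. det (\<chi> i j. if j = k then b $ i else A $ i $ j) / det A"
  show "A *v ?x = b" using cramer[of A ?x b] d by force
  show "?x $ k \<in> \<int>" for k
  proof -
    have "det (\<chi> i j. if j = k then b $ i else A $ i $ j) \<in> \<int>"
      by (rule det_Ints) (use A b in auto)
    moreover have "det A = 1 \<or> det A = -1" using d by linarith
    ultimately show ?thesis by auto
  qed
qed

lemma inner_lat: "lat z \<bullet> lat u = of_int (pair z u)"
  by (simp add: inner_vec_def lat_def pair_def)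

lemma lat_diff: "lat (x - y) = lat x - lat y" and lat_add: "lat (x + y) = lat x + lat y"
  and lat_0 [simp]: "lat 0 = 0" and lat_inject [simp]: "lat x = lat y \<longleftrightarrow> x = y"
  by (auto simp: lat_def vec_eq_iff)

text \<open>Up to the factorial the volume is the absolute determinant of the edge vectors at one
  vertex, which is therefore one. Hence the increments of \<beta> from that vertex are realized by
  an integral vector. The lattice statements on simplices below rest on this.\<close>

lemma unimodular_simplex_functional:
  fixes Z :: "(real ^ 'n::finite) set"
  assumes Z: "finite Z" "card Z = Suc CARD('n)" "Z \<subseteq> range lat"
    and vol: "measure lebesgue (convex hull Z) = 1 / fact CARD('n)"
  obtains u :: "int ^ 'n" and c where "\<And>z. lat z \<in> Z \<Longrightarrow> pair z u = \<beta> z + c"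
proof -
  have "card (UNIV :: 'n ordered_index set) = card (UNIV :: 'n set)"
    by (simp add: card_ordered_index)
  then obtain h :: "'n ordered_index \<Rightarrow> 'n" where h: "bij h"
    using finite_same_card_bij[of "UNIV :: 'n ordered_index set" "UNIV :: 'n set"] by auto
  define g where "g = inv h"
  have hg: "h (g i) = i" "g (h j) = j" for i j
    using h by (auto simp: g_def bij_is_surj bij_is_inj surj_f_inv_f)
  let ?r = "reindex h :: real ^ 'n \<Rightarrow> real ^ 'n ordered_index"
  have linr: "linear ?r" by (auto simp: linear_iff reindex_def vec_eq_iff)
  have inj: "inj ?r"
    using hg by (auto simp: inj_on_def reindex_def vec_eq_iff) (metis hg(1))
  obtain z0 where z0: "lat z0 \<in> Z" using Z(2,3) by (metis card.empty ex_in_conv image_iff nat.distinct(1) subset_iff)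
  have card: "card (?r ` Z) = Suc CARD('n ordered_index)"
    using Z inj by (simp add: card_image card_ordered_index inj_on_subset)
  then have "card (?r ` Z - {?r (lat z0)}) = CARD('n ordered_index)"
    using z0 Z(1) by (subst card_Diff_singleton) auto
  then obtain f where f: "bij_betw f (UNIV :: 'n ordered_index set) (?r ` Z - {?r (lat z0)})"
    using finite_same_card_bij[of "UNIV :: 'n ordered_index set" "?r ` Z - {?r (lat z0)}"] Z(1) by auto
  have "\<exists>z. f j = ?r (lat z) \<and> lat z \<in> Z" for j
  proof -
    have "f j \<in> ?r ` Z" using bij_betw_apply[OF f, of j] by auto
    with Z(3) show ?thesis by auto
  qed
  then obtain zf where zf: "\<And>j. f j = ?r (lat (zf j))" "\<And>j. lat (zf j) \<in> Z" by metis
  \<comment> \<open>The columns of \<open>M\<close> are the edge vectors at \<open>lat z0\<close>,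
    written in the ordered coordinates.\<close>
  define M where "M = (\<chi> i j. f j $ i - ?r (lat z0) $ i)"
  have "measure lborel (convex hull (?r ` Z)) = \<bar>det M\<bar> / fact CARD('n ordered_index)"
    unfolding M_def by (rule content_simplex[OF _ card _ f]) (use Z(1) z0 in auto)
  moreover have "measure lborel (convex hull (?r ` Z)) = measure lebesgue (?r ` (convex hull Z))"
    using Z(1) by (subst measure_completion)
      (auto simp: convex_hull_linear_image[OF linr] finite_imp_compact_convex_hull intro!: borel_closed compact_imp_closed)
  moreover have "measure lebesgue (?r ` (convex hull Z)) = 1 / fact CARD('n)"
    using Z(1) unfolding vol[symmetric]
    by (intro measure_reindex h)
      (auto simp: convex_hull_linear_image[OF linr] finite_imp_compact_convex_hull intro!: borel_closed compact_imp_closed)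
  ultimately have "\<bar>det M\<bar> = 1" by (simp add: card_ordered_index)
  then have "\<bar>det (transpose M)\<bar> = 1" by (simp add: det_transpose)
  moreover have "transpose M $ i $ j \<in> \<int>" for i j
    by (simp add: transpose_def M_def zf reindex_def lat_def)
  ultimately obtain y where y: "transpose M *v y = (\<chi> j. of_int (\<beta> (zf j) - \<beta> z0))" "\<And>i. y $ i \<in> \<int>"
    using unimodular_solve[of "transpose M" "\<chi> j. of_int (\<beta> (zf j) - \<beta> z0)"] by auto
  define u where "u = (\<chi> i. \<lfloor>y $ g i\<rfloor>)"
  have u: "of_int (u $ i) = y $ g i" for i
    using y(2)[of "g i"] by (auto simp: u_def elim!: Ints_cases)
  have key: "pair (zf j - z0) u = \<beta> (zf j) - \<beta> z0" for j
  proof -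
    have "real_of_int (pair (zf j - z0) u) = (\<Sum>i\<in>UNIV. (lat (zf j) $ i - lat z0 $ i) * y $ g i)"
      by (simp add: pair_def u lat_def)
    also have "\<dots> = (\<Sum>i\<in>UNIV. (f j $ i - ?r (lat z0) $ i) * y $ i)"
      by (rule sum.reindex_bij_witness[of _ h g]) (auto simp: hg zf reindex_def)
    also have "\<dots> = (transpose M *v y) $ j"
      by (simp add: matrix_vector_mult_def transpose_def M_def)
    also have "\<dots> = of_int (\<beta> (zf j) - \<beta> z0)" unfolding y(1) by simp
    finally show ?thesis by linarith
  qed
  have "pair z u = \<beta> z + (pair z0 u - \<beta> z0)" if z: "lat z \<in> Z" for z
  proof (cases "z = z0")
    case False
    then have "?r (lat z) \<in> ?r ` Z - {?r (lat z0)}"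
      using z inj by (auto dest: injD)
    then obtain j where "?r (lat z) = f j" using f by (auto simp: bij_betw_def)
    then have "lat z = lat (zf j)" using injD[OF inj] zf by metis
    then have "z = zf j" by simp
    moreover have "pair (zf j) u = pair (zf j - z0) u + pair z0 u"
      by (simp flip: pair_add)
    ultimately show ?thesis using key by simp
  qed simp
  then show ?thesis by (rule that)
qed

section \<open>Simplices of a primitive triangulation\<close>

definition verts :: "'a::real_vector set \<Rightarrow> 'a set" where
  "verts \<sigma> = {v. v extreme_point_of \<sigma>}"

lemma verts_subset: "verts \<sigma> \<subseteq> \<sigma>"
  by (auto simp: verts_def extreme_point_of_def)

locale smooth_triangulation =
  fixes P :: "(real ^ 'n::finite) set" and K :: "(real ^ 'n) set set"
  assumes primitive: "primitive_triangulation P K"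
    and convex_P: "convex P" and aff_dim_P: "aff_dim P = int CARD('n)"
begin

lemma complex_K: "simplicial_complex K" and Union_K: "\<Union> K = P"
  using primitive by (auto simp: primitive_triangulation_def)

lemma finite_K: "finite K" and face_in_K: "\<And>F S. S \<in> K \<Longrightarrow> F face_of S \<Longrightarrow> F \<in> K"
  and Int_face_K: "\<And>S S'. S \<in> K \<Longrightarrow> S' \<in> K \<Longrightarrow> S \<inter> S' face_of S"
  using complex_K by (auto simp: simplicial_complex_def)

lemma simplex_K:
  assumes "\<sigma> \<in> K"
  shows "\<not> affine_dependent (verts \<sigma>)" "convex hull (verts \<sigma>) = \<sigma>"
    "int (card (verts \<sigma>)) = aff_dim \<sigma> + 1" "finite (verts \<sigma>)"
proof -
  obtain n C where C: "\<not> affine_dependent C" "\<sigma> = convex hull C" "int (card C) = n + 1"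
    using complex_K assms by (auto simp: simplicial_complex_def simplex_def)
  then have V: "verts \<sigma> = C"
    by (auto simp: verts_def extreme_point_of_convex_hull_affine_independent)
  have "aff_dim \<sigma> = int (card C) - 1"
    using C by (simp add: aff_dim_convex_hull affine_independent_iff_card)
  then show "\<not> affine_dependent (verts \<sigma>)" "convex hull (verts \<sigma>) = \<sigma>"
    "int (card (verts \<sigma>)) = aff_dim \<sigma> + 1" "finite (verts \<sigma>)"
    using C unfolding V by (simp_all add: aff_independent_finite)
qed

lemma convex_K: "\<sigma> \<in> K \<Longrightarrow> convex \<sigma>"
  using simplex_K(2) convex_convex_hull by metis

lemma compact_K: "\<sigma> \<in> K \<Longrightarrow> compact \<sigma>"
  using simplex_K(2,4) finite_imp_compact_convex_hull by metis

lemma K_subset_P: "\<sigma> \<in> K \<Longrightarrow> \<sigma> \<subseteq> P"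
  using Union_K by auto

lemma verts_lattice: "\<sigma> \<in> K \<Longrightarrow> verts \<sigma> \<subseteq> range lat"
  using primitive by (auto simp: primitive_triangulation_def verts_def)

lemma hull_K:
  assumes "\<tau> \<in> K" "S \<subseteq> verts \<tau>"
  shows "convex hull S face_of \<tau>" "convex hull S \<in> K" "verts (convex hull S) = S"
proof -
  show f: "convex hull S face_of \<tau>"
    using face_of_convex_hull_affine_independent[OF simplex_K(1)[OF assms(1)], of "convex hull S"]
      simplex_K(2)[OF assms(1)] assms(2) by auto
  show "convex hull S \<in> K" by (rule face_in_K[OF assms(1) f])
  show "verts (convex hull S) = S"
    using affine_independent_subset[OF simplex_K(1)[OF assms(1)] assms(2)]
    by (auto simp: verts_def extreme_point_of_convex_hull_affine_independent)
qed

lemma face_verts: "\<sigma> face_of \<tau> \<Longrightarrow> verts \<sigma> \<subseteq> verts \<tau>"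
  by (auto simp: verts_def extreme_point_of_face)

lemma face_iff_verts:
  assumes "\<sigma> \<in> K" "\<tau> \<in> K"
  shows "\<sigma> face_of \<tau> \<longleftrightarrow> verts \<sigma> \<subseteq> verts \<tau>"
  using face_verts hull_K(1)[OF assms(2)] simplex_K(2)[OF assms(1)] by metis

lemma verts_inject: "\<sigma> \<in> K \<Longrightarrow> \<tau> \<in> K \<Longrightarrow> verts \<sigma> = verts \<tau> \<longleftrightarrow> \<sigma> = \<tau>"
  using simplex_K(2) by metis

lemma face_same_dim: "\<tau> \<in> K \<Longrightarrow> \<sigma> face_of \<tau> \<Longrightarrow> aff_dim \<sigma> = aff_dim \<tau> \<Longrightarrow> \<sigma> = \<tau>"
  using face_of_aff_dim_lt[OF convex_K] by (metis less_irrefl)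

lemma face_refl_K: "\<sigma> \<in> K \<Longrightarrow> \<sigma> face_of \<sigma>"
  by (simp add: convex_K face_of_refl)

lemma aff_dim_face: "\<sigma> face_of \<tau> \<Longrightarrow> aff_dim \<sigma> \<le> aff_dim \<tau>"
  by (simp add: aff_dim_subset face_of_imp_subset)

lemma finite_fine_cells: "finite (fine_cells K q)"
  by (rule finite_subset[of _ "K \<times> K"]) (auto simp: fine_cells_def finite_K)

text \<open>An intermediate cell arises from [\<sigma>, \<tau>] either by adding to \<sigma> a
  vertex of \<open>\<sigma>2\<close> or by removing from \<tau> a vertex outside
  \<open>\<tau>2\<close>. The set \<open>D\<close> collects these vertices, and the dimensions force
  it to have two elements. Boundaries of boundaries vanish modulo two for this reason.\<close>

lemma diamond:
  assumes K: "\<sigma> \<in> K" "\<tau> \<in> K" "\<sigma>2 \<in> K" "\<tau>2 \<in> K"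
    and f: "\<sigma> face_of \<sigma>2" "\<sigma>2 face_of \<tau>2" "\<tau>2 face_of \<tau>"
    and dim: "aff_dim \<tau> - aff_dim \<sigma> = q + 1" "aff_dim \<tau>2 - aff_dim \<sigma>2 = q - 1"
  shows "card {(s, t). s \<in> K \<and> t \<in> K \<and> \<sigma> face_of s \<and> s face_of \<sigma>2 \<and> \<tau>2 face_of t \<and> t face_of \<tau>
    \<and> aff_dim t - aff_dim s = q} = 2" (is "card ?M = 2")
proof -
  note fin = simplex_K(4)[OF K(1)] simplex_K(4)[OF K(2)] simplex_K(4)[OF K(3)] simplex_K(4)[OF K(4)]
  have inc: "verts \<sigma> \<subseteq> verts \<sigma>2" "verts \<sigma>2 \<subseteq> verts \<tau>2" "verts \<tau>2 \<subseteq> verts \<tau>"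
    using f face_verts by auto
  note c = simplex_K(3)[OF K(1)] simplex_K(3)[OF K(2)] simplex_K(3)[OF K(3)] simplex_K(3)[OF K(4)]
  define D where "D = (verts \<sigma>2 - verts \<sigma>) \<union> (verts \<tau> - verts \<tau>2)"
  define g where "g x = (if x \<in> verts \<sigma>2 then (convex hull (insert x (verts \<sigma>)), \<tau>)
                         else (\<sigma>, convex hull (verts \<tau> - {x})))" for x
  have "card D = card (verts \<sigma>2 - verts \<sigma>) + card (verts \<tau> - verts \<tau>2)"
    unfolding D_def using fin inc by (intro card_Un_disjoint) auto
  also have "int \<dots> = 2"
    using c dim inc fin by (simp add: card_Diff_subset of_nat_diff card_mono)
  finally have D2: "card D = 2" by simp
  have "bij_betw g D ?M"
    unfolding bij_betw_def
  proof (intro conjI equalityI subsetI)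
    show "inj_on g D"
    proof (rule inj_onI)
      fix x y assume xy: "x \<in> D" "y \<in> D" "g x = g y"
      have A: "verts (convex hull (insert x (verts \<sigma>))) = insert x (verts \<sigma>)" if "x \<in> verts \<sigma>2" for x
        using hull_K(3)[OF K(3)] that inc by auto
      have B: "verts (convex hull (verts \<tau> - {x})) = verts \<tau> - {x}" for x
        using hull_K(3)[OF K(2)] by auto
      have C: "x \<notin> verts \<sigma>" if "x \<in> verts \<sigma>2" "x \<in> D" for x
        using that inc(2,3) by (auto simp: D_def)
      have E: "x \<in> verts \<tau>" if "x \<notin> verts \<sigma>2" "x \<in> D" for x
        using that by (auto simp: D_def)
      consider "x \<in> verts \<sigma>2" "y \<in> verts \<sigma>2" | "x \<in> verts \<sigma>2" "y \<notin> verts \<sigma>2"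
        | "x \<notin> verts \<sigma>2" "y \<in> verts \<sigma>2" | "x \<notin> verts \<sigma>2" "y \<notin> verts \<sigma>2" by blast
      then show "x = y"
      proof cases
        case 1
        then have "convex hull (insert x (verts \<sigma>)) = convex hull (insert y (verts \<sigma>))"
          using xy(3) by (simp add: g_def)
        then have "insert x (verts \<sigma>) = insert y (verts \<sigma>)" using A[OF 1(1)] A[OF 1(2)] by argo
        then show ?thesis using C[OF 1(1) xy(1)] C[OF 1(2) xy(2)] by blast
      next
        case 2
        then have "convex hull (insert x (verts \<sigma>)) = \<sigma>" using xy(3) by (simp add: g_def)
        then show ?thesis using A[OF 2(1)] C[OF 2(1) xy(1)] by auto
      next
        case 3
        then have "convex hull (insert y (verts \<sigma>)) = \<sigma>" using xy(3) by (simp add: g_def)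
        then show ?thesis using A[OF 3(2)] C[OF 3(2) xy(2)] by auto
      next
        case 4
        then have "convex hull (verts \<tau> - {x}) = convex hull (verts \<tau> - {y})"
          using xy(3) by (simp add: g_def)
        then have "verts \<tau> - {x} = verts \<tau> - {y}" using B[of x] B[of y] by argo
        then show ?thesis using E[OF 4(1) xy(1)] E[OF 4(2) xy(2)] by blast
      qed
    qed
  next
    fix e' assume "e' \<in> g ` D"
    then obtain x where x: "x \<in> D" "e' = g x" by auto
    show "e' \<in> ?M"
    proof (cases "x \<in> verts \<sigma>2")
      case True
      let ?s = "convex hull (insert x (verts \<sigma>))"
      have s: "?s \<in> K" "?s face_of \<sigma>2" "verts ?s = insert x (verts \<sigma>)"
        using hull_K[OF K(3), of "insert x (verts \<sigma>)"] True inc by auto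
      have "x \<notin> verts \<sigma>" using x True inc by (auto simp: D_def)
      then have d: "aff_dim ?s = aff_dim \<sigma> + 1"
        using simplex_K(3)[OF s(1)] c fin by (simp add: s(3))
      have "\<sigma> face_of ?s" using face_iff_verts[OF K(1) s(1)] s(3) by auto
      then show ?thesis
        using True s d dim K f by (auto simp: x(2) g_def face_refl_K)
    next
      case False
      let ?t = "convex hull (verts \<tau> - {x})"
      have xt: "x \<in> verts \<tau>" "x \<notin> verts \<tau>2" using x False inc by (auto simp: D_def)
      have t: "?t \<in> K" "?t face_of \<tau>" "verts ?t = verts \<tau> - {x}"
        using hull_K[OF K(2), of "verts \<tau> - {x}"] by auto
      have "card (verts \<tau>) = Suc (card (verts \<tau> - {x}))"
        by (rule card.remove[OF fin(2) xt(1)])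
      then have d: "aff_dim ?t = aff_dim \<tau> - 1"
        using simplex_K(3)[OF t(1)] c(2) unfolding t(3) by linarith
      have "\<tau>2 face_of ?t" using face_iff_verts[OF K(4) t(1)] t(3) inc xt by auto
      then show ?thesis
        using False t d dim K f by (auto simp: x(2) g_def face_refl_K)
    qed
  next
    fix e' assume e': "e' \<in> ?M"
    obtain s t where st: "e' = (s, t)" by (cases e')
    have sK: "s \<in> K" "t \<in> K" and dst: "aff_dim t - aff_dim s = q"
      using e' by (auto simp: st)
    have i: "verts \<sigma> \<subseteq> verts s" "verts s \<subseteq> verts \<sigma>2" "verts \<tau>2 \<subseteq> verts t" "verts t \<subseteq> verts \<tau>"
      using e' face_verts by (auto simp: st)
    note fs = simplex_K(4)[OF sK(1)] simplex_K(4)[OF sK(2)]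
    have "int (card (verts s - verts \<sigma>) + card (verts \<tau> - verts t)) = 1"
      using c simplex_K(3)[OF sK(1)] simplex_K(3)[OF sK(2)] dim dst i fin fs
      by (simp add: card_Diff_subset of_nat_diff card_mono)
    then consider "card (verts s - verts \<sigma>) = 1" "card (verts \<tau> - verts t) = 0"
      | "card (verts s - verts \<sigma>) = 0" "card (verts \<tau> - verts t) = 1" by linarith
    then show "e' \<in> g ` D"
    proof cases
      case 1
      then obtain x where x: "verts s - verts \<sigma> = {x}" by (auto simp: card_1_singleton_iff)
      have "verts \<tau> = verts t" using 1(2) fin fs i by auto
      then have "\<tau> = t" using verts_inject[OF K(2) sK(2)] by simp
      moreover have "verts s = insert x (verts \<sigma>)" using x i by auto
      then have "s = convex hull (insert x (verts \<sigma>))" using simplex_K(2)[OF sK(1)] by simp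
      ultimately have "e' = g x" "x \<in> D" using x i by (auto simp: st g_def D_def)
      then show ?thesis by blast
    next
      case 2
      then obtain x where x: "verts \<tau> - verts t = {x}" by (auto simp: card_1_singleton_iff)
      have "verts s = verts \<sigma>" using 2(1) fin fs i by auto
      then have "s = \<sigma>" using verts_inject[OF sK(1) K(1)] by simp
      moreover have "verts t = verts \<tau> - {x}" using x i by auto
      then have "t = convex hull (verts \<tau> - {x})" using simplex_K(2)[OF sK(2)] by simp
      moreover have "x \<notin> verts \<sigma>2" "x \<in> D" using x i inc by (auto simp: D_def)
      ultimately have "e' = g x" by (simp add: st g_def)
      with \<open>x \<in> D\<close> show ?thesis by blast
    qed
  qed
  then have "card D = card ?M"
    by (rule bij_betw_same_card)
  with D2 show ?thesis by simp
qed

section \<open>Simplices around a simplex of codimension one\<close>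

lemma rel_interior_subset_face:
  assumes "\<sigma> \<in> K" "\<rho> \<in> K" "x \<in> rel_interior \<sigma>" "x \<in> \<rho>"
  shows "\<sigma> face_of \<rho>"
proof -
  have "\<sigma> \<subseteq> \<sigma> \<inter> \<rho>"
    by (rule subset_of_face_of[OF Int_face_K[OF assms(1,2)]])
      (use assms rel_interior_subset in auto)
  then have "\<sigma> \<inter> \<rho> = \<sigma>" by auto
  with Int_face_K[OF assms(2,1)] show ?thesis by (simp add: Int_commute)
qed

lemma closed_P: "closed P"
  using finite_K compact_K compact_imp_closed by (subst Union_K[symmetric]) (auto intro!: closed_Union)

lemma coface_apex:
  assumes \<tau>: "\<tau> \<in> K" and \<rho>: "\<rho> \<in> K" "\<tau> face_of \<rho>" and d: "aff_dim \<rho> = aff_dim \<tau> + 1"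
  obtains w where "w \<notin> affine hull \<tau>" "verts \<rho> = insert w (verts \<tau>)" "w \<notin> verts \<tau>"
proof -
  have inc: "verts \<tau> \<subseteq> verts \<rho>" using face_verts[OF \<rho>(2)] .
  have "card (verts \<rho>) = Suc (card (verts \<tau>))"
    using simplex_K(3)[OF \<tau>] simplex_K(3)[OF \<rho>(1)] d by linarith
  then have "card (verts \<rho> - verts \<tau>) = 1"
    using inc simplex_K(4)[OF \<tau>] by (simp add: card_Diff_subset)
  then obtain w where w: "verts \<rho> - verts \<tau> = {w}" by (auto simp: card_1_singleton_iff)
  then have v: "verts \<rho> = insert w (verts \<tau>)" "w \<notin> verts \<tau>" using inc by auto
  then have "w \<notin> affine hull (verts \<tau>)"
    using simplex_K(1)[OF \<rho>(1)] by (auto simp: affine_dependent_def)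
  also have "affine hull (verts \<tau>) = affine hull \<tau>"
    using simplex_K(2)[OF \<tau>] affine_hull_convex_hull by metis
  finally show ?thesis using that v by blast
qed

lemma hyperplane_side:
  assumes V: "finite V" "\<And>v. v \<in> V \<Longrightarrow> a \<bullet> v = b" and x: "x \<in> convex hull (insert w V)"
    and s: "s * (a \<bullet> x - b) > (0::real)"
  shows "s * (a \<bullet> w - b) > 0"
proof (rule ccontr)
  assume "\<not> s * (a \<bullet> w - b) > 0"
  then have "insert w V \<subseteq> {y. (s *\<^sub>R a) \<bullet> y \<le> s * b}"
    using V(2) by (auto simp: algebra_simps)
  then have "convex hull (insert w V) \<subseteq> {y. (s *\<^sub>R a) \<bullet> y \<le> s * b}"
    by (intro hull_minimal convex_halfspace_le)
  with x s show False by (auto simp: algebra_simps)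
qed

text \<open>Points tending to \<open>x0\<close> along the normal from the chosen side are eventually
  in P, which is covered by finitely many simplices. One simplex contains infinitely many of the
  points, hence the limit \<open>x0\<close>, hence all of \<tau>; as it leaves the hyperplane, it is
  full-dimensional.\<close>

lemma coface_side_exists:
  assumes \<tau>: "\<tau> \<in> K" "aff_dim \<tau> = int CARD('n) - 1"
    and H: "affine hull \<tau> = {x. a \<bullet> x = b}" "a \<noteq> 0"
    and x0: "x0 \<in> rel_interior \<tau>" "x0 \<in> interior P" and s: "s \<noteq> (0::real)"
  obtains \<rho> w where "\<rho> \<in> K" "\<tau> face_of \<rho>" "aff_dim \<rho> = int CARD('n)"
    "verts \<rho> = insert w (verts \<tau>)" "w \<notin> verts \<tau>" "s * (a \<bullet> w - b) > 0"
proof -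
  define Y where "Y k = x0 + (s / real (Suc k)) *\<^sub>R a" for k
  have Y0: "Y \<longlonglongrightarrow> x0"
  proof -
    have "(\<lambda>k. s / real (Suc k)) \<longlonglongrightarrow> 0"
      using LIMSEQ_Suc[OF lim_const_over_n[of s]] by simp
    then have "(\<lambda>k. x0 + (s / real (Suc k)) *\<^sub>R a) \<longlonglongrightarrow> x0 + 0 *\<^sub>R a"
      by (intro tendsto_intros)
    then show ?thesis by (simp add: Y_def[abs_def])
  qed
  then have "eventually (\<lambda>k. Y k \<in> interior P) sequentially"
    using x0(2) by (simp add: topological_tendstoD)
  then obtain k0 where k0: "\<And>k. k \<ge> k0 \<Longrightarrow> Y k \<in> P"
    using interior_subset by (auto simp: eventually_sequentially)
  have "\<exists>\<rho>\<in>K. infinite {k. k \<ge> k0 \<and> Y k \<in> \<rho>}"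
  proof (rule ccontr)
    assume "\<not> ?thesis"
    then have "finite (\<Union>\<rho>\<in>K. {k. k \<ge> k0 \<and> Y k \<in> \<rho>})" using finite_K by auto
    moreover have "{k0..} \<subseteq> (\<Union>\<rho>\<in>K. {k. k \<ge> k0 \<and> Y k \<in> \<rho>})"
      using k0 Union_K by fastforce
    ultimately have "finite {k0..}" by (rule rev_finite_subset)
    then show False by (simp add: infinite_Ici)
  qed
  then obtain \<rho> where \<rho>: "\<rho> \<in> K" "infinite {k. k \<ge> k0 \<and> Y k \<in> \<rho>}" by blast
  have "x0 \<in> \<rho>"
  proof (rule ccontr)
    assume "x0 \<notin> \<rho>"
    then have "eventually (\<lambda>k. Y k \<in> - \<rho>) sequentially"
      using compact_imp_closed[OF compact_K[OF \<rho>(1)]] by (intro topological_tendstoD[OF Y0]) auto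
    then obtain k1 where "\<And>k. k \<ge> k1 \<Longrightarrow> Y k \<notin> \<rho>" by (auto simp: eventually_sequentially)
    then have "{k. k \<ge> k0 \<and> Y k \<in> \<rho>} \<subseteq> {..<k1}" by (auto simp flip: not_le)
    with \<rho>(2) show False using finite_subset by blast
  qed
  then have f: "\<tau> face_of \<rho>" by (rule rel_interior_subset_face[OF \<tau>(1) \<rho>(1) x0(1)])
  obtain k where k: "Y k \<in> \<rho>" using \<rho>(2) not_finite_existsD by fastforce
  have ax0: "a \<bullet> x0 = b"
    using x0(1) rel_interior_subset hull_subset[of \<tau> affine] H(1) by blast
  then have axk: "a \<bullet> Y k - b = s / real (Suc k) * (a \<bullet> a)"
    by (simp add: Y_def inner_add_right)
  then have "Y k \<notin> \<tau>"
    using H s hull_subset[of \<tau> affine] by fastforce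
  then have "\<tau> \<noteq> \<rho>" using k by auto
  then have "aff_dim \<tau> < aff_dim \<rho>" by (rule face_of_aff_dim_lt[OF convex_K[OF \<rho>(1)] f])
  moreover have "aff_dim \<rho> \<le> int CARD('n)" using aff_dim_le_DIM[of \<rho>] by simp
  ultimately have d: "aff_dim \<rho> = int CARD('n)" using \<tau>(2) by linarith
  obtain w where w: "verts \<rho> = insert w (verts \<tau>)" "w \<notin> verts \<tau>"
    using coface_apex[OF \<tau>(1) \<rho>(1) f] d \<tau>(2) by auto
  have "s * (a \<bullet> w - b) > 0"
  proof (rule hyperplane_side[OF simplex_K(4)[OF \<tau>(1)]])
    show "a \<bullet> v = b" if "v \<in> verts \<tau>" for v
      using that verts_subset[of \<tau>] hull_subset[of \<tau> affine] H(1) by blast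
    show "Y k \<in> convex hull (insert w (verts \<tau>))"
      using k simplex_K(2)[OF \<rho>(1)] w(1) by simp
    have "0 < s * s" using s not_real_square_gt_zero[of s] by blast
    then have "0 < s * s * (a \<bullet> a) / real (Suc k)"
      using H(2) by (intro divide_pos_pos mult_pos_pos[of "s * s"]) auto
    then show "s * (a \<bullet> Y k - b) > 0" by (simp add: axk)
  qed
  with that \<rho>(1) f d w show ?thesis by blast
qed

text \<open>The segment from \<open>x0\<close> to w starts inside \<open>\<rho>'\<close>: in
  barycentric coordinates for \<open>\<rho>'\<close>, those of \<open>x0\<close> are positive on
  \<tau>, and w has a positive coordinate at w' because both lie on the same side. So a relative
  interior point of \<open>\<rho>'\<close> lies in \<rho>, which makes \<open>\<rho>'\<close> a face
  of \<rho>.\<close>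

lemma coface_side_unique:
  assumes \<tau>: "\<tau> \<in> K" and H: "affine hull \<tau> = {x. a \<bullet> x = b}"
    and \<rho>: "\<rho> \<in> K" "\<tau> face_of \<rho>" "aff_dim \<rho> = int CARD('n)" "verts \<rho> = insert w (verts \<tau>)" "w \<notin> verts \<tau>"
    and \<rho>': "\<rho>' \<in> K" "\<tau> face_of \<rho>'" "aff_dim \<rho>' = int CARD('n)" "verts \<rho>' = insert w' (verts \<tau>)" "w' \<notin> verts \<tau>"
    and side: "s * (a \<bullet> w - b) > (0::real)" "s * (a \<bullet> w' - b) > 0"
    and x0: "x0 \<in> rel_interior \<tau>"
  shows "\<rho> = \<rho>'"
proof -
  let ?V = "verts \<tau>"
  note fin = simplex_K(4)[OF \<tau>]
  have aV: "a \<bullet> v = b" if "v \<in> ?V" for v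
    using that verts_subset[of \<tau>] hull_subset[of \<tau> affine] H(1) by blast
  have "\<exists>l. (\<forall>v\<in>?V. 0 < l v) \<and> sum l ?V = 1 \<and> (\<Sum>v\<in>?V. l v *\<^sub>R v) = x0"
    using x0 rel_interior_convex_hull_explicit[OF simplex_K(1)[OF \<tau>]] simplex_K(2)[OF \<tau>]
    by simp
  then obtain l where l: "\<And>v. v \<in> ?V \<Longrightarrow> 0 < l v" "sum l ?V = 1" "(\<Sum>v\<in>?V. l v *\<^sub>R v) = x0"
    by blast
  have "card (verts \<rho>') = Suc DIM(real ^ 'n)"
    using simplex_K(3)[OF \<rho>'(1)] \<rho>'(3) by simp
  then have "affine hull (verts \<rho>') = UNIV"
    using affine_independent_span_eq[OF simplex_K(1)[OF \<rho>'(1)]] by simp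
  then have "w \<in> affine hull (verts \<rho>')" by simp
  then obtain m where m: "sum m (verts \<rho>') = 1" "(\<Sum>v\<in>verts \<rho>'. m v *\<^sub>R v) = w"
    using affine_hull_finite[OF simplex_K(4)[OF \<rho>'(1)]] by auto
  have m1: "m w' + sum m ?V = 1" and m2: "m w' *\<^sub>R w' + (\<Sum>v\<in>?V. m v *\<^sub>R v) = w"
    using m \<rho>'(4,5) fin by auto
  have "a \<bullet> w = m w' * (a \<bullet> w') + (\<Sum>v\<in>?V. m v * (a \<bullet> v))"
    by (simp add: m2[symmetric] inner_add_right inner_sum_right)
  also have "(\<Sum>v\<in>?V. m v * (a \<bullet> v)) = (1 - m w') * b"
    using aV m1 by (simp flip: sum_distrib_right)
  finally have aw: "a \<bullet> w = m w' * (a \<bullet> w') + (1 - m w') * b" .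
  have "s * (a \<bullet> w - b) = m w' * (s * (a \<bullet> w' - b))"
    unfolding aw by (simp add: algebra_simps)
  then have mw: "m w' > 0" using side by (metis mult.commute zero_less_mult_pos)
  \<comment> \<open>The coordinates \<open>m v\<close> may be negative; for small t they are
    outweighed by the positive \<open>l v\<close>.\<close>
  have "\<exists>t>0. t < 1 \<and> (\<forall>v\<in>?V. (1 - t) * l v + t * m v > 0)"
  proof -
    have "eventually (\<lambda>t. (1 - t) * l v + t * m v > 0) (at_right 0)" if "v \<in> ?V" for v
    proof -
      have "((\<lambda>t. (1 - t) * l v + t * m v) \<longlongrightarrow> (1 - 0) * l v + 0 * m v) (at_right 0)"
        by (intro tendsto_intros)
      then show ?thesis using l(1)[OF that] by (simp add: order_tendstoD)
    qed
    then have "eventually (\<lambda>t. \<forall>v\<in>?V. (1 - t) * l v + t * m v > 0) (at_right 0)"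
      using fin by (simp add: eventually_ball_finite)
    moreover have "eventually (\<lambda>t::real. t \<in> {0<..<1}) (at_right 0)"
      by (rule eventually_at_right_real) simp
    ultimately have "eventually (\<lambda>t. t > 0 \<and> t < 1 \<and> (\<forall>v\<in>?V. (1 - t) * l v + t * m v > 0)) (at_right 0)"
      by eventually_elim auto
    from eventually_happens'[OF _ this] show ?thesis by simp
  qed
  then obtain t where t: "t > 0" "t < 1" "\<And>v. v \<in> ?V \<Longrightarrow> (1 - t) * l v + t * m v > 0" by blast
  define y where "y = (1 - t) *\<^sub>R x0 + t *\<^sub>R w"
  have "x0 \<in> \<rho>" using x0 rel_interior_subset face_of_imp_subset[OF \<rho>(2)] by blast
  moreover have "w \<in> \<rho>" using \<rho>(4) verts_subset[of \<rho>] by auto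
  ultimately have y\<rho>: "y \<in> \<rho>"
    unfolding y_def using t convex_K[OF \<rho>(1)] by (intro convexD) auto
  define c where "c v = (if v = w' then t * m w' else (1 - t) * l v + t * m v)" for v
  have cV: "(\<Sum>v\<in>?V. c v *\<^sub>R v) = (\<Sum>v\<in>?V. ((1 - t) * l v + t * m v) *\<^sub>R v)"
    "sum c ?V = (\<Sum>v\<in>?V. (1 - t) * l v + t * m v)"
    using \<rho>'(5) by (auto simp: c_def intro!: sum.cong)
  have "sum c (verts \<rho>') = t * m w' + ((1 - t) * sum l ?V + t * sum m ?V)"
    using \<rho>'(4,5) fin cV(2) by (simp add: c_def sum.distrib sum_distrib_left)
  also have "\<dots> = t * (m w' + sum m ?V) + (1 - t)" by (simp add: l(2) algebra_simps)
  finally have c1: "sum c (verts \<rho>') = 1" by (simp add: m1)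
  have "(\<Sum>v\<in>verts \<rho>'. c v *\<^sub>R v) = (t * m w') *\<^sub>R w' + (\<Sum>v\<in>?V. ((1 - t) * l v + t * m v) *\<^sub>R v)"
    using \<rho>'(4,5) fin cV(1) by (simp add: c_def)
  also have "\<dots> = (1 - t) *\<^sub>R (\<Sum>v\<in>?V. l v *\<^sub>R v) + t *\<^sub>R (m w' *\<^sub>R w' + (\<Sum>v\<in>?V. m v *\<^sub>R v))"
    by (simp add: scaleR_add_left sum.distrib scaleR_sum_right scaleR_add_right add.left_commute)
  finally have c2: "(\<Sum>v\<in>verts \<rho>'. c v *\<^sub>R v) = y" by (simp add: y_def l(3) m2)
  have "y \<in> rel_interior (convex hull (verts \<rho>'))"
    unfolding rel_interior_convex_hull_explicit[OF simplex_K(1)[OF \<rho>'(1)]]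
    using c1 c2 t mw \<rho>'(4,5) by (intro CollectI exI[of _ c]) (auto simp: c_def)
  then have "\<rho>' face_of \<rho>"
    using rel_interior_subset_face[OF \<rho>'(1) \<rho>(1) _ y\<rho>] simplex_K(2)[OF \<rho>'(1)] by simp
  then show ?thesis using face_same_dim[OF \<rho>(1)] \<rho>(3) \<rho>'(3) by metis
qed

text \<open>One coface on each side of the hyperplane spanned by \<open>\<tau>\<close>.\<close>

lemma card_cofaces_interior:
  assumes \<tau>: "\<tau> \<in> K" "aff_dim \<tau> = int CARD('n) - 1" "\<not> \<tau> \<subseteq> frontier P"
  shows "card {\<rho> \<in> K. \<tau> face_of \<rho> \<and> aff_dim \<rho> = int CARD('n)} = 2"
proof -
  obtain a b where H: "a \<noteq> 0" "affine hull \<tau> = {x. a \<bullet> x = b}"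
    using \<tau>(2) aff_dim_eq_hyperplane[of \<tau>] by auto
  obtain y where "y \<in> \<tau>" "y \<notin> frontier P" using \<tau>(3) by auto
  then have "y \<in> interior P"
    using K_subset_P[OF \<tau>(1)] closed_P by (auto simp: frontier_def)
  moreover have "y \<in> closure (rel_interior \<tau>)"
    using \<open>y \<in> \<tau>\<close> convex_closure_rel_interior[OF convex_K[OF \<tau>(1)]] closure_subset by blast
  ultimately obtain x0 where x0: "x0 \<in> rel_interior \<tau>" "x0 \<in> interior P"
    using open_Int_closure_eq_empty[OF open_interior[of P], of "rel_interior \<tau>"] by blast
  obtain \<rho>1 w1 where 1: "\<rho>1 \<in> K" "\<tau> face_of \<rho>1" "aff_dim \<rho>1 = int CARD('n)"
    "verts \<rho>1 = insert w1 (verts \<tau>)" "w1 \<notin> verts \<tau>" "1 * (a \<bullet> w1 - b) > 0"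
    by (rule coface_side_exists[OF \<tau>(1,2) H(2,1) x0, of 1]) auto
  obtain \<rho>2 w2 where 2: "\<rho>2 \<in> K" "\<tau> face_of \<rho>2" "aff_dim \<rho>2 = int CARD('n)"
    "verts \<rho>2 = insert w2 (verts \<tau>)" "w2 \<notin> verts \<tau>" "- 1 * (a \<bullet> w2 - b) > 0"
    by (rule coface_side_exists[OF \<tau>(1,2) H(2,1) x0, of "-1"]) auto
  have "\<rho> = \<rho>1 \<or> \<rho> = \<rho>2" if \<rho>: "\<rho> \<in> K" "\<tau> face_of \<rho>" "aff_dim \<rho> = int CARD('n)" for \<rho>
  proof -
    obtain w where w: "w \<notin> affine hull \<tau>" "verts \<rho> = insert w (verts \<tau>)" "w \<notin> verts \<tau>"
      by (rule coface_apex[OF \<tau>(1) \<rho>(1,2)]) (use \<rho>(3) \<tau>(2) in auto)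
    then have "1 * (a \<bullet> w - b) > 0 \<or> - 1 * (a \<bullet> w - b) > 0" using H(2) by auto
    then show ?thesis
      using coface_side_unique[OF \<tau>(1) H(2) \<rho> w(2,3) 1(1-5) _ 1(6) x0(1)]
        coface_side_unique[OF \<tau>(1) H(2) \<rho> w(2,3) 2(1-5) _ 2(6) x0(1)] by blast
  qed
  moreover have "\<rho>1 \<noteq> \<rho>2"
  proof
    assume "\<rho>1 = \<rho>2"
    then have "w1 = w2" using 1(4,5) 2(4,5) by auto
    then show False using 1(6) 2(6) by simp
  qed
  ultimately have "{\<rho> \<in> K. \<tau> face_of \<rho> \<and> aff_dim \<rho> = int CARD('n)} = {\<rho>1, \<rho>2}"
    using 1(1-3) 2(1-3) by auto
  with \<open>\<rho>1 \<noteq> \<rho>2\<close> show ?thesis by simp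
qed

end

section \<open>Reduction modulo two\<close>

lemma of_int_bit_eq_0: "of_int m = (0 :: bit) \<longleftrightarrow> even m"
proof -
  have "of_int (2 * k) = (0 :: bit)" for k by (simp only: of_int_mult) simp
  then have 1: "even m \<Longrightarrow> of_int m = (0 :: bit)" for m by (elim evenE) simp
  moreover have "of_int m = (1 :: bit)" if "odd m" for m
    using that 1[of "m - 1"] by (elim oddE) simp
  ultimately show ?thesis by (metis zero_neq_one)
qed

lemma mod2_add: "mod2 (x + y) = mod2 x + mod2 y" and mod2_0 [simp]: "mod2 0 = 0"
  by (simp_all add: mod2_def vec_eq_iff)

lemma mod2_diff: "mod2 (x - y) = mod2 x + mod2 y"
  by (simp add: mod2_def vec_eq_iff)

lemma pair_mod2: "pair (mod2 x) (mod2 y) = of_int (pair x y)"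
  by (simp add: pair_def mod2_def)

lemma mod2_surj: "\<exists>x. mod2 x = u"
proof
  show "mod2 (\<chi> i. if u $ i = 0 then 0 else 1) = u"
    by (simp add: mod2_def vec_eq_iff)
qed

lemma pair_diff: "pair (x - y) z = pair x z - pair y z" "pair z (x - y) = pair z x - pair z y"
  for x y z :: "'a::comm_ring_1 ^ 'i::finite"
  by (simp_all add: pair_def sum_subtractf algebra_simps)

lemma tangent_mono: "A \<subseteq> B \<Longrightarrow> tangent A \<subseteq> tangent B"
  unfolding tangent_def by (rule span_mono) auto

lemma tangent_diff: "x \<in> A \<Longrightarrow> y \<in> A \<Longrightarrow> x - y \<in> tangent A"
  unfolding tangent_def by (rule span_base) auto

lemma conormal2_antimono: "A \<subseteq> B \<Longrightarrow> conormal2 B \<subseteq> conormal2 A"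
  using tangent_mono unfolding conormal2_def by blast

lemma conormal2_subspace: "vec.subspace (conormal2 A)"
proof (rule bit_vec_subspaceI)
  show "0 \<in> conormal2 A"
    unfolding conormal2_def by (rule image_eqI[of _ _ 0]) simp_all
  fix x y assume "x \<in> conormal2 A" "y \<in> conormal2 A"
  then obtain u v where "x = mod2 u" "y = mod2 v" "\<forall>t\<in>tangent A. t \<bullet> lat u = 0" "\<forall>t\<in>tangent A. t \<bullet> lat v = 0"
    unfolding conormal2_def by blast
  then have "x + y = mod2 (u + v)" "\<forall>t\<in>tangent A. t \<bullet> lat (u + v) = 0"
    by (auto simp: mod2_add lat_add inner_add_right)
  then show "x + y \<in> conormal2 A" unfolding conormal2_def by blast
qed

lemma conormal2_pair:
  assumes "u \<in> conormal2 A" "lat z \<in> A" "lat z' \<in> A"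
  shows "pair (mod2 (z - z')) u = 0"
proof -
  obtain w where w: "u = mod2 w" "\<forall>t\<in>tangent A. t \<bullet> lat w = 0"
    using assms(1) unfolding conormal2_def by blast
  have "lat (z - z') \<bullet> lat w = 0" using w(2) tangent_diff[OF assms(2,3)] by (simp add: lat_diff)
  then have "pair (z - z') w = 0" by (simp add: inner_lat)
  then show ?thesis by (simp add: w pair_mod2)
qed

lemma tangent2_diff: "lat z \<in> A \<Longrightarrow> lat z' \<in> A \<Longrightarrow> mod2 (z - z') \<in> tangent2 A"
  unfolding tangent2_def using tangent_diff[of "lat z" A "lat z'"] by (auto simp: lat_diff)

section \<open>Integral functionals and dual bases of a simplex\<close>

context smooth_triangulation
begin

text \<open>A maximal simplex around \<sigma> has nonzero volume, so it is full-dimensional and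
  unimodular; \<sigma> is a face of it, and the functional found there is restricted to the vertices
  of \<sigma>.\<close>

lemma integral_functional:
  assumes "\<sigma> \<in> K"
  obtains u :: "int ^ 'n" and c where "\<And>z. lat z \<in> verts \<sigma> \<Longrightarrow> pair z u = \<beta> z + c"
proof -
  obtain \<tau> where \<tau>: "\<tau> \<in> K" "\<sigma> \<subseteq> \<tau>" "\<forall>\<rho>\<in>K. \<tau> \<subseteq> \<rho> \<longrightarrow> \<rho> = \<tau>"
    using finite_has_maximal2[OF finite_K assms] by metis
  have vol: "measure lebesgue \<tau> = 1 / fact CARD('n)"
    using primitive \<tau> by (auto simp: primitive_triangulation_def)
  have d: "aff_dim \<tau> = int CARD('n)"
  proof (rule ccontr)
    assume "aff_dim \<tau> \<noteq> int CARD('n)"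
    then have "aff_dim \<tau> < int DIM(real ^ 'n)" using aff_dim_le_DIM[of \<tau>] by simp
    then have "interior \<tau> = {}" using low_dim_interior by force
    then have "negligible \<tau>" by (simp add: negligible_convex_interior[OF convex_K[OF \<tau>(1)]])
    then show False using vol by (simp add: negligible_imp_measure0)
  qed
  have "card (verts \<tau>) = Suc CARD('n)" using simplex_K(3)[OF \<tau>(1)] d by linarith
  then obtain u c where u: "\<And>z. lat z \<in> verts \<tau> \<Longrightarrow> pair z u = \<beta> z + (c::int)"
    using unimodular_simplex_functional[OF simplex_K(4)[OF \<tau>(1)] _ verts_lattice[OF \<tau>(1)]]
      vol simplex_K(2)[OF \<tau>(1)] by metis
  have "\<sigma> \<inter> \<tau> = \<sigma>" using \<tau>(2) by auto
  then have "\<sigma> face_of \<tau>" using Int_face_K[OF \<tau>(1) assms] by (simp add: Int_commute)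
  then have "verts \<sigma> \<subseteq> verts \<tau>" by (rule face_verts)
  with u show ?thesis using that by blast
qed

lemma functional_mod2:
  fixes \<beta> :: "real ^ 'n \<Rightarrow> bit"
  assumes "\<sigma> \<in> K"
  obtains u where "\<And>z z'. lat z \<in> verts \<sigma> \<Longrightarrow> lat z' \<in> verts \<sigma> \<Longrightarrow>
    pair (mod2 (z - z')) u = \<beta> (lat z) + \<beta> (lat z')"
proof -
  obtain u c where u: "\<And>z. lat z \<in> verts \<sigma> \<Longrightarrow> pair z u = of_bool (\<beta> (lat z) = 1) + (c::int)"
    using integral_functional[OF assms, of "\<lambda>z. of_bool (\<beta> (lat z) = 1)"] by blast
  have "pair (mod2 (z - z')) (mod2 u) = \<beta> (lat z) + \<beta> (lat z')"
    if "lat z \<in> verts \<sigma>" "lat z' \<in> verts \<sigma>" for z z'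
    unfolding pair_mod2 pair_diff u[OF that(1)] u[OF that(2)]
    by (cases "\<beta> (lat z)"; cases "\<beta> (lat z')") simp_all
  then show ?thesis by (rule that)
qed

lemma tangent_verts:
  assumes "\<sigma> \<in> K" "z0 \<in> verts \<sigma>"
  shows "tangent \<sigma> = span {v - z0 | v. v \<in> verts \<sigma>}"
proof
  show "span {v - z0 | v. v \<in> verts \<sigma>} \<subseteq> tangent \<sigma>"
    unfolding tangent_def using verts_subset[of \<sigma>] assms(2) by (intro span_mono) auto
  have *: "x - z0 \<in> span {v - z0 | v. v \<in> verts \<sigma>}" if "x \<in> \<sigma>" for x
  proof -
    have "x \<in> convex hull (verts \<sigma>)" using that simplex_K(2)[OF assms(1)] by simp
    then obtain l where l: "sum l (verts \<sigma>) = 1" "(\<Sum>v\<in>verts \<sigma>. l v *\<^sub>R v) = x"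
      using convex_hull_finite[OF simplex_K(4)[OF assms(1)]] by auto
    have "x - z0 = (\<Sum>v\<in>verts \<sigma>. l v *\<^sub>R (v - z0))"
      by (simp add: scaleR_diff_right sum_subtractf l flip: scaleR_sum_left)
    also have "\<dots> \<in> span {v - z0 | v. v \<in> verts \<sigma>}"
      by (intro span_sum span_scale span_base) auto
    finally show ?thesis .
  qed
  have "x - y \<in> span {v - z0 | v. v \<in> verts \<sigma>}" if "x \<in> \<sigma>" "y \<in> \<sigma>" for x y
    using span_diff[OF *[OF that(1)] *[OF that(2)]] by simp
  then show "tangent \<sigma> \<subseteq> span {v - z0 | v. v \<in> verts \<sigma>}"
    unfolding tangent_def by (intro span_minimal) auto
qed

text \<open>From right to left a condition modulo two is lifted to the integers. A lift w of u has
  even differences on the vertices; an integral vector u' realizes half of them, so w - 2u' is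
  orthogonal to \<sigma> and still reduces to u.\<close>

lemma conormal2_simplex:
  assumes "\<sigma> \<in> K"
  shows "conormal2 \<sigma> = {u. \<forall>z z'. lat z \<in> verts \<sigma> \<longrightarrow> lat z' \<in> verts \<sigma> \<longrightarrow> pair (mod2 (z - z')) u = 0}"
    (is "_ = ?R")
proof
  show "conormal2 \<sigma> \<subseteq> ?R" using conormal2_pair verts_subset by blast
  show "?R \<subseteq> conormal2 \<sigma>"
  proof
    fix u assume u: "u \<in> ?R"
    obtain w where w: "mod2 w = u" using mod2_surj by blast
    show "u \<in> conormal2 \<sigma>"
    proof (cases "verts \<sigma> = {}")
      case True
      then have "\<sigma> = {}" using simplex_K(2)[OF assms] by simp
      then have "\<forall>t\<in>tangent \<sigma>. t \<bullet> lat w = 0" by (simp add: tangent_def)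
      then show ?thesis using w unfolding conormal2_def by blast
    next
      case False
      then obtain z0 where z0: "lat z0 \<in> verts \<sigma>" using verts_lattice[OF assms] by blast
      obtain u' c where u': "\<And>z. lat z \<in> verts \<sigma> \<Longrightarrow> pair z u' = (pair z w - pair z0 w) div 2 + (c::int)"
        using integral_functional[OF assms, of "\<lambda>z. (pair z w - pair z0 w) div 2"] by blast
      define w' where "w' = w - (u' + u')"
      have "pair (z - z0) w' = 0" if z: "lat z \<in> verts \<sigma>" for z
      proof -
        have "pair (mod2 (z - z0)) u = 0" using u z z0 by blast
        then have "of_int (pair (z - z0) w) = (0 :: bit)" by (simp only: w[symmetric] pair_mod2)
        then have "even (pair z w - pair z0 w)" by (simp only: of_int_bit_eq_0 pair_diff)
        moreover have "pair (z - z0) w' = (pair z w - pair z0 w) - 2 * (pair z u' - pair z0 u')"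
          by (simp only: w'_def pair_diff pair_add) simp
        ultimately show ?thesis using u'[OF z] u'[OF z0] by simp
      qed
      then have "(lat z - lat z0) \<bullet> lat w' = 0" if "lat z \<in> verts \<sigma>" for z
        using that by (simp add: inner_lat flip: lat_diff)
      then have "{v - lat z0 | v. v \<in> verts \<sigma>} \<subseteq> {t. t \<bullet> lat w' = 0}"
        using verts_lattice[OF assms] by auto
      then have "tangent \<sigma> \<subseteq> {t. t \<bullet> lat w' = 0}"
        unfolding tangent_verts[OF assms z0] by (intro span_minimal) (auto simp: subspace_def inner_add_left)
      moreover have "mod2 w' = u" by (simp only: w'_def mod2_diff mod2_add w) simp
      ultimately show ?thesis unfolding conormal2_def by blast
    qed
  qed
qed

lemma vertex_list:
  assumes "\<sigma> \<in> K" "lat z0 \<in> verts \<sigma>"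
  obtains zs where "distinct zs" "set zs = {z. lat z \<in> verts \<sigma> \<and> z \<noteq> z0}" "int (length zs) = aff_dim \<sigma>"
proof -
  have "inj lat" by (auto simp: inj_def)
  then have "finite {z. lat z \<in> verts \<sigma>}"
    using simplex_K(4)[OF assms(1)] finite_vimageI[of "verts \<sigma>" lat] by (simp add: vimage_def)
  then obtain zs where zs: "distinct zs" "set zs = {z. lat z \<in> verts \<sigma> \<and> z \<noteq> z0}"
    using finite_distinct_list[of "{z. lat z \<in> verts \<sigma> \<and> z \<noteq> z0}"] by auto
  have "verts \<sigma> = insert (lat z0) (lat ` set zs)"
    unfolding zs(2) using assms(2) verts_lattice[OF assms(1)] by blast
  moreover have "lat z0 \<notin> lat ` set zs" unfolding zs(2) by (auto simp: image_iff)
  moreover have "card (lat ` set zs) = length zs"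
    using card_image[OF inj_on_subset[OF \<open>inj lat\<close> subset_UNIV]] distinct_card[OF zs(1)] by metis
  ultimately have "card (verts \<sigma>) = Suc (length zs)" by simp
  then show ?thesis using zs that simplex_K(3)[OF assms(1)] by simp
qed

text \<open>\<open>ds ! j\<close> is the linear part of an integral affine function that separates
  the vertex \<open>zs ! j\<close> from all the others by one.\<close>

lemma dual_basis:
  assumes \<sigma>: "\<sigma> \<in> K" and zs: "distinct zs" "set zs = {z. lat z \<in> verts \<sigma> \<and> z \<noteq> z0}"
    and z0: "lat z0 \<in> verts \<sigma>"
  obtains ds :: "(int ^ 'n) list" where "length ds = length zs"
    "\<And>i j. i < length zs \<Longrightarrow> j < length zs \<Longrightarrow> pair (zs ! i - z0) (ds ! j) = of_bool (i = j)"
proof -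
  have "\<exists>d :: int ^ 'n. \<forall>i<length zs. pair (zs ! i - z0) d = of_bool (i = j)" if "j < length zs" for j
  proof -
    obtain u c where u: "\<And>z. lat z \<in> verts \<sigma> \<Longrightarrow> pair z u = of_bool (z = zs ! j) + (c::int)"
      using integral_functional[OF \<sigma>, of "\<lambda>z. of_bool (z = zs ! j)"] by blast
    have "zs ! j \<noteq> z0" using zs nth_mem[OF that] by blast
    then have "pair (zs ! i - z0) u = of_bool (i = j)" if "i < length zs" for i
      using u[of "zs ! i"] u[OF z0] zs nth_mem[OF that] that \<open>j < length zs\<close>
      by (auto simp: pair_diff nth_eq_iff_index_eq)
    then show ?thesis by blast
  qed
  then obtain d :: "nat \<Rightarrow> int ^ 'n" where
    "\<And>j i. j < length zs \<Longrightarrow> i < length zs \<Longrightarrow> pair (zs ! i - z0) (d j) = of_bool (i = j)" by metis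
  then show ?thesis using that[of "map d [0..<length zs]"] by simp
qed

text \<open>Pairing with the dual vectors shows that the wedge product of the edge directions at
  \<open>z0\<close> is nonzero. The same vectors read off the coefficients of a lattice vector
  tangent to \<sigma>, which are thus integers. So the edge directions span
  \<open>tangent2 \<sigma>\<close>, and its top exterior power is the line through their
  product.\<close>

lemma omega_eq:
  assumes \<sigma>: "\<sigma> \<in> K" and zs: "distinct zs" "set zs = {z. lat z \<in> verts \<sigma> \<and> z \<noteq> z0}"
    "int (length zs) = aff_dim \<sigma>" and z0: "lat z0 \<in> verts \<sigma>"
  shows "omega \<sigma> = wedge_list (map (\<lambda>z. mod2 (z - z0)) zs)"
    and "omega \<sigma> \<in> ext_power (length zs) (vec.span ((\<lambda>z. mod2 (z - z0)) ` set zs))"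
proof -
  let ?b = "\<lambda>z. mod2 (z - z0)"
  let ?bs = "map ?b zs"
  obtain ds where ds: "length ds = length zs"
    "\<And>i j. i < length zs \<Longrightarrow> j < length zs \<Longrightarrow> pair (zs ! i - z0) (ds ! j) = of_bool (i = j)"
    using dual_basis[OF \<sigma> zs(1,2) z0] by blast
  have dual: "pair (?bs ! i) (map mod2 ds ! j) = of_bool (i = j)" if "i < length zs" "j < length zs" for i j
    using that ds(1) ds(2)[OF that] by (simp add: pair_mod2)
  have bs: "distinct ?bs"
  proof (rule ccontr)
    assume "\<not> distinct ?bs"
    then obtain i j where ij: "i < length zs" "j < length zs" "i \<noteq> j" "?bs ! i = ?bs ! j"
      by (auto simp: distinct_conv_nth)
    then show False using dual[of i i] dual[of j i] by simp
  qed
  have "pair (wedge_list ?bs) (wedge_list (map mod2 ds)) = 1"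
    by (rule pair_wedge_list_dual) (use ds(1) dual in auto)
  then have nz: "wedge_list ?bs \<noteq> 0" by auto
  have t: "tangent2 \<sigma> \<subseteq> vec.span (set ?bs)"
  proof
    fix x assume "x \<in> tangent2 \<sigma>"
    then obtain m where m: "x = mod2 m" "lat m \<in> tangent \<sigma>" by (auto simp: tangent2_def)
    let ?e = "\<lambda>i. zs ! i - z0"
    let ?k = "length zs"
    have "lat m \<in> {y. \<exists>r. y = (\<Sum>i<?k. r i *\<^sub>R lat (?e i))}"
    proof -
      have "subspace {y. \<exists>r. y = (\<Sum>i<?k. r i *\<^sub>R lat (?e i))}"
        unfolding subspace_def
      proof (intro conjI ballI allI)
        show "0 \<in> {y. \<exists>r. y = (\<Sum>i<?k. r i *\<^sub>R lat (?e i))}"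
          by (auto intro!: exI[of _ "\<lambda>_. 0"])
        fix x y assume "x \<in> {y. \<exists>r. y = (\<Sum>i<?k. r i *\<^sub>R lat (?e i))}" "y \<in> {y. \<exists>r. y = (\<Sum>i<?k. r i *\<^sub>R lat (?e i))}"
        then obtain r s where "x = (\<Sum>i<?k. r i *\<^sub>R lat (?e i))" "y = (\<Sum>i<?k. s i *\<^sub>R lat (?e i))" by auto
        then have "x + y = (\<Sum>i<?k. (r i + s i) *\<^sub>R lat (?e i))"
          by (simp add: scaleR_add_left sum.distrib)
        then show "x + y \<in> {y. \<exists>r. y = (\<Sum>i<?k. r i *\<^sub>R lat (?e i))}"
          by (intro CollectI exI[of _ "\<lambda>i. r i + s i"])
      next
        fix c x assume "x \<in> {y. \<exists>r. y = (\<Sum>i<?k. r i *\<^sub>R lat (?e i))}"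
        then obtain r where "x = (\<Sum>i<?k. r i *\<^sub>R lat (?e i))" by auto
        then have "c *\<^sub>R x = (\<Sum>i<?k. (c * r i) *\<^sub>R lat (?e i))" by (simp add: scaleR_sum_right)
        then show "c *\<^sub>R x \<in> {y. \<exists>r. y = (\<Sum>i<?k. r i *\<^sub>R lat (?e i))}"
          by (intro CollectI exI[of _ "\<lambda>i. c * r i"])
      qed
      moreover have "{v - lat z0 | v. v \<in> verts \<sigma>} \<subseteq> {y. \<exists>r. y = (\<Sum>i<?k. r i *\<^sub>R lat (?e i))}"
      proof clarify
        fix v assume v: "v \<in> verts \<sigma>"
        show "\<exists>r. v - lat z0 = (\<Sum>i<?k. r i *\<^sub>R lat (?e i))"
        proof (cases "v = lat z0")
          case True
          then show ?thesis by (auto intro!: exI[of _ "\<lambda>_. 0"])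
        next
          case False
          then obtain z where "v = lat z" "z \<in> set zs" using v verts_lattice[OF \<sigma>] zs(2) by blast
          then obtain i where i: "i < ?k" "v = lat (zs ! i)" by (auto simp: in_set_conv_nth)
          have "(\<Sum>j<?k. (if j = i then 1 else 0) *\<^sub>R lat (?e j)) = (\<Sum>j<?k. if j = i then lat (?e i) else 0)"
            by (rule sum.cong) auto
          also have "\<dots> = lat (?e i)" using i by simp
          finally show ?thesis using i by (auto simp: lat_diff intro!: exI[of _ "\<lambda>j. if j = i then 1 else 0"])
        qed
      qed
      ultimately have "span {v - lat z0 | v. v \<in> verts \<sigma>} \<subseteq> {y. \<exists>r. y = (\<Sum>i<?k. r i *\<^sub>R lat (?e i))}"
        by (intro span_minimal)
      then show ?thesis using m(2) tangent_verts[OF \<sigma> z0] by auto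
    qed
    then obtain r where r: "lat m = (\<Sum>i<?k. r i *\<^sub>R lat (?e i))" by auto
    have "r j = of_int (pair m (ds ! j))" if j: "j < ?k" for j
    proof -
      have "of_int (pair m (ds ! j)) = (\<Sum>i<?k. r i * of_int (pair (?e i) (ds ! j)))"
        by (simp add: r inner_sum_left flip: inner_lat)
      also have "\<dots> = (\<Sum>i<?k. if i = j then r j else 0)"
        by (rule sum.cong) (auto simp: ds(2) j)
      finally show ?thesis using j by simp
    qed
    then have "lat m = lat (\<chi> l. \<Sum>i<?k. pair m (ds ! i) * ?e i $ l)"
      unfolding r by (simp add: lat_def vec_eq_iff)
    then have "m = (\<chi> l. \<Sum>i<?k. pair m (ds ! i) * ?e i $ l)" by (simp only: lat_inject)
    then have "x = (\<chi> l. \<Sum>i<?k. of_int (pair m (ds ! i)) * mod2 (?e i) $ l)"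
      using m(1) by (metis (mono_tags, lifting) mod2_def of_int_mult of_int_sum sum.cong vec_lambda_beta vec_lambda_unique)
    also have "\<dots> = (\<Sum>i<?k. bit_scale (of_int (pair m (ds ! i))) (mod2 (?e i)))"
    proof -
      have "of_int c * (v :: bit) = bit_scale (of_int c) v" for c v
        by (cases "of_int c :: bit") simp_all
      moreover have "bit_scale c v $ l = bit_scale c (v $ l)" for c and v :: "bit ^ 'n" and l
        by (simp add: bit_scale_def)
      ultimately show ?thesis by (simp add: vec_eq_iff)
    qed
    also have "\<dots> \<in> vec.span (set ?bs)"
    proof (rule vec.span_sum)
      fix i assume "i \<in> {..<?k}"
      then have "mod2 (?e i) \<in> set ?bs" by simp
      then show "bit_scale (of_int (pair m (ds ! i))) (mod2 (?e i)) \<in> vec.span (set ?bs)"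
        by (simp add: bit_scale_def vec.span_base vec.span_zero)
    qed
    finally show "x \<in> vec.span (set ?bs)" .
  qed
  have bt: "set ?bs \<subseteq> tangent2 \<sigma>"
    using zs(2) z0 verts_subset[of \<sigma>] by (auto intro!: tangent2_diff)
  have k: "nat (aff_dim \<sigma>) = length ?bs" using zs(3) by simp
  have mem: "wedge_list ?bs \<in> ext_power (nat (aff_dim \<sigma>)) (tangent2 \<sigma>)"
    unfolding k using bt by (intro ext_power_base) auto
  have mono: "ext_power q V \<subseteq> ext_power q W" if "V \<subseteq> W" for q and V W :: "(bit ^ 'n) set"
    unfolding ext_power_def using that by (intro vec.span_mono) blast
  show eq: "omega \<sigma> = wedge_list ?bs"
    unfolding omega_def
  proof (rule the_equality)
    fix w assume w: "w \<in> ext_power (nat (aff_dim \<sigma>)) (tangent2 \<sigma>) \<and> w \<noteq> 0"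
    then have "w \<in> ext_power (length ?bs) (vec.span (set ?bs))"
      using mono[OF t] unfolding k by blast
    then show "w = wedge_list ?bs" using ext_power_top[OF bs] w by blast
  qed (use mem nz in blast)
  show "omega \<sigma> \<in> ext_power (length zs) (vec.span (?b ` set zs))"
    using mem mono[OF t] unfolding eq k by auto
qed

text \<open>The factors of \<omega>(\<sigma>) are directions of \<sigma>, on which s vanishes. So
  contraction with s kills \<omega>(\<sigma>), and contraction is adjoint to the wedge
  product.\<close>

lemma omega_annihilates:
  assumes \<sigma>: "\<sigma> \<in> K" "0 \<le> aff_dim \<sigma>" and s: "s \<in> conormal2 \<sigma>"
  shows "pair (omega \<sigma>) (wedge (ext_vec s) y) = 0"
proof -
  have "verts \<sigma> \<noteq> {}" using simplex_K(3)[OF \<sigma>(1)] \<sigma>(2) by auto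
  then obtain z0 where z0: "lat z0 \<in> verts \<sigma>" using verts_lattice[OF \<sigma>(1)] by blast
  obtain zs where zs: "distinct zs" "set zs = {z. lat z \<in> verts \<sigma> \<and> z \<noteq> z0}" "int (length zs) = aff_dim \<sigma>"
    using vertex_list[OF \<sigma>(1) z0] by blast
  have "pair m s = 0" if "m \<in> vec.span ((\<lambda>z. mod2 (z - z0)) ` set zs)" for m
    using that
  proof (induction rule: bit_span_induct)
    case (base b)
    then show ?case using s zs(2) z0 unfolding conormal2_simplex[OF \<sigma>(1)] by auto
  qed (simp_all add: pair_add)
  then have "contract s (omega \<sigma>) = 0"
    by (rule contract_ext_power[OF omega_eq(2)[OF \<sigma>(1) zs z0]])
  then show ?thesis by (simp add: pair_wedge_ext_vec)
qed

lemma edge_cases: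
  assumes "\<sigma> \<in> K" "e edge_of \<sigma>"
  obtains z0 z1 where "lat z0 \<in> verts \<sigma>" "lat z1 \<in> verts \<sigma>" "z0 \<noteq> z1" "verts e = {lat z0, lat z1}" "e \<in> K"
    "omega e = ext_vec (mod2 (z1 - z0))"
proof -
  have e: "e face_of \<sigma>" "aff_dim e = 1" using assms(2) by (auto simp: edge_of_def)
  have eK: "e \<in> K" by (rule face_in_K[OF assms(1) e(1)])
  have "card (verts e) = 2" using simplex_K(3)[OF eK] e(2) by simp
  then obtain v0 v1 where v: "verts e = {v0, v1}" "v0 \<noteq> v1" by (auto simp: card_2_iff)
  then obtain z0 z1 where z: "v0 = lat z0" "v1 = lat z1" using verts_lattice[OF eK] by auto
  have "omega e = wedge_list (map (\<lambda>z. mod2 (z - z0)) [z1])"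
    by (rule omega_eq(1)[OF eK]) (use v z e(2) in auto)
  then show ?thesis using that[of z0 z1] face_verts[OF e(1)] v z eK by auto
qed

lemma edge_exists:
  assumes "\<sigma> \<in> K" "lat z0 \<in> verts \<sigma>" "lat z1 \<in> verts \<sigma>" "z0 \<noteq> z1"
  shows "closed_segment (lat z0) (lat z1) edge_of \<sigma>" "closed_segment (lat z0) (lat z1) \<in> K"
    "verts (closed_segment (lat z0) (lat z1)) = {lat z0, lat z1}"
    "omega (closed_segment (lat z0) (lat z1)) = ext_vec (mod2 (z1 - z0))"
proof -
  let ?e = "closed_segment (lat z0) (lat z1)"
  have e: "?e face_of \<sigma>" "?e \<in> K" "verts ?e = {lat z0, lat z1}"
    using hull_K[OF assms(1), of "{lat z0, lat z1}"] assms by (auto simp: segment_convex_hull)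
  moreover have "aff_dim ?e = 1"
    using simplex_K(3)[OF e(2)] e(3) assms(4) by simp
  ultimately show "?e edge_of \<sigma>" "?e \<in> K" "verts ?e = {lat z0, lat z1}" by (auto simp: edge_of_def)
  have "omega ?e = wedge_list (map (\<lambda>z. mod2 (z - z0)) [z1])"
    by (rule omega_eq(1)[OF e(2)]) (use e(3) \<open>aff_dim ?e = 1\<close> assms(4) in auto)
  then show "omega ?e = ext_vec (mod2 (z1 - z0))" by simp
qed

lemma conormal2_edge:
  assumes "\<sigma> \<in> K" "e edge_of \<sigma>" "verts e = {lat z0, lat z1}"
  shows "conormal2 e = {u. pair (mod2 (z1 - z0)) u = 0}"
proof -
  have "e \<in> K" using assms face_in_K by (auto simp: edge_of_def)
  then show ?thesis
    unfolding conormal2_simplex[OF \<open>e \<in> K\<close>] assms(3) by (auto simp: mod2_diff add.commute)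
qed

end

section \<open>The stalks of the sign cosheaf\<close>

lemma keys_sum_subset:
  "Poly_Mapping.keys (sum f I) \<subseteq> (\<Union>i\<in>I. Poly_Mapping.keys (f i :: 'k \<Rightarrow>\<^sub>0 bit))"
proof (induction I rule: infinite_finite_induct)
  case (insert i I)
  then show ?case using keys_add[of "f i" "sum f I"] by auto
qed auto

lemma keys_aug_prod_subspace:
  assumes "vec.subspace V" "set us \<subseteq> V"
  shows "Poly_Mapping.keys (aug_prod us) \<subseteq> V"
  using assms(2)
proof (induction us)
  case Nil
  then show ?case using vec.subspace_0[OF assms(1)] by simp
next
  case (Cons u us)
  then have "(+) u ` Poly_Mapping.keys (aug_prod us) \<subseteq> V"
    using vec.subspace_add[OF assms(1)] by auto
  moreover have "Poly_Mapping.keys (aug_prod (u # us))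
      \<subseteq> Poly_Mapping.keys (aug_prod us) \<union> (+) u ` Poly_Mapping.keys (aug_prod us)"
    using keys_add[of "aug_prod us" "xpow u * aug_prod us"] keys_mult_xpow[of u "aug_prod us"]
    by (simp add: distrib_right)
  moreover have "Poly_Mapping.keys (aug_prod us) \<subseteq> V" using Cons by simp
  ultimately show ?case by blast
qed

lemma keys_quot: "Poly_Mapping.keys (quot S r) \<subseteq> (\<lambda>w. w +o S) ` Poly_Mapping.keys r"
proof -
  have "Poly_Mapping.keys (quot S r) \<subseteq> (\<Union>u\<in>Poly_Mapping.keys r. Poly_Mapping.keys (gen (u +o S)))"
    unfolding quot_def bit_lin_keys by (rule keys_sum_subset)
  then show ?thesis by (auto simp: gen_def)
qed

text \<open>Pushing any lift forward along an additive choice of representatives keeps it in the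
  filtration and cancels everything over cosets outside the support of \<open>a\<close>.\<close>

lemma lift_support:
  assumes S: "vec.subspace S" and a: "a \<in> quot S ` aug_filt p"
  obtains r where "r \<in> aug_filt p" "quot S r = a" "\<And>w. w \<in> Poly_Mapping.keys r \<Longrightarrow> w +o S \<in> Poly_Mapping.keys a"
proof -
  obtain r0 where r0: "r0 \<in> aug_filt p" "a = quot S r0" using a by blast
  obtain \<pi> where \<pi>: "\<And>u v. \<pi> (u + v) = \<pi> u + \<pi> v" "\<And>u. u + \<pi> u \<in> S" "\<And>s. s \<in> S \<Longrightarrow> \<pi> s = 0"
    using exists_projection[OF S] by blast
  have r: "pushfwd \<pi> r0 = bit_lin (\<lambda>U. xpow (\<pi> (SOME u. u \<in> U))) a"
    unfolding r0(2) by (rule pushfwd_eq_bit_lin_quot[OF S \<pi>(1,3)])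
  show ?thesis
  proof (rule that[of "pushfwd \<pi> r0"])
    show "pushfwd \<pi> r0 \<in> aug_filt p" by (rule pushfwd_aug_filt[OF \<pi>(1) r0(1)])
    show "quot S (pushfwd \<pi> r0) = a" using pushfwd_quot[OF S \<pi>(2)] r0(2) by simp
    fix w assume "w \<in> Poly_Mapping.keys (pushfwd \<pi> r0)"
    then obtain U where U: "U \<in> Poly_Mapping.keys a" "w = \<pi> (SOME u. u \<in> U)"
      unfolding r bit_lin_keys
      using keys_sum_subset[of "\<lambda>U. xpow (\<pi> (SOME u. u \<in> U))" "Poly_Mapping.keys a"]
      by (auto simp: xpow_def)
    obtain u where u: "U = u +o S" using U(1) keys_quot[of S r0] r0(2) by auto
    define v where "v = (SOME u. u \<in> U)"
    have "u \<in> U" using vec.subspace_0[OF S] by (force simp: u elt_set_plus_def)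
    then have "v \<in> U" unfolding v_def by (rule someI)
    then have "v + u \<in> S" by (auto simp: u elt_set_plus_def ac_simps)
    moreover have "v + \<pi> v \<in> S" by (rule \<pi>(2))
    ultimately have "(v + u) + (v + \<pi> v) \<in> S" by (rule vec.subspace_add[OF S])
    moreover have "(v + u) + (v + \<pi> v) = w + u" by (simp add: U(2) v_def ac_simps)
    ultimately have "w +o S = U" using coset_eq_iff[OF S] u by simp
    with U(1) show "w +o S \<in> Poly_Mapping.keys a" by simp
  qed
qed

text \<open>Combinatorial form of the inclusion of u\<cdot>[\<sigma>, Q] in the T-hypersurface.
  Equal vertices never satisfy the equation, as its left-hand side is then zero, so only edges
  count.\<close>

definition active :: "(real ^ 'n \<Rightarrow> bit) \<Rightarrow> (real ^ 'n) set \<Rightarrow> bit ^ 'n \<Rightarrow> bool" where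
  "active \<epsilon> \<sigma> u \<longleftrightarrow> (\<exists>z z'. lat z \<in> verts \<sigma> \<and> lat z' \<in> verts \<sigma> \<and>
     pair (mod2 (z - z')) u + \<epsilon> (lat z) + \<epsilon> (lat z') = 1)"

text \<open>Representatives over N_2 of the stalk of F_p, before the quotient by Sed.\<close>

definition fspan :: "nat \<Rightarrow> (real ^ 'n) set \<Rightarrow> ('n::finite ext) set" where
  "fspan p \<sigma> = vec.span (\<Union>e\<in>{e. e edge_of \<sigma>}. ext_power p (conormal2 e))"

lemma fspan_add: "x \<in> fspan p \<sigma> \<Longrightarrow> y \<in> fspan p \<sigma> \<Longrightarrow> x + y \<in> fspan p \<sigma>"
  unfolding fspan_def by (rule vec.span_add)

lemma fspan_0 [simp]: "0 \<in> fspan p \<sigma>"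
  unfolding fspan_def by (rule vec.span_zero)

lemma active_shift:
  assumes "active \<epsilon> \<sigma> u" "u + w \<in> conormal2 Q" "\<sigma> \<subseteq> Q"
  shows "active \<epsilon> \<sigma> w"
proof -
  obtain z z' where z: "lat z \<in> verts \<sigma>" "lat z' \<in> verts \<sigma>"
    "pair (mod2 (z - z')) u + \<epsilon> (lat z) + \<epsilon> (lat z') = 1"
    using assms(1) by (auto simp: active_def)
  have "pair (mod2 (z - z')) (u + w) = 0"
    using assms(2,3) z verts_subset[of \<sigma>] by (intro conormal2_pair[of _ Q]) auto
  then have "pair (mod2 (z - z')) u = pair (mod2 (z - z')) w"
    by (metis add.commute add_cancel_left_right bit_add_self pair_add(2) add.left_commute)
  with z show ?thesis by (auto simp: active_def)
qed

section \<open>The T-hypersurface, and \<open>bv\<close> over a single cell\<close>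

context smooth_triangulation
begin

lemma barycenter_rel_interior:
  assumes "\<sigma> \<in> K" "\<sigma> \<noteq> {}"
  shows "barycenter \<sigma> \<in> rel_interior \<sigma>"
proof -
  have ne: "verts \<sigma> \<noteq> {}" using simplex_K(2)[OF assms(1)] assms(2) by auto
  then have c: "card (verts \<sigma>) > 0" using simplex_K(4)[OF assms(1)] by (simp add: card_gt_0_iff)
  have "barycenter \<sigma> = (\<Sum>v\<in>verts \<sigma>. (1 / real (card (verts \<sigma>))) *\<^sub>R v)"
    by (simp add: barycenter_def verts_def scaleR_sum_right)
  then have "barycenter \<sigma> \<in> rel_interior (convex hull (verts \<sigma>))"
    unfolding rel_interior_convex_hull_explicit[OF simplex_K(1)[OF assms(1)]]
    using c by (intro CollectI exI[of _ "\<lambda>_. 1 / real (card (verts \<sigma>))"]) auto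
  then show ?thesis using simplex_K(2)[OF assms(1)] by simp
qed

text \<open>The point lies in the hull of the barycenters of a flag of simplices above e. The part
  of this hull in \<sigma> is a face of it, hence itself the hull of some of the barycenters. So
  some \<rho> in the flag has its barycenter in \<sigma>, and e \<le> \<rho> \<le> \<sigma>.\<close>

lemma barycenter_in_dual_cell:
  assumes \<sigma>: "\<sigma> \<in> K" "\<sigma> \<noteq> {}" and e: "e \<in> K" "e \<noteq> {}" and x: "barycenter \<sigma> \<in> dual_cell K e Q"
  shows "e face_of \<sigma>"
proof -
  let ?x = "barycenter \<sigma>"
  obtain \<tau> C where \<tau>: "\<tau> \<in> K" and C: "C \<subseteq> {\<rho>\<in>K. e face_of \<rho> \<and> \<rho> face_of \<tau>}"
    and xC: "?x \<in> convex hull (barycenter ` C)"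
    using x unfolding dual_cell_def cube_def by auto
  have ne: "\<rho> \<noteq> {}" if "\<rho> \<in> C" for \<rho> using that C e(2) face_of_imp_subset by fastforce
  have bC: "barycenter \<rho> \<in> rel_interior \<rho>" if "\<rho> \<in> C" for \<rho>
    using that C ne by (intro barycenter_rel_interior) auto
  have sub: "barycenter ` C \<subseteq> \<tau>"
    using bC C rel_interior_subset face_of_imp_subset by fastforce
  then have hull: "convex hull (barycenter ` C) \<subseteq> \<tau>" using convex_K[OF \<tau>] by (simp add: hull_minimal)
  have x\<sigma>: "?x \<in> \<sigma>" using barycenter_rel_interior[OF \<sigma>] rel_interior_subset by blast
  have "\<tau> \<inter> \<sigma> \<inter> convex hull (barycenter ` C) face_of \<tau> \<inter> convex hull (barycenter ` C)"
    by (rule face_of_slice[OF Int_face_K[OF \<tau> \<sigma>(1)]]) simp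
  moreover have "\<tau> \<inter> convex hull (barycenter ` C) = convex hull (barycenter ` C)" using hull by auto
  ultimately have f: "\<tau> \<inter> \<sigma> \<inter> convex hull (barycenter ` C) face_of convex hull (barycenter ` C)" by simp
  have "finite C" using C finite_K by (auto intro: finite_subset)
  then obtain S' where S': "S' \<subseteq> barycenter ` C" "\<tau> \<inter> \<sigma> \<inter> convex hull (barycenter ` C) = convex hull S'"
    using face_of_convex_hull_subset[OF _ f] finite_imp_compact by blast
  have "?x \<in> convex hull S'" using S'(2) x\<sigma> xC hull by blast
  then have "S' \<noteq> {}" by auto
  then obtain \<rho> where \<rho>: "\<rho> \<in> C" "barycenter \<rho> \<in> S'" using S'(1) by blast
  then have "barycenter \<rho> \<in> \<sigma>" using S'(2) hull_subset[of S' convex] by blast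
  then have "\<rho> face_of \<sigma>" using rel_interior_subset_face[OF _ \<sigma>(1) bC] \<rho>(1) C by blast
  then show ?thesis using \<rho>(1) C face_of_trans by blast
qed

text \<open>The inclusion is tested at the barycenter of \<sigma>, which lies only in the dual cells
  of faces of \<sigma>. Gluing at this point changes u by a vector orthogonal to the smallest face
  of P through it; that face contains \<sigma>, so the sign conditions of the edges of \<sigma> are
  unaffected.\<close>

lemma copy_imp_active:
  assumes \<sigma>: "\<sigma> \<in> K" "\<sigma> \<noteq> {}" "\<sigma> \<subseteq> Q"
    and sub: "copy P u (dual_cell K \<sigma> Q) \<subseteq> T_hypersurface P K \<epsilon>"
  shows "active \<epsilon> \<sigma> u"
proof -
  let ?x = "barycenter \<sigma>"
  have ri: "?x \<in> rel_interior \<sigma>" by (rule barycenter_rel_interior[OF \<sigma>(1,2)])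
  then have x\<sigma>: "?x \<in> \<sigma>" using rel_interior_subset by blast
  then have xP: "?x \<in> P" using K_subset_P[OF \<sigma>(1)] by auto
  have "?x \<in> cube K \<sigma> \<sigma>"
    unfolding cube_def using \<sigma>(1) face_refl_K
    by (intro UnionI[of "convex hull (barycenter ` {\<sigma>})"] CollectI exI[of _ "{\<sigma>}"]) auto
  then have "?x \<in> dual_cell K \<sigma> Q"
    unfolding dual_cell_def using \<sigma> face_refl_K by auto
  then have "real_glue P `` {(u, ?x)} \<in> T_hypersurface P K \<epsilon>"
    using sub by (auto simp: copy_def)
  then obtain u' v0 v1 m x' where seg: "closed_segment v0 v1 \<in> K" "v0 \<noteq> v1" "v0 - v1 = lat m"
    "pair (mod2 m) u' + \<epsilon> v0 + \<epsilon> v1 = 1"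
    and x': "x' \<in> dual_cell K (closed_segment v0 v1) P"
    and eq: "real_glue P `` {(u, ?x)} = real_glue P `` {(u', x')}"
    unfolding T_hypersurface_def copy_def by blast
  have "0 \<in> sed A" for A :: "(real ^ 'n) set" by (rule vec.subspace_0[OF conormal2_subspace])
  then have "(u, ?x) \<in> real_glue P `` {(u, ?x)}" using xP by (simp add: real_glue_def)
  then have "(u, ?x) \<in> real_glue P `` {(u', x')}" using eq by simp
  then have xx: "x' = ?x" and us: "u' - u \<in> sed (min_face P {?x})" by (auto simp: real_glue_def)
  have "closed_segment v0 v1 face_of \<sigma>"
    by (rule barycenter_in_dual_cell[OF \<sigma>(1,2) seg(1)]) (use x' xx in auto)
  then have "verts (closed_segment v0 v1) \<subseteq> verts \<sigma>" by (rule face_verts)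
  then have v: "v0 \<in> verts \<sigma>" "v1 \<in> verts \<sigma>" by (auto simp: verts_def extreme_point_of_segment)
  then obtain z0 z1 where z: "v0 = lat z0" "v1 = lat z1" using verts_lattice[OF \<sigma>(1)] by blast
  then have "lat m = lat (z0 - z1)" using seg(3) by (simp add: lat_diff)
  then have m: "m = z0 - z1" by (simp only: lat_inject)
  have "\<sigma> \<subseteq> min_face P {?x}"
    unfolding min_face_def using subset_of_face_of[OF _ K_subset_P[OF \<sigma>(1)]] ri by blast
  then have "pair (mod2 m) (u' - u) = 0"
    unfolding m using v z verts_subset[of \<sigma>] by (intro conormal2_pair[OF us]) auto
  then have "pair (mod2 m) u' + pair (mod2 m) u = 0" by (simp add: pair_diff)
  then have "pair (mod2 m) u' = pair (mod2 m) u"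
    by (cases "pair (mod2 m) u"; cases "pair (mod2 m) u'") simp_all
  with seg(4) v z m show ?thesis by (auto simp: active_def)
qed

lemma active_imp_copy:
  assumes \<sigma>: "\<sigma> \<in> K" and a: "active \<epsilon> \<sigma> u"
  shows "copy P u (dual_cell K \<sigma> Q) \<subseteq> T_hypersurface P K \<epsilon>"
proof -
  obtain z z' where z: "lat z \<in> verts \<sigma>" "lat z' \<in> verts \<sigma>"
    "pair (mod2 (z - z')) u + \<epsilon> (lat z) + \<epsilon> (lat z') = 1"
    using a by (auto simp: active_def)
  have ne: "z \<noteq> z'" using z(3) by auto
  let ?e = "closed_segment (lat z) (lat z')"
  have e: "?e edge_of \<sigma>" "?e \<in> K" by (rule edge_exists[OF \<sigma> z(1,2) ne])+
  then have f: "?e face_of \<sigma>" by (simp add: edge_of_def)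
  have "cube K \<sigma> \<tau> \<subseteq> cube K ?e \<tau>" for \<tau>
    unfolding cube_def using face_of_trans[OF f] by (intro Union_mono) blast
  then have "dual_cell K \<sigma> Q \<subseteq> dual_cell K ?e P"
    unfolding dual_cell_def using face_of_trans[OF f] K_subset_P by blast
  then have "copy P u (dual_cell K \<sigma> Q) \<subseteq> copy P u (dual_cell K ?e P)"
    by (auto simp: copy_def)
  also have "\<dots> \<subseteq> T_hypersurface P K \<epsilon>"
    unfolding T_hypersurface_def using e(2) ne z(3) lat_diff[of z z', symmetric]
    by (intro Union_upper CollectI exI[of _ u] exI[of _ "lat z"] exI[of _ "lat z'"] exI[of _ "z - z'"]) auto
  finally show ?thesis .
qed

lemma sign_stalk:
  "stalk (sign_cosheaf P K \<epsilon> p) (\<sigma>, Q) = {a \<in> quot (sed Q) ` aug_filt p. Poly_Mapping.keys a \<subseteq>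
     {u +o sed Q | u. copy P u (dual_cell K \<sigma> Q) \<subseteq> T_hypersurface P K \<epsilon>}}"
  by (simp add: sign_cosheaf_def aug_power_eq[OF conormal2_subspace])

lemma quot_in_sign_stalk:
  assumes "\<sigma> \<in> K" "r \<in> aug_filt p" "\<And>w. w \<in> Poly_Mapping.keys r \<Longrightarrow> active \<epsilon> \<sigma> w"
  shows "quot (sed Q) r \<in> stalk (sign_cosheaf P K \<epsilon> p) (\<sigma>, Q)"
  unfolding sign_stalk using assms keys_quot[of "sed Q" r] active_imp_copy by blast

text \<open>\<open>bv\<close> maps the sign cosheaf into F_p. Translation by a vector
  \<open>u0\<close> with the differences of \<epsilon> keeps the leading term and turns the sign
  condition of an edge into pairing to one with it. Then an edge at \<open>z0\<close> pairs to one
  as well, and \<open>lead_part_support\<close> applies to the edges at \<open>z0\<close> and their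
  dual basis.\<close>

lemma lead_part_sign_stalk:
  assumes \<sigma>: "\<sigma> \<in> K" "1 \<le> aff_dim \<sigma>" "\<sigma> \<subseteq> Q"
    and a: "a \<in> stalk (sign_cosheaf P K \<epsilon> p) (\<sigma>, Q)"
  obtains r where "r \<in> aug_filt p" "quot (sed Q) r = a" "lead_part p r \<in> fspan p \<sigma>"
proof -
  have ne: "\<sigma> \<noteq> {}" using \<sigma>(2) by auto
  from a have a': "a \<in> quot (sed Q) ` aug_filt p" "Poly_Mapping.keys a \<subseteq>
     {u +o sed Q | u. copy P u (dual_cell K \<sigma> Q) \<subseteq> T_hypersurface P K \<epsilon>}"
    by (auto simp: sign_stalk)
  obtain r where r: "r \<in> aug_filt p" "quot (sed Q) r = a"
    "\<And>w. w \<in> Poly_Mapping.keys r \<Longrightarrow> w +o sed Q \<in> Poly_Mapping.keys a"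
    using lift_support[OF conormal2_subspace a'(1)] by blast
  have act: "active \<epsilon> \<sigma> w" if w: "w \<in> Poly_Mapping.keys r" for w
  proof -
    obtain u where u: "w +o sed Q = u +o sed Q" "copy P u (dual_cell K \<sigma> Q) \<subseteq> T_hypersurface P K \<epsilon>"
      using r(3)[OF w] a'(2) by blast
    have "u + w \<in> sed Q" using u(1) coset_eq_iff[OF conormal2_subspace, of u Q w] by simp
    then show ?thesis
      using active_shift[OF copy_imp_active[OF \<sigma>(1) ne \<sigma>(3) u(2)]] \<sigma>(3) by blast
  qed
  have "verts \<sigma> \<noteq> {}" using simplex_K(2)[OF \<sigma>(1)] ne by auto
  then obtain z0 where z0: "lat z0 \<in> verts \<sigma>" using verts_lattice[OF \<sigma>(1)] by blast
  obtain zs where zs: "distinct zs" "set zs = {z. lat z \<in> verts \<sigma> \<and> z \<noteq> z0}" "int (length zs) = aff_dim \<sigma>"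
    using vertex_list[OF \<sigma>(1) z0] by blast
  obtain ds where ds: "length ds = length zs"
    "\<And>i j. i < length zs \<Longrightarrow> j < length zs \<Longrightarrow> pair (zs ! i - z0) (ds ! j) = of_bool (i = j)"
    using dual_basis[OF \<sigma>(1) zs(1,2) z0] by blast
  define m where "m i = mod2 (zs ! i - z0)" for i
  define d where "d j = mod2 (ds ! j)" for j
  have dual: "pair (m i) (d j) = of_bool (i = j)" if "i < length zs" "j < length zs" for i j
    using ds(2)[OF that] by (simp add: m_def d_def pair_mod2)
  obtain u0 where u0: "\<And>z z'. lat z \<in> verts \<sigma> \<Longrightarrow> lat z' \<in> verts \<sigma> \<Longrightarrow>
    pair (mod2 (z - z')) u0 = \<epsilon> (lat z) + \<epsilon> (lat z')"
    using functional_mod2[OF \<sigma>(1), of \<epsilon>] by blast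
  have "lead_part p (xpow u0 * r) \<in> vec.span (\<Union>i<length zs. ext_power p {u. pair (m i) u = 0})"
  proof (rule lead_part_support[OF dual])
    show "xpow u0 * r \<in> aug_filt p" by (rule aug_filt_mult_left[OF r(1)])
    fix w assume "w \<in> Poly_Mapping.keys (xpow u0 * r)"
    then obtain u where u: "u \<in> Poly_Mapping.keys r" "w = u0 + u" unfolding keys_mult_xpow by blast
    obtain z z' where z: "lat z \<in> verts \<sigma>" "lat z' \<in> verts \<sigma>"
      "pair (mod2 (z - z')) u + \<epsilon> (lat z) + \<epsilon> (lat z') = 1"
      using act[OF u(1)] by (auto simp: active_def)
    have "pair (mod2 (z - z')) w = 1"
      using z(3) by (simp add: u(2) pair_add u0[OF z(1,2)] ac_simps)
    then have "pair (mod2 (z - z0)) w + pair (mod2 (z' - z0)) w = 1"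
      by (simp add: mod2_diff pair_add ac_simps)
    then have "pair (mod2 (z - z0)) w = 1 \<or> pair (mod2 (z' - z0)) w = 1"
      by (cases "pair (mod2 (z - z0)) w"; cases "pair (mod2 (z' - z0)) w") simp_all
    then obtain y where y: "lat y \<in> verts \<sigma>" "pair (mod2 (y - z0)) w = 1" using z by blast
    then have "y \<noteq> z0" by auto
    then have "y \<in> set zs" using zs(2) y(1) by simp
    then show "\<exists>i<length zs. pair (m i) w = 1" using y(2) by (auto simp: m_def in_set_conv_nth)
  qed
  moreover have "lead_part p (xpow u0 * r) = lead_part p r"
    using lead_part_mult[of "xpow u0" 0 r p] r(1) by simp
  moreover have "vec.span (\<Union>i<length zs. ext_power p {u. pair (m i) u = 0}) \<subseteq> fspan p \<sigma>"
    unfolding fspan_def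
  proof (rule vec.span_mono, rule UN_least)
    fix i assume "i \<in> {..<length zs}"
    then have "lat (zs ! i) \<in> verts \<sigma>" "z0 \<noteq> zs ! i" using zs(2) nth_mem[of i zs] by auto
    note e = edge_exists[OF \<sigma>(1) z0 this]
    show "ext_power p {u. pair (m i) u = 0} \<subseteq> (\<Union>e\<in>{e. e edge_of \<sigma>}. ext_power p (conormal2 e))"
      using e(1) conormal2_edge[OF \<sigma>(1) e(1) e(3)] by (auto simp: m_def)
  qed
  ultimately show ?thesis using that r(1,2) by auto
qed

text \<open>\<open>bv\<close> maps onto F_p. If \<open>u0\<close> satisfies the sign condition of an
  edge e, so do all points of its translate of \<open>conormal2 e\<close>, and x(u0) times a product
  of factors 1 + x(u_i) with u_i in \<open>conormal2 e\<close> is supported on this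
  translate.\<close>

lemma fspan_lift:
  assumes \<sigma>: "\<sigma> \<in> K" and x: "x \<in> fspan p \<sigma>"
  obtains r where "r \<in> aug_filt p" "lead_part p r = x" "\<And>w. w \<in> Poly_Mapping.keys r \<Longrightarrow> active \<epsilon> \<sigma> w"
proof -
  define R where "R x \<longleftrightarrow> (\<exists>r\<in>aug_filt p. lead_part p r = x \<and> (\<forall>w\<in>Poly_Mapping.keys r. active \<epsilon> \<sigma> w))" for x
  have R0: "R 0" unfolding R_def by (intro bexI[of _ 0]) auto
  have Radd: "R (x + y)" if xy: "R x" "R y" for x y
  proof -
    obtain r s where "r \<in> aug_filt p" "lead_part p r = x" "\<forall>w\<in>Poly_Mapping.keys r. active \<epsilon> \<sigma> w"
      "s \<in> aug_filt p" "lead_part p s = y" "\<forall>w\<in>Poly_Mapping.keys s. active \<epsilon> \<sigma> w"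
      using xy unfolding R_def by blast
    then show ?thesis
      unfolding R_def using keys_add[of r s] by (intro bexI[of _ "r + s"]) (auto intro: aug_filt_add)
  qed
  have base: "R (wedge_list us)" if e: "e edge_of \<sigma>" and us: "length us = p" "set us \<subseteq> conormal2 e" for e us
  proof -
    obtain z0 z1 where z: "lat z0 \<in> verts \<sigma>" "lat z1 \<in> verts \<sigma>" "z0 \<noteq> z1" "verts e = {lat z0, lat z1}"
      by (rule edge_cases[OF \<sigma> e])
    \<comment> \<open>The prescribed function is concentrated at \<open>z1\<close>, with the value
      for which \<open>u0\<close> satisfies the sign condition of the edge.\<close>
    obtain u0 where u0: "\<And>z z'. lat z \<in> verts \<sigma> \<Longrightarrow> lat z' \<in> verts \<sigma> \<Longrightarrow> pair (mod2 (z - z')) u0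
        = (if z = z1 then 1 + \<epsilon> (lat z0) + \<epsilon> (lat z1) else 0) + (if z' = z1 then 1 + \<epsilon> (lat z0) + \<epsilon> (lat z1) else 0)"
      using functional_mod2[OF \<sigma>, of "\<lambda>v. if v = lat z1 then 1 + \<epsilon> (lat z0) + \<epsilon> (lat z1) else 0"] by auto
    have "active \<epsilon> \<sigma> w" if w: "w \<in> Poly_Mapping.keys (xpow u0 * aug_prod us)" for w
    proof -
      obtain u where u: "u \<in> Poly_Mapping.keys (aug_prod us)" "w = u0 + u" using w unfolding keys_mult_xpow by blast
      have "u \<in> conormal2 e" using keys_aug_prod_subspace[OF conormal2_subspace us(2)] u(1) by blast
      then have "pair (mod2 (z1 - z0)) u = 0" using conormal2_edge[OF \<sigma> e z(4)] by simp
      then have "pair (mod2 (z1 - z0)) w = 1 + \<epsilon> (lat z0) + \<epsilon> (lat z1)"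
        using u0[OF z(2,1)] z(3) by (simp add: u(2) pair_add)
      then have "pair (mod2 (z1 - z0)) w + \<epsilon> (lat z1) + \<epsilon> (lat z0) = 1"
        by (cases "\<epsilon> (lat z0)"; cases "\<epsilon> (lat z1)") simp_all
      then show ?thesis using z by (auto simp: active_def)
    qed
    then show ?thesis
      unfolding R_def using xpow_aug_prod_aug_filt[of u0 us] lead_part_xpow_aug_prod[of us u0] us(1)
      by (intro bexI[of _ "xpow u0 * aug_prod us"]) auto
  qed
  have step: "R y" if "y \<in> ext_power p (conormal2 e)" "e edge_of \<sigma>" for y e
    using that(1) unfolding ext_power_def
    by (induction rule: bit_span_induct) (use base that(2) R0 Radd in auto)
  from x have "R x"
    unfolding fspan_def by (induction rule: bit_span_induct) (use step R0 Radd in auto)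
  then show ?thesis using that unfolding R_def by blast
qed

end

section \<open>Chains given by representatives\<close>

text \<open>For the cap-product: the wedge product of a coset with a fixed element is a coset of the
  image \<open>J i\<close> of an ideal, and this image may be smaller than the ideal
  \<open>I\<close> of the target. Adding \<open>I\<close> absorbs these images and covers the empty
  sum.\<close>

lemma coset_image_sum:
  assumes I: "vec.subspace (I :: (bit ^ 'a) set)" and J: "\<And>i. i \<in> A \<Longrightarrow> 0 \<in> J i \<and> J i \<subseteq> I"
  shows "I + (\<Sum>i\<in>A. x i +o J i) = (\<Sum>i\<in>A. x i) +o I"
  using J
proof (induction A rule: infinite_finite_induct)
  case (insert i A)
  have J: "0 \<in> J i" "J i \<subseteq> I" using insert.prems[of i] by auto
  have "J i + I = I"
  proof
    show "J i + I \<subseteq> I" using J(2) vec.subspace_add[OF I] by (auto elim!: set_plus_elim)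
    show "I \<subseteq> J i + I" using set_plus_mono3[OF J(1), of I] by simp
  qed
  then have "(x i +o J i) + I = x i +o I" by (simp add: set_plus_rearrange3)
  moreover have "I + ((x i +o J i) + (\<Sum>i\<in>A. x i +o J i)) = ((x i +o J i) + I) + (\<Sum>i\<in>A. x i +o J i)"
    by (simp only: ac_simps)
  moreover have "(x i +o I) + (\<Sum>i\<in>A. x i +o J i) = x i +o (I + (\<Sum>i\<in>A. x i +o J i))"
    by (rule set_plus_rearrange3)
  ultimately show ?case using insert by (simp add: set_plus_rearrange2)
qed simp_all

context smooth_triangulation
begin

abbreviation cell_sed :: "'n cell \<Rightarrow> (bit ^ 'n) set" where
  "cell_sed e \<equiv> sed (min_face P (snd e))"

abbreviation cell_ideal :: "'n cell \<Rightarrow> 'n ext set" where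
  "cell_ideal e \<equiv> ext_ideal (cell_sed e)"

definition coset_chain :: "int \<Rightarrow> ('n cell \<Rightarrow> 'n ext) \<Rightarrow> 'n cell \<Rightarrow> 'n ext set" where
  "coset_chain q c = (\<lambda>e\<in>fine_cells K q. c e +o cell_ideal e)"

definition quot_chain :: "int \<Rightarrow> ('n cell \<Rightarrow> 'n grp_alg) \<Rightarrow> 'n cell \<Rightarrow> 'n galg" where
  "quot_chain q r = (\<lambda>e\<in>fine_cells K q. quot (cell_sed e) (r e))"

text \<open>Boundary with constant coefficients. As the transition maps are induced by projections,
  it may be taken on representatives before passing to quotients, in the exterior algebra as well as
  in the group algebra.\<close>

definition bdry :: "int \<Rightarrow> ('n cell \<Rightarrow> 'v::comm_monoid_add) \<Rightarrow> 'n cell \<Rightarrow> 'v" where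
  "bdry q c e' = (\<Sum>e | e \<in> fine_cells K q \<and> fine_face e' e. c e)"

lemma finite_cofaces: "finite {e \<in> fine_cells K q. fine_face e' e}"
  using finite_fine_cells by simp

lemma cell_sed_mono: "fine_face e' e \<Longrightarrow> cell_sed e \<subseteq> cell_sed e'"
  by (rule conormal2_antimono) (auto simp: fine_face_def min_face_def dest: face_of_imp_subset)

lemma cell_ideal_mono: "fine_face e' e \<Longrightarrow> cell_ideal e \<subseteq> cell_ideal e'"
  by (rule ext_ideal_mono[OF cell_sed_mono])

lemma bdry_add: "bdry q (\<lambda>e. c e + d e) e' = bdry q c e' + bdry q d e'"
  by (simp add: bdry_def sum.distrib)

lemma bdry_cong: "(\<And>e. e \<in> fine_cells K q \<Longrightarrow> fine_face e' e \<Longrightarrow> c e = d e) \<Longrightarrow> bdry q c e' = bdry q d e'"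
  unfolding bdry_def by (rule sum.cong) auto

lemma sum_const_even:
  assumes "\<And>x :: 'v::comm_monoid_add. x + x = 0" "card A = 2"
  shows "(\<Sum>i\<in>A. x) = (0 :: 'v)"
proof -
  obtain a b where "A = {a, b}" "a \<noteq> b" using assms(2) by (auto simp: card_2_iff)
  then show ?thesis by (simp add: assms(1))
qed

lemma fine_face_trans: "fine_face e1 e2 \<Longrightarrow> fine_face e2 e3 \<Longrightarrow> fine_face e1 e3"
  unfolding fine_face_def by (meson face_of_trans)

text \<open>After exchanging the sums, the value at a cell e is counted once for each cell between
  \<open>e2\<close> and e; by \<open>diamond\<close> there are two of them.\<close>

lemma bdry_bdry:
  assumes ch: "\<And>x :: 'v::comm_monoid_add. x + x = 0" and e2: "e2 \<in> fine_cells K (q - 1)"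
  shows "bdry q (bdry (q + 1) c) e2 = (0 :: 'v)"
proof -
  let ?M = "{e' \<in> fine_cells K q. fine_face e2 e'}"
  let ?C = "{e \<in> fine_cells K (q + 1). fine_face e2 e}"
  have "bdry q (bdry (q + 1) c) e2 = (\<Sum>e'\<in>?M. \<Sum>e | e \<in> ?C \<and> fine_face e' e. c e)"
    unfolding bdry_def
    by (intro sum.cong refl) (auto intro: fine_face_trans)
  also have "\<dots> = (\<Sum>e\<in>?C. \<Sum>e' | e' \<in> ?M \<and> fine_face e' e. c e)"
    by (rule sum.swap_restrict) (use finite_cofaces in auto)
  also have "\<dots> = 0"
  proof (rule sum.neutral, rule ballI)
    fix e assume e: "e \<in> ?C"
    obtain \<sigma> \<tau> \<sigma>2 \<tau>2 where st: "e = (\<sigma>, \<tau>)" "e2 = (\<sigma>2, \<tau>2)" by (cases e, cases e2)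
    have "a face_of b" if "a face_of \<sigma>2" "\<tau>2 face_of b" for a b
      using that e face_of_trans unfolding st fine_face_def by (metis (no_types, lifting) fst_conv mem_Collect_eq snd_conv)
    then have "{e' \<in> fine_cells K q. fine_face e2 e' \<and> fine_face e' e}
        = {(s, t). s \<in> K \<and> t \<in> K \<and> \<sigma> face_of s \<and> s face_of \<sigma>2 \<and> \<tau>2 face_of t \<and> t face_of \<tau> \<and> aff_dim t - aff_dim s = q}"
      using e e2 by (auto simp: st fine_cells_def fine_face_def dest: aff_dim_face intro: face_of_trans)
    then have "card {e' \<in> fine_cells K q. fine_face e2 e' \<and> fine_face e' e} = 2"
      using diamond[of \<sigma> \<tau> \<sigma>2 \<tau>2 q] e e2 by (simp add: st fine_cells_def fine_face_def)
    then show "(\<Sum>e' | e' \<in> ?M \<and> fine_face e' e. c e) = 0"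
      by (intro sum_const_even[OF ch]) (simp add: conj_assoc)
  qed
  finally show ?thesis .
qed

lemma on_fine_trop:
  "stalk (on_fine P (trop p)) e = (\<lambda>x. x +o cell_ideal e) ` fspan p (fst e)"
  "zero_at (on_fine P (trop p)) e = cell_ideal e"
  "trans_map (on_fine P (trop p)) e' e y = y + cell_ideal e"
  by (simp_all add: on_fine_def trop_def coarse_of_def fspan_def)

lemma on_fine_sign:
  "stalk (on_fine P (sign_cosheaf P K \<epsilon> p)) e = stalk (sign_cosheaf P K \<epsilon> p) (fst e, min_face P (snd e))"
  "zero_at (on_fine P (sign_cosheaf P K \<epsilon> p)) e = 0"
  "trans_map (on_fine P (sign_cosheaf P K \<epsilon> p)) e' e = galg_proj (cell_sed e)"
  by (simp_all add: on_fine_def sign_cosheaf_def coarse_of_def)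

lemma coset_chain_cong:
  "(\<And>e. e \<in> fine_cells K q \<Longrightarrow> c e + d e \<in> cell_ideal e) \<Longrightarrow> coset_chain q c = coset_chain q d"
  unfolding coset_chain_def by (intro restrict_ext) (simp add: coset_eq_iff ext_ideal_subspace)

lemma coset_chain_eqD:
  assumes "coset_chain q c = coset_chain q d" "e \<in> fine_cells K q"
  shows "c e + d e \<in> cell_ideal e"
  using fun_cong[OF assms(1), of e] assms(2)
  by (simp add: coset_chain_def coset_eq_iff ext_ideal_subspace)

lemma chains_trop:
  "x \<in> chains K (on_fine P (trop p)) q \<longleftrightarrow>
     (\<exists>c. x = coset_chain q c \<and> (\<forall>e\<in>fine_cells K q. c e \<in> fspan p (fst e)))"
proof
  assume x: "x \<in> chains K (on_fine P (trop p)) q"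
  have "\<exists>y\<in>fspan p (fst e). x e = y +o cell_ideal e" if "e \<in> fine_cells K q" for e
  proof -
    have "x e \<in> stalk (on_fine P (trop p)) e" using x that by (auto simp: chains_def dest: PiE_mem)
    then show ?thesis unfolding on_fine_trop by blast
  qed
  then obtain c where c: "\<forall>e\<in>fine_cells K q. c e \<in> fspan p (fst e) \<and> x e = c e +o cell_ideal e" by metis
  moreover have "x = coset_chain q c"
    using x c by (intro extensionalityI[of _ "fine_cells K q"]) (auto simp: chains_def coset_chain_def PiE_def)
  ultimately show "\<exists>c. x = coset_chain q c \<and> (\<forall>e\<in>fine_cells K q. c e \<in> fspan p (fst e))" by blast
qed (auto simp: chains_def on_fine_trop coset_chain_def)

lemma boundary_trop:
  "boundary K (on_fine P (trop p)) q (coset_chain q c) = coset_chain (q - 1) (bdry q c)"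
  unfolding boundary_def coset_chain_def
proof (intro restrict_ext)
  fix e' assume "e' \<in> fine_cells K (q - 1)"
  have "(\<Sum>e | e \<in> fine_cells K q \<and> fine_face e' e.
        trans_map (on_fine P (trop p)) e e' ((\<lambda>e\<in>fine_cells K q. c e +o cell_ideal e) e))
      = (\<Sum>e | e \<in> fine_cells K q \<and> fine_face e' e. c e +o cell_ideal e')"
  proof (intro sum.cong refl)
    fix e assume "e \<in> {e \<in> fine_cells K q. fine_face e' e}"
    then show "trans_map (on_fine P (trop p)) e e' ((\<lambda>e\<in>fine_cells K q. c e +o cell_ideal e) e) = c e +o cell_ideal e'"
      using coset_add_subspace[OF ext_ideal_subspace ext_ideal_subspace cell_ideal_mono[of e' e]]
      by (simp add: on_fine_trop)
  qed
  then show "zero_at (on_fine P (trop p)) e' + (\<Sum>e | e \<in> fine_cells K q \<and> fine_face e' e.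
        trans_map (on_fine P (trop p)) e e' ((\<lambda>e\<in>fine_cells K q. c e +o cell_ideal e) e)) = bdry q c e' +o cell_ideal e'"
    by (simp add: on_fine_trop bdry_def coset_sum ext_ideal_subspace)
qed

lemma mem_trop_class:
  "x \<in> trop_class P K p q (coset_chain q c) \<longleftrightarrow>
     (\<exists>b. x = coset_chain q (\<lambda>e. c e + bdry (q + 1) b e) \<and> (\<forall>e\<in>fine_cells K (q + 1). b e \<in> fspan p (fst e)))"
proof -
  have *: "(\<lambda>e\<in>fine_cells K q. coset_chain q c e + boundary K (on_fine P (trop p)) (q + 1) (coset_chain (q + 1) b) e)
      = coset_chain q (\<lambda>e. c e + bdry (q + 1) b e)" for b
    unfolding boundary_trop unfolding coset_chain_def
    by (intro restrict_ext) (simp add: coset_add ext_ideal_subspace)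
  show ?thesis
    unfolding hom_class_def
  proof safe
    fix b assume "b \<in> chains K (on_fine P (trop p)) (q + 1)"
    then obtain b' where "b = coset_chain (q + 1) b'" "\<forall>e\<in>fine_cells K (q + 1). b' e \<in> fspan p (fst e)"
      by (auto simp: chains_trop)
    then show "\<exists>b'. (\<lambda>e\<in>fine_cells K q. coset_chain q c e + boundary K (on_fine P (trop p)) (q + 1) b e)
          = coset_chain q (\<lambda>e. c e + bdry (q + 1) b' e) \<and> (\<forall>e\<in>fine_cells K (q + 1). b' e \<in> fspan p (fst e))"
      using * by blast
  next
    fix b assume "\<forall>e\<in>fine_cells K (q + 1). b e \<in> fspan p (fst e)"
    then show "\<exists>b'. coset_chain q (\<lambda>e. c e + bdry (q + 1) b e)
        = (\<lambda>e\<in>fine_cells K q. coset_chain q c e + boundary K (on_fine P (trop p)) (q + 1) b' e)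
        \<and> b' \<in> chains K (on_fine P (trop p)) (q + 1)"
      by (intro exI[of _ "coset_chain (q + 1) b"]) (auto simp: * chains_trop)
  qed
qed

lemma trop_class_eqI:
  assumes b: "\<And>e. e \<in> fine_cells K (q + 1) \<Longrightarrow> b e \<in> fspan p (fst e)"
    and c: "\<And>e. e \<in> fine_cells K q \<Longrightarrow> c e + d e + bdry (q + 1) b e \<in> cell_ideal e"
  shows "trop_class P K p q (coset_chain q c) = trop_class P K p q (coset_chain q d)"
proof -
  have *: "trop_class P K p q (coset_chain q c) \<subseteq> trop_class P K p q (coset_chain q d)"
    if c: "\<And>e. e \<in> fine_cells K q \<Longrightarrow> c e + d e + bdry (q + 1) b e \<in> cell_ideal e" for c d
  proof
    fix x assume "x \<in> trop_class P K p q (coset_chain q c)"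
    then obtain a where a: "x = coset_chain q (\<lambda>e. c e + bdry (q + 1) a e)"
      "\<forall>e\<in>fine_cells K (q + 1). a e \<in> fspan p (fst e)" by (auto simp: mem_trop_class)
    have "x = coset_chain q (\<lambda>e. d e + bdry (q + 1) (\<lambda>e. a e + b e) e)"
      unfolding a(1)
    proof (rule coset_chain_cong)
      fix e assume "e \<in> fine_cells K q"
      have eq: "c e + bdry (q + 1) a e + (d e + bdry (q + 1) (\<lambda>e. a e + b e) e) = c e + d e + bdry (q + 1) b e"
        by (simp add: bdry_add ac_simps)
      show "c e + bdry (q + 1) a e + (d e + bdry (q + 1) (\<lambda>e. a e + b e) e) \<in> cell_ideal e"
        unfolding eq by (rule c[OF \<open>e \<in> fine_cells K q\<close>])
    qed
    moreover have "\<forall>e\<in>fine_cells K (q + 1). a e + b e \<in> fspan p (fst e)"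
      using a(2) b fspan_add by blast
    ultimately show "x \<in> trop_class P K p q (coset_chain q d)" unfolding mem_trop_class by blast
  qed
  show ?thesis
  proof
    show "trop_class P K p q (coset_chain q c) \<subseteq> trop_class P K p q (coset_chain q d)"
      by (rule *[OF c])
    show "trop_class P K p q (coset_chain q d) \<subseteq> trop_class P K p q (coset_chain q c)"
      by (rule *) (use c in \<open>simp add: add.commute\<close>)
  qed
qed

lemma boundary_sign:
  "boundary K (on_fine P (sign_cosheaf P K \<epsilon> p)) q (quot_chain q r) = quot_chain (q - 1) (bdry q r)"
  unfolding boundary_def quot_chain_def
proof (intro restrict_ext)
  fix e'
  have "(\<Sum>e | e \<in> fine_cells K q \<and> fine_face e' e.
        trans_map (on_fine P (sign_cosheaf P K \<epsilon> p)) e e' ((\<lambda>e\<in>fine_cells K q. quot (cell_sed e) (r e)) e))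
      = (\<Sum>e | e \<in> fine_cells K q \<and> fine_face e' e. quot (cell_sed e') (r e))"
  proof (intro sum.cong refl)
    fix e assume "e \<in> {e \<in> fine_cells K q. fine_face e' e}"
    then show "trans_map (on_fine P (sign_cosheaf P K \<epsilon> p)) e e' ((\<lambda>e\<in>fine_cells K q. quot (cell_sed e) (r e)) e)
        = quot (cell_sed e') (r e)"
      using galg_proj_quot[OF conormal2_subspace conormal2_subspace cell_sed_mono[of e' e]]
      by (simp add: on_fine_sign)
  qed
  then show "zero_at (on_fine P (sign_cosheaf P K \<epsilon> p)) e' + (\<Sum>e | e \<in> fine_cells K q \<and> fine_face e' e.
        trans_map (on_fine P (sign_cosheaf P K \<epsilon> p)) e e' ((\<lambda>e\<in>fine_cells K q. quot (cell_sed e) (r e)) e))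
      = quot (cell_sed e') (bdry q r e')"
    by (simp add: on_fine_sign bdry_def quot_sum)
qed

lemma bv_chain_quot:
  assumes "\<And>e. e \<in> fine_cells K q \<Longrightarrow> r e \<in> aug_filt p"
  shows "bv_chain P K p q (quot_chain q r) = coset_chain q (\<lambda>e. lead_part p (r e))"
  unfolding bv_chain_def coset_chain_def quot_chain_def
  by (intro restrict_ext) (auto simp: assms bv_quot conormal2_subspace)

lemma bv_chain_quot':
  assumes "\<And>e. e \<in> fine_cells K q \<Longrightarrow> r e \<in> aug_filt p \<and> quot (cell_sed e) (r e) = quot (cell_sed e) (s e)"
  shows "bv_chain P K p q (quot_chain q s) = coset_chain q (\<lambda>e. lead_part p (r e))"
proof -
  have "quot_chain q s = quot_chain q r" unfolding quot_chain_def using assms by (intro restrict_ext) simp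
  then show ?thesis using bv_chain_quot assms by simp
qed

section \<open>Lifts of chains and the operator \<open>partial_eps\<close>\<close>

definition sign_rep :: "(real ^ 'n \<Rightarrow> bit) \<Rightarrow> nat \<Rightarrow> int \<Rightarrow> ('n cell \<Rightarrow> 'n grp_alg) \<Rightarrow> bool" where
  "sign_rep \<epsilon> p q r \<longleftrightarrow> (\<forall>e\<in>fine_cells K q. r e \<in> aug_filt p \<and>
     quot (cell_sed e) (r e) \<in> stalk (sign_cosheaf P K \<epsilon> p) (fst e, min_face P (snd e)))"

lemma fine_cells_facts:
  assumes "e \<in> fine_cells K q"
  shows "fst e \<in> K" "1 \<le> aff_dim (fst e)" "fst e \<subseteq> min_face P (snd e)" "snd e \<in> K" "fst e face_of snd e"
    "aff_dim (snd e) - aff_dim (fst e) = q"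
proof -
  show "fst e \<in> K" "1 \<le> aff_dim (fst e)" "snd e \<in> K" "fst e face_of snd e"
    "aff_dim (snd e) - aff_dim (fst e) = q"
    using assms by (auto simp: fine_cells_def)
  then show "fst e \<subseteq> min_face P (snd e)"
    using face_of_imp_subset by (fastforce simp: min_face_def)
qed

lemma chains_sign:
  "x \<in> chains K (on_fine P (sign_cosheaf P K \<epsilon> p)) q \<longleftrightarrow> (\<exists>r. x = quot_chain q r \<and> sign_rep \<epsilon> p q r)"
proof
  assume x: "x \<in> chains K (on_fine P (sign_cosheaf P K \<epsilon> p)) q"
  then have st: "x e \<in> stalk (sign_cosheaf P K \<epsilon> p) (fst e, min_face P (snd e))" if "e \<in> fine_cells K q" for e
    using that by (auto simp: chains_def on_fine_sign dest!: PiE_mem)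
  then have "\<forall>e\<in>fine_cells K q. \<exists>r\<in>aug_filt p. x e = quot (cell_sed e) r"
    by (force simp: sign_stalk)
  then obtain r where r: "\<forall>e\<in>fine_cells K q. r e \<in> aug_filt p \<and> x e = quot (cell_sed e) (r e)" by metis
  moreover have "x = quot_chain q r"
    using x r by (intro extensionalityI[of _ "fine_cells K q"]) (auto simp: chains_def quot_chain_def PiE_def)
  ultimately show "\<exists>r. x = quot_chain q r \<and> sign_rep \<epsilon> p q r"
    using st unfolding sign_rep_def by metis
qed (auto simp: chains_def on_fine_sign quot_chain_def sign_rep_def)

lemma sign_stalk_add:
  assumes "a \<in> stalk (sign_cosheaf P K \<epsilon> p) c" "b \<in> stalk (sign_cosheaf P K \<epsilon> p) c"
  shows "a + b \<in> stalk (sign_cosheaf P K \<epsilon> p) c"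
proof -
  obtain \<sigma> Q where c: "c = (\<sigma>, Q)" by (cases c)
  from assms obtain r s where rs: "r \<in> aug_filt p" "a = quot (sed Q) r" "s \<in> aug_filt p" "b = quot (sed Q) s"
    by (auto simp: c sign_stalk)
  then have "a + b = quot (sed Q) (r + s)" "r + s \<in> aug_filt p" by (auto intro: aug_filt_add)
  then have "a + b \<in> quot (sed Q) ` aug_filt p" by blast
  then show ?thesis using assms keys_add[of a b] by (auto simp: c sign_stalk)
qed

lemma zero_in_sign_stalk: "0 \<in> stalk (sign_cosheaf P K \<epsilon> p) (\<sigma>, Q)"
proof -
  have "0 = quot (sed Q) 0" by simp
  then have "0 \<in> quot (sed Q) ` aug_filt p" using zero_in_aug_filt by blast
  then show ?thesis by (simp add: sign_stalk)
qed

text \<open>Along a transition map the dual cell shrinks and Sed grows, so the support condition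
  persists.\<close>

lemma sign_stalk_proj:
  assumes a: "quot (sed Q) r \<in> stalk (sign_cosheaf P K \<epsilon> p) (\<sigma>, Q)" "r \<in> aug_filt p"
    and f: "\<sigma> face_of \<sigma>'" "Q' \<subseteq> Q"
  shows "quot (sed Q') r \<in> stalk (sign_cosheaf P K \<epsilon> p) (\<sigma>', Q')"
proof -
  have S: "sed Q \<subseteq> sed Q'" by (rule conormal2_antimono[OF f(2)])
  have "cube K \<sigma>' \<tau> \<subseteq> cube K \<sigma> \<tau>" for \<tau>
    unfolding cube_def using face_of_trans[OF f(1)] by (intro Union_mono) blast
  then have "dual_cell K \<sigma>' Q' \<subseteq> dual_cell K \<sigma> Q"
    unfolding dual_cell_def using face_of_trans[OF f(1)] f(2) by blast
  then have cp: "copy P u (dual_cell K \<sigma>' Q') \<subseteq> copy P u (dual_cell K \<sigma> Q)" for u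
    by (auto simp: copy_def)
  have "quot (sed Q') r = galg_proj (sed Q') (quot (sed Q) r)"
    by (simp add: galg_proj_quot conormal2_subspace S)
  also have "Poly_Mapping.keys \<dots> \<subseteq> (\<lambda>U. U + sed Q') ` Poly_Mapping.keys (quot (sed Q) r)"
    unfolding galg_proj_bit_lin bit_lin_keys
    using keys_sum_subset[of "\<lambda>U. gen (U + sed Q')" "Poly_Mapping.keys (quot (sed Q) r)"]
    by (auto simp: gen_def)
  finally have "Poly_Mapping.keys (quot (sed Q') r) \<subseteq> (\<lambda>U. U + sed Q') ` Poly_Mapping.keys (quot (sed Q) r)" .
  moreover have "(u +o sed Q) + sed Q' = u +o sed Q'" for u
    by (rule coset_add_subspace[OF conormal2_subspace conormal2_subspace S])
  moreover have "\<exists>u. U = u +o sed Q \<and> copy P u (dual_cell K \<sigma>' Q') \<subseteq> T_hypersurface P K \<epsilon>"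
    if "U \<in> Poly_Mapping.keys (quot (sed Q) r)" for U
    using a(1) that subset_trans[OF cp] unfolding sign_stalk by blast
  ultimately have "\<exists>u. W = u +o sed Q' \<and> copy P u (dual_cell K \<sigma>' Q') \<subseteq> T_hypersurface P K \<epsilon>"
    if "W \<in> Poly_Mapping.keys (quot (sed Q') r)" for W
    using that by blast
  then show ?thesis using a(2) unfolding sign_stalk by blast
qed

lemma sign_rep_add: "sign_rep \<epsilon> p q r \<Longrightarrow> sign_rep \<epsilon> p q s \<Longrightarrow> sign_rep \<epsilon> p q (\<lambda>e. r e + s e)"
  unfolding sign_rep_def by (simp add: aug_filt_add sign_stalk_add)

lemma sign_rep_bdry:
  assumes r: "sign_rep \<epsilon> p q r"
  shows "sign_rep \<epsilon> p (q - 1) (bdry q r)"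
  unfolding sign_rep_def
proof (intro ballI conjI)
  fix e' assume "e' \<in> fine_cells K (q - 1)"
  show "bdry q r e' \<in> aug_filt p"
    using r unfolding bdry_def sign_rep_def by (intro aug_filt_sum) auto
  have *: "quot (cell_sed e') (r e) \<in> stalk (sign_cosheaf P K \<epsilon> p) (fst e', min_face P (snd e'))"
    if "e \<in> fine_cells K q" "fine_face e' e" for e
  proof (rule sign_stalk_proj)
    show "min_face P (snd e') \<subseteq> min_face P (snd e)"
      using that(2) face_of_imp_subset unfolding fine_face_def min_face_def by blast
  qed (use that r in \<open>auto simp: sign_rep_def fine_face_def\<close>)
  have "(\<Sum>e\<in>A. quot (cell_sed e') (r e)) \<in> stalk (sign_cosheaf P K \<epsilon> p) (fst e', min_face P (snd e'))"
    if "A \<subseteq> {e. e \<in> fine_cells K q \<and> fine_face e' e}" for A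
    using that by (induction A rule: infinite_finite_induct) (auto simp: zero_in_sign_stalk * intro!: sign_stalk_add)
  then show "quot (cell_sed e') (bdry q r e') \<in> stalk (sign_cosheaf P K \<epsilon> p) (fst e', min_face P (snd e'))"
    unfolding bdry_def quot_sum by blast
qed

text \<open>A given lift has its leading term in F_p only modulo the ideal; the lift is replaced by
  one whose leading term lies in \<open>fspan\<close> itself.\<close>

lemma sign_rep_normalize:
  assumes "\<And>e. e \<in> fine_cells K q \<Longrightarrow>
    quot (cell_sed e) (s e) \<in> stalk (sign_cosheaf P K \<epsilon> p) (fst e, min_face P (snd e))"
  obtains r where "\<And>e. e \<in> fine_cells K q \<Longrightarrow> r e \<in> aug_filt p"
    "\<And>e. e \<in> fine_cells K q \<Longrightarrow> quot (cell_sed e) (r e) = quot (cell_sed e) (s e)"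
    "\<And>e. e \<in> fine_cells K q \<Longrightarrow> lead_part p (r e) \<in> fspan p (fst e)"
proof -
  have "\<exists>r. r \<in> aug_filt p \<and> quot (cell_sed e) r = quot (cell_sed e) (s e) \<and> lead_part p r \<in> fspan p (fst e)"
    if e: "e \<in> fine_cells K q" for e
    using lead_part_sign_stalk[OF fine_cells_facts(1-3)[OF e] assms[OF e]] by blast
  then obtain r where "\<And>e. e \<in> fine_cells K q \<Longrightarrow>
    r e \<in> aug_filt p \<and> quot (cell_sed e) (r e) = quot (cell_sed e) (s e) \<and> lead_part p (r e) \<in> fspan p (fst e)" by metis
  then show ?thesis using that by blast
qed

lemma sign_stalk_Suc:
  assumes "quot (sed Q) r \<in> stalk (sign_cosheaf P K \<epsilon> p) (\<sigma>, Q)" "r \<in> aug_filt p" "lead_part p r \<in> ext_ideal (sed Q)"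
  shows "quot (sed Q) r \<in> stalk (sign_cosheaf P K \<epsilon> (Suc p)) (\<sigma>, Q)"
  using assms aug_filt_Suc_of_lead_part_ideal[OF conormal2_subspace assms(2,3)] by (simp add: sign_stalk)

lemma lead_part_bdry: "lead_part p (bdry q r e) = bdry q (\<lambda>e. lead_part p (r e)) e"
  by (simp add: bdry_def lead_part_sum)

text \<open>Let s be another lift of the class. Its leading terms differ from those of r by the
  boundary of some d, modulo the ideals. If t lifts d, then s + r + \<partial>t has leading terms in
  the ideals, so it defines a chain x of the next step of the filtration. In the quotients
  \<partial>s and \<partial>r differ by \<partial>x, whose leading term is a tropical
  boundary.\<close>

lemma partial_eps_class:
  assumes r: "sign_rep \<epsilon> p q r" "\<And>e. e \<in> fine_cells K (q - 1) \<Longrightarrow> bdry q r e \<in> aug_filt (Suc p)"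
  shows "partial_eps P K \<epsilon> p q (trop_class P K p q (coset_chain q (\<lambda>e. lead_part p (r e))))
    = trop_class P K (p + 1) (q - 1) (coset_chain (q - 1) (\<lambda>e. lead_part (Suc p) (bdry q r e)))"
proof -
  let ?H = "trop_class P K p q (coset_chain q (\<lambda>e. lead_part p (r e)))"
  let ?A = "{c \<in> chains K (on_fine P (sign_cosheaf P K \<epsilon> p)) q. bv_chain P K p q c \<in> ?H}"
  let ?B = "\<lambda>c. trop_class P K (p + 1) (q - 1)
          (bv_chain P K (p + 1) (q - 1) (boundary K (on_fine P (sign_cosheaf P K \<epsilon> p)) q c))"
  let ?R = "trop_class P K (p + 1) (q - 1) (coset_chain (q - 1) (\<lambda>e. lead_part (Suc p) (bdry q r e)))"
  have rf: "r e \<in> aug_filt p" if "e \<in> fine_cells K q" for e using r(1) that by (simp add: sign_rep_def)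
  have "quot_chain q r \<in> ?A"
  proof -
    have "bv_chain P K p q (quot_chain q r) = coset_chain q (\<lambda>e. lead_part p (r e) + bdry (q + 1) (\<lambda>_. 0) e)"
      by (simp add: bv_chain_quot rf bdry_def)
    then have "bv_chain P K p q (quot_chain q r) \<in> ?H"
      unfolding mem_trop_class by (intro exI[of _ "\<lambda>_. 0"]) simp
    then show ?thesis using r(1) by (auto simp: chains_sign)
  qed
  moreover have "?B c = ?R" if c: "c \<in> ?A" for c
  proof -
    obtain s where s: "c = quot_chain q s" "sign_rep \<epsilon> p q s" using c by (auto simp: chains_sign)
    then have sf: "s e \<in> aug_filt p" if "e \<in> fine_cells K q" for e using that by (simp add: sign_rep_def)
    have "coset_chain q (\<lambda>e. lead_part p (s e)) \<in> ?H" using c by (simp add: s(1) bv_chain_quot sf)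
    then obtain d where d: "coset_chain q (\<lambda>e. lead_part p (s e)) = coset_chain q (\<lambda>e. lead_part p (r e) + bdry (q + 1) d e)"
      "\<forall>e\<in>fine_cells K (q + 1). d e \<in> fspan p (fst e)" by (auto simp: mem_trop_class)
    have "\<exists>t. t \<in> aug_filt p \<and> lead_part p t = d e \<and> quot (cell_sed e) t \<in> stalk (sign_cosheaf P K \<epsilon> p) (fst e, min_face P (snd e))"
      if e: "e \<in> fine_cells K (q + 1)" for e
    proof -
      obtain t where "t \<in> aug_filt p" "lead_part p t = d e" "\<And>w. w \<in> Poly_Mapping.keys t \<Longrightarrow> active \<epsilon> (fst e) w"
        using fspan_lift[OF fine_cells_facts(1)[OF e] d(2)[rule_format, OF e]] by blast
      then show ?thesis using quot_in_sign_stalk[OF fine_cells_facts(1)[OF e]] by blast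
    qed
    then obtain t where t: "\<And>e. e \<in> fine_cells K (q + 1) \<Longrightarrow> t e \<in> aug_filt p \<and> lead_part p (t e) = d e \<and>
      quot (cell_sed e) (t e) \<in> stalk (sign_cosheaf P K \<epsilon> p) (fst e, min_face P (snd e))" by metis
    have trep: "sign_rep \<epsilon> p (q + 1) t" using t by (simp add: sign_rep_def)
    define y where "y e = s e + r e + bdry (q + 1) t e" for e
    have yrep: "sign_rep \<epsilon> p q y"
      unfolding y_def using sign_rep_bdry[OF trep] s(2) r(1) by (intro sign_rep_add) simp_all
    have "quot (cell_sed e) (y e) \<in> stalk (sign_cosheaf P K \<epsilon> (Suc p)) (fst e, min_face P (snd e))"
      if e: "e \<in> fine_cells K q" for e
    proof (rule sign_stalk_Suc)
      have "bdry (q + 1) (\<lambda>e. lead_part p (t e)) e = bdry (q + 1) d e" by (rule bdry_cong) (simp add: t)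
      then have "lead_part p (y e) = lead_part p (s e) + (lead_part p (r e) + bdry (q + 1) d e)"
        by (simp add: y_def lead_part_bdry add.assoc)
      then show "lead_part p (y e) \<in> cell_ideal e" using coset_chain_eqD[OF d(1) e] by simp
    qed (use yrep e in \<open>auto simp: sign_rep_def\<close>)
    \<comment> \<open>\<open>y\<close> reaches the next step of the filtration only in the
      quotients; \<open>x\<close> has the same images there and lies in that step itself.\<close>
    then obtain x where x: "\<And>e. e \<in> fine_cells K q \<Longrightarrow> x e \<in> aug_filt (Suc p)"
      "\<And>e. e \<in> fine_cells K q \<Longrightarrow> quot (cell_sed e) (x e) = quot (cell_sed e) (y e)"
      "\<And>e. e \<in> fine_cells K q \<Longrightarrow> lead_part (Suc p) (x e) \<in> fspan (Suc p) (fst e)"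
      using sign_rep_normalize[of q y \<epsilon> "Suc p"] by blast
    have bdx: "bdry q x e \<in> aug_filt (Suc p)" for e
      unfolding bdry_def using x(1) by (intro aug_filt_sum) auto
    have "bdry q r e + bdry q x e \<in> aug_filt (Suc p) \<and> quot (cell_sed e) (bdry q r e + bdry q x e) = quot (cell_sed e) (bdry q s e)"
      if e: "e \<in> fine_cells K (q - 1)" for e
    proof
      show "bdry q r e + bdry q x e \<in> aug_filt (Suc p)" using r(2)[OF e] bdx by (rule aug_filt_add)
      have "quot (cell_sed e) (x e') = quot (cell_sed e) (y e')" if "e' \<in> fine_cells K q" "fine_face e e'" for e'
        using x(2)[OF that(1)] galg_proj_quot[OF conormal2_subspace conormal2_subspace cell_sed_mono[OF that(2)]] by metis
      then have "quot (cell_sed e) (bdry q x e) = quot (cell_sed e) (bdry q y e)"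
        unfolding bdry_def quot_sum by (intro sum.cong) auto
      moreover have "bdry q y e = bdry q s e + bdry q r e + bdry q (bdry (q + 1) t) e"
        unfolding y_def[abs_def] bdry_add by simp
      moreover have "bdry q (bdry (q + 1) t) e = 0" by (rule bdry_bdry[OF _ e]) simp
      ultimately show "quot (cell_sed e) (bdry q r e + bdry q x e) = quot (cell_sed e) (bdry q s e)"
        by (simp add: add.commute[of "quot _ (bdry q s e)"])
    qed
    then have bvc: "bv_chain P K (p + 1) (q - 1) (boundary K (on_fine P (sign_cosheaf P K \<epsilon> p)) q c)
        = coset_chain (q - 1) (\<lambda>e. lead_part (Suc p) (bdry q r e + bdry q x e))"
      unfolding s(1) boundary_sign by (subst bv_chain_quot'[of _ "\<lambda>e. bdry q r e + bdry q x e" "p + 1"]) auto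
    have "trop_class P K (p + 1) (q - 1) (coset_chain (q - 1) (\<lambda>e. lead_part (Suc p) (bdry q r e + bdry q x e))) = ?R"
    proof (rule trop_class_eqI)
      show "lead_part (Suc p) (x e) \<in> fspan (p + 1) (fst e)" if "e \<in> fine_cells K (q - 1 + 1)" for e
        using x(3)[of e] that by simp
      show "lead_part (Suc p) (bdry q r e + bdry q x e) + lead_part (Suc p) (bdry q r e)
          + bdry (q - 1 + 1) (\<lambda>e. lead_part (Suc p) (x e)) e \<in> cell_ideal e" for e
        by (simp add: lead_part_bdry add.commute[of "bdry q (\<lambda>e. lead_part (Suc p) (r e)) e"] add.assoc)
    qed
    then show ?thesis by (simp only: bvc)
  qed
  ultimately show ?thesis unfolding partial_eps_def by blast
qed

text \<open>The boundary of r is a chain of the next step of the sign cosheaf, so its leading terms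
  lie in the next tropical cosheaf modulo the ideals. Their boundary is the leading term of
  \<partial>\<partial>r = 0.\<close>

lemma partial_eps_homology:
  assumes r: "sign_rep \<epsilon> p q r" "\<And>e. e \<in> fine_cells K (q - 1) \<Longrightarrow> bdry q r e \<in> aug_filt (Suc p)"
  shows "trop_class P K (p + 1) (q - 1) (coset_chain (q - 1) (\<lambda>e. lead_part (Suc p) (bdry q r e)))
    \<in> trop_homology P K (p + 1) (q - 1)"
proof -
  let ?g = "\<lambda>e. lead_part (Suc p) (bdry q r e)"
  have bdrep: "sign_rep \<epsilon> p (q - 1) (bdry q r)" by (rule sign_rep_bdry[OF r(1)])
  have "quot (cell_sed e) (bdry q r e) \<in> stalk (sign_cosheaf P K \<epsilon> (Suc p)) (fst e, min_face P (snd e))"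
    if e: "e \<in> fine_cells K (q - 1)" for e
    using bdrep e r(2)[OF e] by (intro sign_stalk_Suc) (auto simp: sign_rep_def aug_filt_Suc_iff)
  then obtain x where x: "\<And>e. e \<in> fine_cells K (q - 1) \<Longrightarrow> x e \<in> aug_filt (Suc p)"
    "\<And>e. e \<in> fine_cells K (q - 1) \<Longrightarrow> quot (cell_sed e) (x e) = quot (cell_sed e) (bdry q r e)"
    "\<And>e. e \<in> fine_cells K (q - 1) \<Longrightarrow> lead_part (Suc p) (x e) \<in> fspan (Suc p) (fst e)"
    using sign_rep_normalize[of "q - 1" "bdry q r" \<epsilon> "Suc p"] by blast
  have "coset_chain (q - 1) ?g = coset_chain (q - 1) (\<lambda>e. lead_part (Suc p) (x e))"
    by (rule coset_chain_cong) (use lead_part_well_defined[OF conormal2_subspace] x r(2) in metis)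
  then have "coset_chain (q - 1) ?g \<in> chains K (on_fine P (trop (p + 1))) (q - 1)"
    using x(3) by (auto simp: chains_trop)
  moreover have "boundary K (on_fine P (trop (p + 1))) (q - 1) (coset_chain (q - 1) ?g)
      = restrict (zero_at (on_fine P (trop (p + 1)))) (fine_cells K (q - 1 - 1))"
    unfolding boundary_trop unfolding coset_chain_def
  proof (intro restrict_ext)
    fix e assume e: "e \<in> fine_cells K (q - 1 - 1)"
    have "bdry (q - 1) ?g e = lead_part (Suc p) (bdry (q - 1) (bdry (q - 1 + 1) r) e)"
      by (simp add: lead_part_bdry)
    also have "\<dots> = 0" by (subst bdry_bdry[OF _ e]) simp_all
    finally show "bdry (q - 1) ?g e +o cell_ideal e = zero_at (on_fine P (trop (p + 1))) e"
      by (simp add: on_fine_trop)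
  qed
  ultimately have "coset_chain (q - 1) ?g \<in> cycles K (on_fine P (trop (p + 1))) (q - 1)"
    by (simp add: cycles_def)
  then show ?thesis by (simp add: homology_def)
qed

end

section \<open>Face cycles and the cap-product with the Hessian wave\<close>

lemma ext_power_1:
  assumes "vec.subspace V"
  shows "ext_power (Suc 0) V = ext_vec ` V"
proof
  have "vec.subspace (ext_vec ` V)"
  proof (rule bit_vec_subspaceI)
    show "0 \<in> ext_vec ` V" using vec.subspace_0[OF assms] by (intro image_eqI[of _ _ 0]) auto
    show "x + y \<in> ext_vec ` V" if "x \<in> ext_vec ` V" "y \<in> ext_vec ` V" for x y
      using that vec.subspace_add[OF assms] by (auto simp flip: ext_vec_add)
  qed
  then show "ext_power (Suc 0) V \<subseteq> ext_vec ` V"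
    unfolding ext_power_def by (intro vec.span_minimal) (auto simp: length_Suc_conv)
  show "ext_vec ` V \<subseteq> ext_power (Suc 0) V"
    using ext_power_base[of "[_]" "Suc 0" V] by auto
qed

lemma fspan_wedge:
  assumes "x \<in> fspan p \<sigma>" "s \<in> conormal2 \<sigma>"
  shows "wedge x (ext_vec s) \<in> fspan (Suc p) \<sigma>"
  using assms(1) unfolding fspan_def
proof (induction rule: bit_span_induct)
  case (base b)
  then obtain e where e: "e edge_of \<sigma>" "b \<in> ext_power p (conormal2 e)" by auto
  then have "conormal2 \<sigma> \<subseteq> conormal2 e"
    by (intro conormal2_antimono) (auto simp: edge_of_def dest: face_of_imp_subset)
  then show ?case
    using ext_power_wedge[OF e(2)] e(1) assms(2) by (intro vec.span_base) (auto simp: wedge_commute[of b])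
qed (auto simp: wedge_add vec.span_zero intro: vec.span_add)

context smooth_triangulation
begin

section \<open>Cap-product with the coboundary of a cochain\<close>

definition cofacets :: "(real ^ 'n) set \<Rightarrow> (real ^ 'n) set set" where
  "cofacets \<tau> = {\<rho> \<in> K. \<tau> face_of \<rho> \<and> aff_dim \<rho> - aff_dim \<tau> = 1}"

text \<open>Cap-product, on representatives, with the wave whose value on the fine 1-cell
  [\<tau>, \<rho>] is \<open>b \<rho> + b \<tau>\<close>.\<close>

definition hess_cap ::
    "((real ^ 'n) set \<Rightarrow> bit ^ 'n) \<Rightarrow> ('n cell \<Rightarrow> 'n ext) \<Rightarrow> 'n cell \<Rightarrow> 'n ext" where
  "hess_cap b c e = (\<Sum>\<rho>\<in>cofacets (snd e). wedge (c (fst e, \<rho>)) (ext_vec (b \<rho> + b (snd e))))"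

definition gradient :: "(real ^ 'n \<Rightarrow> bit) \<Rightarrow> ((real ^ 'n) set \<Rightarrow> bit ^ 'n) \<Rightarrow> bool" where
  "gradient \<epsilon> b \<longleftrightarrow> (\<forall>\<rho>\<in>K. 1 \<le> aff_dim \<rho> \<longrightarrow> (\<forall>z z'. lat z \<in> verts \<rho> \<longrightarrow> lat z' \<in> verts \<rho> \<longrightarrow>
     pair (mod2 (z - z')) (b \<rho>) = \<epsilon> (lat z) + \<epsilon> (lat z')))"

lemma aff_dim_K: "\<rho> \<in> K \<Longrightarrow> aff_dim \<rho> \<le> int CARD('n)"
  using aff_dim_le_DIM[of \<rho>] by simp

text \<open>The cells one dimension up are the [\<sigma>, t] with t a cofacet of \<tau> and the
  [s, \<tau>] with s a facet of \<sigma>; the assumption removes the second kind.\<close>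

lemma bdry_cofacets:
  assumes e: "(\<sigma>, \<tau>) \<in> fine_cells K (q - 1)"
    and z: "\<And>\<rho>. (\<rho>, \<tau>) \<in> fine_cells K q \<Longrightarrow> \<rho> face_of \<sigma> \<Longrightarrow> c (\<rho>, \<tau>) = 0"
  shows "bdry q c (\<sigma>, \<tau>) = (\<Sum>\<rho>\<in>cofacets \<tau>. c (\<sigma>, \<rho>))"
proof -
  note E = fine_cells_facts[OF e, simplified]
  have "bdry q c (\<sigma>, \<tau>) = (\<Sum>e\<in>Pair \<sigma> ` cofacets \<tau>. c e)"
    unfolding bdry_def
  proof (rule sum.mono_neutral_right[OF finite_cofaces])
    show "Pair \<sigma> ` cofacets \<tau> \<subseteq> {e \<in> fine_cells K q. fine_face (\<sigma>, \<tau>) e}"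
      using E face_of_trans[OF E(5)] face_refl_K[OF E(1)]
      by (auto simp: cofacets_def fine_cells_def fine_face_def)
    show "\<forall>e\<in>{e \<in> fine_cells K q. fine_face (\<sigma>, \<tau>) e} - Pair \<sigma> ` cofacets \<tau>. c e = 0"
    proof
      fix e' assume e': "e' \<in> {e \<in> fine_cells K q. fine_face (\<sigma>, \<tau>) e} - Pair \<sigma> ` cofacets \<tau>"
      obtain s t where st: "e' = (s, t)" by (cases e')
      have f: "s \<in> K" "t \<in> K" "s face_of \<sigma>" "\<tau> face_of t" "aff_dim t - aff_dim s = q"
        using e' by (auto simp: st fine_cells_def fine_face_def)
      show "c e' = 0"
      proof (cases "t = \<tau>")
        case True
        then show ?thesis using z e' f by (auto simp: st)
      next
        case False
        have "aff_dim \<tau> < aff_dim t" using face_of_aff_dim_lt[OF convex_K[OF f(2)] f(4)] False by simp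
        moreover have "aff_dim s \<le> aff_dim \<sigma>" by (rule aff_dim_face[OF f(3)])
        ultimately have "aff_dim s = aff_dim \<sigma>" "aff_dim t - aff_dim \<tau> = 1" using E(6) f(5) by linarith+
        then have "s = \<sigma>" "t \<in> cofacets \<tau>"
          using face_same_dim[OF E(1) f(3)] f by (auto simp: cofacets_def)
        then show ?thesis using e' by (auto simp: st)
      qed
    qed
  qed
  also have "\<dots> = (\<Sum>\<rho>\<in>cofacets \<tau>. c (\<sigma>, \<rho>))"
    by (subst sum.reindex) (auto simp: inj_on_def)
  finally show ?thesis .
qed

text \<open>Cap-product with a coboundary is a commutator of the boundary with the wedge product by
  \<open>b\<close>: the terms over cells [s, \<tau>] carry \<open>b \<tau> + b \<tau>\<close> = 0.
  This does not make it trivial in homology, since the wedge product with \<open>b \<tau>\<close>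
  alone need not stay in the tropical cosheaf.\<close>

lemma hess_cap_leibniz:
  assumes e: "e \<in> fine_cells K (q - 1)"
  shows "hess_cap b c e = bdry q (\<lambda>e. wedge (c e) (ext_vec (b (snd e)))) e + wedge (bdry q c e) (ext_vec (b (snd e)))"
proof -
  obtain \<sigma> \<tau> where st: "e = (\<sigma>, \<tau>)" by (cases e)
  have "bdry q (\<lambda>e. wedge (c e) (ext_vec (b (snd e)))) e + wedge (bdry q c e) (ext_vec (b (snd e)))
      = bdry q (\<lambda>e'. wedge (c e') (ext_vec (b (snd e') + b \<tau>))) (\<sigma>, \<tau>)"
    by (simp add: bdry_def wedge_sum ext_vec_add wedge_add sum.distrib st)
  also have "\<dots> = (\<Sum>\<rho>\<in>cofacets \<tau>. wedge (c (\<sigma>, \<rho>)) (ext_vec (b \<rho> + b \<tau>)))"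
    using bdry_cofacets[of \<sigma> \<tau> q "\<lambda>e'. wedge (c e') (ext_vec (b (snd e') + b \<tau>))"] e st by simp
  finally show ?thesis by (simp add: hess_cap_def st)
qed

lemma hess_cap_add: "hess_cap b (\<lambda>e. c e + d e) e = hess_cap b c e + hess_cap b d e"
  by (simp add: hess_cap_def wedge_add sum.distrib)

lemma hess_cap_bdry:
  assumes e: "e \<in> fine_cells K (q - 1)"
  shows "hess_cap b (bdry (q + 1) d) e = bdry q (hess_cap b d) e"
proof -
  let ?A = "\<lambda>c e. wedge (c e) (ext_vec (b (snd e)))"
  have "bdry q (hess_cap b d) e = bdry q (\<lambda>e. bdry (q + 1) (?A d) e + ?A (bdry (q + 1) d) e) e"
    by (rule bdry_cong) (use hess_cap_leibniz[of _ "q + 1" b d] in auto)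
  also have "\<dots> = bdry q (?A (bdry (q + 1) d)) e"
    unfolding bdry_add by (simp add: bdry_bdry[OF _ e])
  also have "\<dots> = hess_cap b (bdry (q + 1) d) e"
    unfolding hess_cap_leibniz[OF e] by (simp add: bdry_bdry[OF _ e])
  finally show ?thesis by simp
qed

lemma gradient_diff:
  assumes b: "gradient \<epsilon> b" and t: "\<tau> \<in> K" "1 \<le> aff_dim \<tau>" "\<rho> \<in> K" "\<tau> face_of \<rho>"
  shows "b \<rho> + b \<tau> \<in> conormal2 \<tau>"
proof -
  have "1 \<le> aff_dim \<rho>" using aff_dim_face[OF t(4)] t(2) by simp
  then show ?thesis
    unfolding conormal2_simplex[OF t(1)]
    using b t face_verts[OF t(4)] by (auto simp: gradient_def pair_add subset_iff)
qed

text \<open>\<open>b \<rho> + b \<tau>\<close> is orthogonal to \<tau>, hence to \<sigma> and each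
  of its edges, so the wedge product with it respects the summands of F_p.\<close>

lemma hess_cap_fspan:
  assumes b: "gradient \<epsilon> b" and e: "e \<in> fine_cells K q"
    and d: "\<And>e. e \<in> fine_cells K (q + 1) \<Longrightarrow> d e \<in> fspan p (fst e)"
  shows "hess_cap b d e \<in> fspan (Suc p) (fst e)"
proof -
  obtain \<sigma> \<tau> where st: "e = (\<sigma>, \<tau>)" by (cases e)
  note E = fine_cells_facts[OF e[unfolded st], simplified]
  have dim: "1 \<le> aff_dim \<tau>" using aff_dim_face[OF E(5)] E(2) by simp
  have "wedge (d (\<sigma>, \<rho>)) (ext_vec (b \<rho> + b \<tau>)) \<in> fspan (Suc p) \<sigma>" if \<rho>: "\<rho> \<in> cofacets \<tau>" for \<rho>
  proof (rule fspan_wedge)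
    have r: "\<rho> \<in> K" "\<tau> face_of \<rho>" "aff_dim \<rho> - aff_dim \<tau> = 1" using \<rho> by (auto simp: cofacets_def)
    then have "(\<sigma>, \<rho>) \<in> fine_cells K (q + 1)"
      using E face_of_trans[OF E(5) r(2)] by (auto simp: fine_cells_def)
    then show "d (\<sigma>, \<rho>) \<in> fspan p \<sigma>" using d[of "(\<sigma>, \<rho>)"] by simp
    have "b \<rho> + b \<tau> \<in> conormal2 \<tau>" by (rule gradient_diff[OF b E(4) dim r(1,2)])
    then show "b \<rho> + b \<tau> \<in> conormal2 \<sigma>"
      using conormal2_antimono[OF face_of_imp_subset[OF E(5)]] by blast
  qed
  then show ?thesis
    unfolding hess_cap_def st fspan_def by (auto intro!: vec.span_sum)
qed

lemma cap_chain_rep: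
  assumes w: "\<And>\<tau> \<rho>. (\<tau>, \<rho>) \<in> fine_cells K 1 \<Longrightarrow> w (\<tau>, \<rho>) = ext_vec (b \<rho> + b \<tau>)"
  shows "cap_chain P K 1 q w (coset_chain q c) = coset_chain (q - 1) (hess_cap b c)"
  unfolding cap_chain_def coset_chain_def
proof (intro ext)
  fix e :: "'n cell"
  obtain \<sigma> \<tau> where st: "e = (\<sigma>, \<tau>)" by (cases e)
  have "ext_ideal (sed (min_face P \<tau>)) + (\<Sum>\<rho> | \<rho> \<in> K \<and> \<tau> face_of \<rho> \<and> aff_dim \<rho> - aff_dim \<tau> = 1.
          (\<lambda>x. wedge x (w (\<tau>, \<rho>))) ` (\<lambda>e\<in>fine_cells K q. c e +o cell_ideal e) (\<sigma>, \<rho>)) = hess_cap b c e +o cell_ideal e"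
    if e: "e \<in> fine_cells K (q - 1)"
  proof -
    note E = fine_cells_facts[OF e[unfolded st], simplified]
    have dim: "1 \<le> aff_dim \<tau>" using aff_dim_face[OF E(5)] E(2) by simp
    \<comment> \<open>The image of the ideal at [\<sigma>, \<rho>]. It lies in the ideal at
      [\<sigma>, \<tau>], because Sed grows when the face of P shrinks.\<close>
    define J where "J \<rho> = (\<lambda>x. wedge x (w (\<tau>, \<rho>))) ` ext_ideal (sed (min_face P \<rho>))" for \<rho>
    have img: "(\<lambda>x. wedge x y) ` (a +o I) = wedge a y +o ((\<lambda>x. wedge x y) ` I)" for a y and I :: "'n ext set"
      by (auto simp: elt_set_plus_def wedge_add(1) image_iff) (metis wedge_add(1))
    have "(\<lambda>x. wedge x (w (\<tau>, \<rho>))) ` (\<lambda>e\<in>fine_cells K q. c e +o cell_ideal e) (\<sigma>, \<rho>)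
        = wedge (c (\<sigma>, \<rho>)) (ext_vec (b \<rho> + b \<tau>)) +o J \<rho>" if r: "\<rho> \<in> cofacets \<tau>" for \<rho>
    proof -
      have "(\<sigma>, \<rho>) \<in> fine_cells K q" "(\<tau>, \<rho>) \<in> fine_cells K 1"
        using r E dim face_of_trans[OF E(5)] by (auto simp: cofacets_def fine_cells_def)
      then show ?thesis by (simp add: img J_def w)
    qed
    moreover have "0 \<in> J \<rho> \<and> J \<rho> \<subseteq> cell_ideal e" if r: "\<rho> \<in> cofacets \<tau>" for \<rho>
    proof -
      have "fine_face (\<sigma>, \<tau>) (\<sigma>, \<rho>)"
        using r E face_refl_K by (auto simp: cofacets_def fine_face_def)
      then have "ext_ideal (sed (min_face P \<rho>)) \<subseteq> cell_ideal e" using cell_ideal_mono[of "(\<sigma>, \<tau>)" "(\<sigma>, \<rho>)"] by (simp add: st)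
      then have "J \<rho> \<subseteq> cell_ideal e" unfolding J_def using ext_ideal_wedge by blast
      moreover have "0 \<in> J \<rho>" unfolding J_def by (rule image_eqI[of _ _ 0]) simp_all
      ultimately show ?thesis by simp
    qed
    ultimately show ?thesis
      unfolding hess_cap_def st cofacets_def[symmetric]
      using coset_image_sum[OF ext_ideal_subspace, of "cofacets \<tau>" J "cell_sed e" "\<lambda>\<rho>. wedge (c (\<sigma>, \<rho>)) (ext_vec (b \<rho> + b \<tau>))"]
      by (simp add: st)
  qed
  then show "(\<lambda>(\<sigma>, \<tau>)\<in>fine_cells K (q - 1). ext_ideal (sed (min_face P \<tau>)) +
       (\<Sum>\<rho> | \<rho> \<in> K \<and> \<tau> face_of \<rho> \<and> aff_dim \<rho> - aff_dim \<tau> = 1.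
          (\<lambda>x. wedge x (w (\<tau>, \<rho>))) ` (\<lambda>e\<in>fine_cells K q. c e +o cell_ideal e) (\<sigma>, \<rho>))) e
     = (\<lambda>e\<in>fine_cells K (q - 1). hess_cap b c e +o cell_ideal e) e"
    by (simp add: st restrict_def)
qed

lemma min_face_top:
  assumes "\<tau> \<in> K" "aff_dim \<tau> = int CARD('n)"
  shows "min_face P \<tau> = P"
proof -
  have "Q = P" if "Q face_of P" "\<tau> \<subseteq> Q" for Q
  proof (rule ccontr)
    assume "Q \<noteq> P"
    then have "aff_dim Q < aff_dim P" by (rule face_of_aff_dim_lt[OF convex_P that(1)])
    moreover have "aff_dim \<tau> \<le> aff_dim Q" by (rule aff_dim_subset[OF that(2)])
    ultimately show False using assms(2) aff_dim_P by simp
  qed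
  then have "{Q. Q face_of P \<and> \<tau> \<subseteq> Q} = {P}"
    using face_of_refl[OF convex_P] K_subset_P[OF assms(1)] by auto
  then show ?thesis by (simp add: min_face_def)
qed

section \<open>Face cycles on the fine structure\<close>

definition face_rep :: "(real ^ 'n) set \<Rightarrow> 'v \<Rightarrow> 'n cell \<Rightarrow> 'v::zero" where
  "face_rep \<sigma> x e = (if aff_dim (snd e) = int CARD('n) \<and> \<sigma> face_of fst e then x else 0)"

text \<open>In this degree the coarse cell around [\<rho>, \<tau>] is [\<rho>, P] and has the same
  dimension exactly if \<tau> is full-dimensional; all other fine cells carry zero.\<close>

lemma face_cycle_rep:
  "face_cycle P K \<sigma> us = coset_chain (int CARD('n) - aff_dim \<sigma> - 1) (face_rep \<sigma> (wedge_list us))"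
proof -
  let ?q = "int CARD('n) - aff_dim \<sigma> - 1"
  show ?thesis
    unfolding face_cycle_def subdivide_def coset_chain_def aff_dim_P
  proof (intro restrict_ext)
    fix e assume e: "e \<in> fine_cells K ?q"
    obtain \<rho> \<tau> where st: "e = (\<rho>, \<tau>)" by (cases e)
    note E = fine_cells_facts[OF e[unfolded st], simplified]
    show "(if coarse_of P e \<in> coarse_cells P K ?q then face_chain P K \<sigma> us (coarse_of P e)
        else zero_at (trop (length us)) (coarse_of P e)) = face_rep \<sigma> (wedge_list us) e +o cell_ideal e"
    proof (cases "aff_dim \<tau> = int CARD('n)")
      case True
      have "(\<rho>, P) \<in> coarse_cells P K ?q"
        using E True K_subset_P face_of_refl[OF convex_P] by (auto simp: coarse_cells_def aff_dim_P)
      then show ?thesis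
        by (simp add: st coarse_of_def min_face_top[OF E(4) True] True face_chain_def face_rep_def aff_dim_P)
    next
      case False
      have "min_face P \<tau> \<noteq> P" if "coarse_of P e \<in> coarse_cells P K ?q"
        using that E False by (auto simp: st coarse_of_def coarse_cells_def aff_dim_P)
      with False show ?thesis
        by (auto simp: st coarse_of_def face_chain_def face_rep_def aff_dim_P trop_def)
    qed
  qed
qed

section \<open>Representatives of the Hessian wave\<close>

lemma gradient_exists: obtains b where "gradient \<epsilon> b"
proof -
  have "\<exists>u. \<forall>z z'. lat z \<in> verts \<rho> \<longrightarrow> lat z' \<in> verts \<rho> \<longrightarrow> pair (mod2 (z - z')) u = \<epsilon> (lat z) + \<epsilon> (lat z')"
    if "\<rho> \<in> K" for \<rho>
    by (rule functional_mod2[OF that, of \<epsilon>]) blast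
  then obtain b where "\<And>\<rho>. \<rho> \<in> K \<Longrightarrow> \<forall>z z'. lat z \<in> verts \<rho> \<longrightarrow> lat z' \<in> verts \<rho> \<longrightarrow>
      pair (mod2 (z - z')) (b \<rho>) = \<epsilon> (lat z) + \<epsilon> (lat z')" by metis
  then have "gradient \<epsilon> b" by (simp add: gradient_def)
  then show ?thesis by (rule that)
qed

lemma fine_cells_0: "e \<in> fine_cells K 0 \<longleftrightarrow> (\<exists>\<rho>\<in>K. e = (\<rho>, \<rho>) \<and> 1 \<le> aff_dim \<rho>)"
proof
  assume e: "e \<in> fine_cells K 0"
  obtain s t where st: "e = (s, t)" by (cases e)
  have "s = t" using face_same_dim[of t s] e by (simp add: st fine_cells_def)
  then show "\<exists>\<rho>\<in>K. e = (\<rho>, \<rho>) \<and> 1 \<le> aff_dim \<rho>" using e by (auto simp: st fine_cells_def)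
qed (auto simp: fine_cells_def face_refl_K)

lemma coboundary_0:
  assumes e: "(\<tau>, \<rho>) \<in> fine_cells K 1"
  shows "coboundary K 0 b (\<tau>, \<rho>) = b (\<rho>, \<rho>) + b (\<tau>, \<tau>)"
proof -
  note E = fine_cells_facts[OF e, simplified]
  have "{e' \<in> fine_cells K 0. fine_face e' (\<tau>, \<rho>)} = {(\<rho>, \<rho>), (\<tau>, \<tau>)}"
  proof (intro equalityI subsetI)
    fix e' assume e': "e' \<in> {e' \<in> fine_cells K 0. fine_face e' (\<tau>, \<rho>)}"
    then obtain \<kappa> where k1: "\<kappa> \<in> K" "e' = (\<kappa>, \<kappa>)" using fine_cells_0 by blast
    then have k: "e' = (\<kappa>, \<kappa>)" "\<kappa> \<in> K" "\<tau> face_of \<kappa>" "\<kappa> face_of \<rho>"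
      using e' by (simp_all add: fine_face_def)
    have "aff_dim \<kappa> = aff_dim \<tau> \<or> aff_dim \<kappa> = aff_dim \<rho>"
      using aff_dim_face[OF k(3)] aff_dim_face[OF k(4)] E(6) by linarith
    then have "\<tau> = \<kappa> \<or> \<kappa> = \<rho>"
      using face_same_dim[OF k(2) k(3)] face_same_dim[OF E(4) k(4)] by argo
    then show "e' \<in> {(\<rho>, \<rho>), (\<tau>, \<tau>)}" using k(1) by blast
  next
    fix e' assume "e' \<in> {(\<rho>, \<rho>), (\<tau>, \<tau>)}"
    moreover have "1 \<le> aff_dim \<rho>" using E(2) aff_dim_face[OF E(5)] by simp
    ultimately show "e' \<in> {e' \<in> fine_cells K 0. fine_face e' (\<tau>, \<rho>)}"
      using E(1,2,4,5) by (auto simp: fine_cells_def fine_face_def face_refl_K)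
  qed
  moreover have "\<rho> \<noteq> \<tau>" using E(6) by auto
  ultimately show ?thesis using e by (simp add: coboundary_def)
qed

text \<open>A representative is the coboundary of c + a, where c lifts the section and a has values
  in the waves. The values of a are orthogonal to the simplex, so c + a has the same differences
  along edges as c and is itself a gradient.\<close>

lemma hessian_gradient:
  assumes "w \<in> hessian P K \<epsilon>"
  obtains b where "gradient \<epsilon> b" "\<And>\<tau> \<rho>. (\<tau>, \<rho>) \<in> fine_cells K 1 \<Longrightarrow> w (\<tau>, \<rho>) = ext_vec (b \<rho> + b \<tau>)"
proof -
  from assms obtain c a where c: "c \<in> cochains K (\<lambda>_. ext_power 1 UNIV) 0"
    "\<forall>e\<in>fine_cells K 0. edge_eval (fst e) (c e) = differential \<epsilon> (fst e)"
    and a: "a \<in> cochains K (wave 1 \<circ> coarse_of P) (1 - 1)"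
    and w: "w = (\<lambda>e\<in>fine_cells K 1. coboundary K 0 c e + coboundary K (1 - 1) a e)"
    unfolding hessian_def connecting_def cohom_class_def by blast
  have "\<exists>u s. c (\<rho>, \<rho>) = ext_vec u \<and> a (\<rho>, \<rho>) = ext_vec s \<and> s \<in> conormal2 \<rho>"
    if "\<rho> \<in> K" "1 \<le> aff_dim \<rho>" for \<rho>
  proof -
    have e: "(\<rho>, \<rho>) \<in> fine_cells K 0" using that by (auto simp: fine_cells_0)
    have "c (\<rho>, \<rho>) \<in> ext_vec ` UNIV"
      using c(1) e ext_power_1[of UNIV] by (auto simp: cochains_def vec.subspace_UNIV dest!: PiE_mem)
    moreover have "a (\<rho>, \<rho>) \<in> ext_vec ` conormal2 \<rho>"
      using a e ext_power_1[OF conormal2_subspace, of \<rho>]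
      by (auto simp: cochains_def wave_def coarse_of_def dest!: PiE_mem)
    ultimately show ?thesis by blast
  qed
  then obtain u s where us: "\<And>\<rho>. \<rho> \<in> K \<Longrightarrow> 1 \<le> aff_dim \<rho> \<Longrightarrow>
    c (\<rho>, \<rho>) = ext_vec (u \<rho>) \<and> a (\<rho>, \<rho>) = ext_vec (s \<rho>) \<and> s \<rho> \<in> conormal2 \<rho>" by metis
  show ?thesis
  proof (rule that[of "\<lambda>\<rho>. u \<rho> + s \<rho>"])
    show "gradient \<epsilon> (\<lambda>\<rho>. u \<rho> + s \<rho>)"
      unfolding gradient_def
    proof (intro ballI allI impI)
      fix \<rho> z z' assume r: "\<rho> \<in> K" "1 \<le> aff_dim \<rho>" and z: "lat z \<in> verts \<rho>" "lat z' \<in> verts \<rho>"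
      show "pair (mod2 (z - z')) (u \<rho> + s \<rho>) = \<epsilon> (lat z) + \<epsilon> (lat z')"
      proof (cases "z = z'")
        case False
        let ?e = "closed_segment (lat z) (lat z')"
        note e = edge_exists[OF r(1) z False]
        have "(\<rho>, \<rho>) \<in> fine_cells K 0" using r by (auto simp: fine_cells_0)
        then have "edge_eval \<rho> (c (\<rho>, \<rho>)) = differential \<epsilon> \<rho>" using c(2) by fastforce
        then have "edge_eval \<rho> (c (\<rho>, \<rho>)) ?e = differential \<epsilon> \<rho> ?e" by simp
        then have "pair (omega ?e) (c (\<rho>, \<rho>)) = (\<Sum>v | v extreme_point_of ?e. \<epsilon> v)"
          using e(1) by (simp add: edge_eval_def differential_def)
        also have "{v. v extreme_point_of ?e} = {lat z, lat z'}" using e(3) by (simp add: verts_def)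
        also have "(\<Sum>v\<in>{lat z, lat z'}. \<epsilon> v) = \<epsilon> (lat z) + \<epsilon> (lat z')" using False by simp
        also have "pair (omega ?e) (c (\<rho>, \<rho>)) = pair (mod2 (z - z')) (u \<rho>)"
          using us[OF r] e(4) by (simp add: pair_ext_vec mod2_diff add.commute)
        finally have "pair (mod2 (z - z')) (u \<rho>) = \<epsilon> (lat z) + \<epsilon> (lat z')" .
        moreover have "pair (mod2 (z - z')) (s \<rho>) = 0"
          using us[OF r] z verts_subset[of \<rho>] by (intro conormal2_pair[of _ \<rho>]) auto
        ultimately show ?thesis by (simp add: pair_add)
      qed simp
    qed
    fix \<tau> \<rho> assume e: "(\<tau>, \<rho>) \<in> fine_cells K 1"
    note E = fine_cells_facts[OF e, simplified]
    have "1 \<le> aff_dim \<rho>" using aff_dim_face[OF E(5)] E(2) by simp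
    then show "w (\<tau>, \<rho>) = ext_vec (u \<rho> + s \<rho> + (u \<tau> + s \<tau>))"
      using e us E by (simp add: w coboundary_0[OF e] ext_vec_add ac_simps)
  qed
qed

text \<open>The cap-product is a union over representatives, which would be empty if there were
  none.\<close>

lemma hessian_nonempty: "hessian P K \<epsilon> \<noteq> {}"
proof -
  obtain b where b: "gradient \<epsilon> b" by (rule gradient_exists)
  define c where "c = (\<lambda>e\<in>fine_cells K 0. ext_vec (b (fst e)))"
  define a where "a = (\<lambda>e\<in>fine_cells K 0. 0 :: 'n ext)"
  have "c \<in> cochains K (\<lambda>_. ext_power 1 UNIV) 0"
    using ext_power_1[of UNIV] by (auto simp: cochains_def c_def vec.subspace_UNIV)
  moreover have "edge_eval (fst e) (c e) = differential \<epsilon> (fst e)" if e: "e \<in> fine_cells K 0" for e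
    unfolding edge_eval_def differential_def
  proof (intro restrict_ext)
    fix g assume "g \<in> {g. g edge_of fst e}"
    then have g: "g edge_of fst e" by simp
    have r: "fst e \<in> K" "1 \<le> aff_dim (fst e)" using e by (auto simp: fine_cells_0)
    obtain z0 z1 where z: "lat z0 \<in> verts (fst e)" "lat z1 \<in> verts (fst e)" "z0 \<noteq> z1"
      "verts g = {lat z0, lat z1}" "omega g = ext_vec (mod2 (z1 - z0))"
      by (rule edge_cases[OF r(1) g])
    have "pair (omega g) (c e) = \<epsilon> (lat z1) + \<epsilon> (lat z0)"
      using b r z e by (simp add: c_def pair_ext_vec gradient_def)
    also have "\<dots> = (\<Sum>v | v extreme_point_of g. \<epsilon> v)"
      using z(3,4) by (simp add: verts_def add.commute)
    finally show "pair (omega g) (c e) = (\<Sum>v | v extreme_point_of g. \<epsilon> v)" .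
  qed
  moreover have "a \<in> cochains K (wave 1 \<circ> coarse_of P) (1 - 1)"
    by (auto simp: cochains_def a_def wave_def coarse_of_def ext_power_def vec.span_zero)
  ultimately show ?thesis
    unfolding hessian_def connecting_def cohom_class_def by blast
qed

text \<open>Otherwise u would divide the wedge product of \<open>us\<close>, and a product with a
  factor orthogonal to \<sigma> pairs to zero with \<omega>(\<sigma>).\<close>

lemma omega_dual_keys:
  assumes \<sigma>: "\<sigma> \<in> K" "0 \<le> aff_dim \<sigma>" and us: "omega_dual \<sigma> us"
    and u: "u \<in> Poly_Mapping.keys (aug_prod us)" "u \<noteq> 0"
  shows "u \<notin> conormal2 \<sigma>"
proof
  assume "u \<in> conormal2 \<sigma>"
  moreover obtain y where "wedge_list us = wedge (ext_vec u) y" using keys_aug_prod[OF u] by blast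
  ultimately have "pair (omega \<sigma>) (wedge_list us) = 0" using omega_annihilates[OF \<sigma>] by simp
  then show False using us by (simp add: omega_dual_def)
qed

lemma face_rep_active:
  assumes \<sigma>: "\<sigma> \<in> K" "0 \<le> aff_dim \<sigma>" and us: "omega_dual \<sigma> us"
    and b: "gradient (\<lambda>v. \<epsilon> v + chi \<sigma> v) b"
    and \<rho>: "\<rho> \<in> K" "\<sigma> face_of \<rho>" "aff_dim \<sigma> < aff_dim \<rho>" and \<tau>: "\<tau> \<in> K" "\<rho> face_of \<tau>" "1 \<le> aff_dim \<tau>"
    and w: "w \<in> Poly_Mapping.keys (xpow (b \<tau>) * aug_prod us)"
  shows "active \<epsilon> \<rho> w"
proof -
  obtain u where u: "u \<in> Poly_Mapping.keys (aug_prod us)" "w = b \<tau> + u" using w unfolding keys_mult_xpow by blast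
  have inc: "verts \<sigma> \<subseteq> verts \<rho>" "verts \<rho> \<subseteq> verts \<tau>" using face_verts \<rho>(2) \<tau>(2) by auto
  have chi: "chi \<sigma> v = of_bool (v \<in> verts \<sigma>)" for v by (simp add: chi_def verts_def)
  have b\<tau>: "pair (mod2 (z - z')) (b \<tau>) = \<epsilon> (lat z) + chi \<sigma> (lat z) + (\<epsilon> (lat z') + chi \<sigma> (lat z'))"
    if "lat z \<in> verts \<rho>" "lat z' \<in> verts \<rho>" for z z'
  proof -
    have "lat z \<in> verts \<tau>" "lat z' \<in> verts \<tau>" using that inc by blast+
    then show ?thesis using b \<tau>(1,3) by (simp add: gradient_def)
  qed
  show ?thesis
  proof (cases "u = 0")
    case True
    \<comment> \<open>At \<open>b \<tau>\<close> itself, an edge from \<sigma> to a vertex of \<rho>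
      outside \<sigma> satisfies the sign condition: \<open>chi\<close> contributes one at a single
      end.\<close>
    have "verts \<sigma> \<noteq> {}" using simplex_K(3)[OF \<sigma>(1)] \<sigma>(2) by auto
    then obtain z where z: "lat z \<in> verts \<sigma>" using verts_lattice[OF \<sigma>(1)] by blast
    have "verts \<sigma> \<noteq> verts \<rho>" using \<rho>(3) verts_inject[OF \<sigma>(1) \<rho>(1)] by auto
    then obtain z' where z': "lat z' \<in> verts \<rho>" "lat z' \<notin> verts \<sigma>"
      using inc(1) verts_lattice[OF \<rho>(1)] by blast
    have zr: "lat z \<in> verts \<rho>" using z inc by blast
    have "pair (mod2 (z - z')) w + \<epsilon> (lat z) + \<epsilon> (lat z') = 1"
      using b\<tau>[OF zr z'(1)] z z' True
      by (cases "\<epsilon> (lat z)"; cases "\<epsilon> (lat z')") (simp_all add: u(2) chi)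
    then show ?thesis using zr z'(1) by (auto simp: active_def)
  next
    case False
    \<comment> \<open>Here an edge inside \<sigma> detects u, and \<open>chi\<close> drops out
      because it is one at both ends.\<close>
    have "u \<notin> conormal2 \<sigma>" by (rule omega_dual_keys[OF \<sigma> us u(1) False])
    then obtain z z' where z: "lat z \<in> verts \<sigma>" "lat z' \<in> verts \<sigma>" "pair (mod2 (z - z')) u = 1"
      unfolding conormal2_simplex[OF \<sigma>(1)] by auto
    then have zr: "lat z \<in> verts \<rho>" "lat z' \<in> verts \<rho>" using inc by auto
    have "pair (mod2 (z - z')) w + \<epsilon> (lat z) + \<epsilon> (lat z') = 1"
      using b\<tau>[OF zr] z
      by (cases "\<epsilon> (lat z)"; cases "\<epsilon> (lat z')") (simp_all add: u(2) chi pair_add)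
    then show ?thesis using zr by (auto simp: active_def)
  qed
qed

lemma lead_part_face_rep:
  assumes "length us = p"
  shows "lead_part p (face_rep \<sigma> (xpow (b (snd e)) * aug_prod us) e) = face_rep \<sigma> (wedge_list us) e"
  using assms lead_part_xpow_aug_prod[of us] by (auto simp: face_rep_def)

lemma sign_rep_face_rep:
  assumes \<sigma>: "\<sigma> \<in> K" "aff_dim \<sigma> = int p" and us: "omega_dual \<sigma> us"
    and b: "gradient (\<lambda>v. \<epsilon> v + chi \<sigma> v) b"
  shows "sign_rep \<epsilon> p (int CARD('n) - int p - 1) (\<lambda>e. face_rep \<sigma> (xpow (b (snd e)) * aug_prod us) e)"
  unfolding sign_rep_def
proof (intro ballI)
  fix e assume e: "e \<in> fine_cells K (int CARD('n) - int p - 1)"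
  note E = fine_cells_facts[OF e]
  have len: "length us = p" using us \<sigma>(2) by (simp add: omega_dual_def)
  show "face_rep \<sigma> (xpow (b (snd e)) * aug_prod us) e \<in> aug_filt p \<and>
    quot (cell_sed e) (face_rep \<sigma> (xpow (b (snd e)) * aug_prod us) e) \<in> stalk (sign_cosheaf P K \<epsilon> p) (fst e, min_face P (snd e))"
  proof (cases "aff_dim (snd e) = int CARD('n) \<and> \<sigma> face_of fst e")
    case True
    have "active \<epsilon> (fst e) w" if w: "w \<in> Poly_Mapping.keys (xpow (b (snd e)) * aug_prod us)" for w
    proof (rule face_rep_active[OF \<sigma>(1) _ us b E(1) _ _ E(4,5) _ w])
      \<comment> \<open>Below a full-dimensional simplex, the degree forces dimension p + 1 on the
        first entry.\<close>
      show "aff_dim \<sigma> < aff_dim (fst e)" using E(6) True \<sigma>(2) by linarith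
    qed (use True \<sigma>(2) in auto)
    then show ?thesis
      using True xpow_aug_prod_aug_filt[of _ us] len quot_in_sign_stalk[OF E(1)] by (simp add: face_rep_def)
  qed (auto simp: face_rep_def zero_in_sign_stalk)
qed

text \<open>The boundary of the lift is supported on the cells \<open>[\<sigma>', \<tau>']\<close> with
  \<open>\<tau>'\<close> of codimension one, where it is the sum of the two terms coming from the cofacets of
  \<open>\<tau>'\<close>.\<close>

lemma bdry_face_rep:
  fixes b :: "(real ^ 'n) set \<Rightarrow> bit ^ 'n"
  assumes \<sigma>: "\<sigma> \<in> K" "aff_dim \<sigma> = int p" "\<not> \<sigma> \<subseteq> frontier P" and len: "length us = p"
    and e: "e \<in> fine_cells K (q - 1)" and q: "q = int CARD('n) - int p - 1"
  defines "r \<equiv> \<lambda>e. face_rep \<sigma> (xpow (b (snd e)) * aug_prod us) e"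
  shows "bdry q r e \<in> aug_filt (Suc p) \<and> lead_part (Suc p) (bdry q r e) = hess_cap b (face_rep \<sigma> (wedge_list us)) e"
proof -
  obtain s t where st: "e = (s, t)" by (cases e)
  note E = fine_cells_facts[OF e[unfolded st], simplified]
  let ?N = "int CARD('n)"
  consider "aff_dim t = ?N" | "aff_dim t = ?N - 1" | "aff_dim t < ?N - 1"
    using aff_dim_K[OF E(4)] by linarith
  then show ?thesis
  proof cases
    case 1
    \<comment> \<open>If t is full-dimensional, the cap-product has no terms. In the boundary only
      the first entry varies, so every nonzero term has the same value \<open>?g\<close>, and the
      number of these terms is two or zero.\<close>
    have "cofacets t = {}" using aff_dim_K 1 by (force simp: cofacets_def)
    then have h: "hess_cap b (face_rep \<sigma> (wedge_list us)) e = 0" by (simp add: hess_cap_def st)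
    let ?g = "xpow (b t) * aug_prod us"
    let ?M = "{(x, y). x \<in> K \<and> y \<in> K \<and> \<sigma> face_of x \<and> x face_of s \<and> t face_of y \<and> y face_of t
      \<and> aff_dim y - aff_dim x = q}"
    have yt: "y = t" if "y \<in> K" "t face_of y" for y
      using face_same_dim[OF that] aff_dim_face[OF that(2)] aff_dim_K[OF that(1)] 1 by simp
    have "bdry q r e = (\<Sum>e' | e' \<in> {e' \<in> fine_cells K q. fine_face e e'} \<and> \<sigma> face_of fst e'. ?g)"
      unfolding bdry_def r_def
    proof (rule sum.mono_neutral_cong_right[OF finite_cofaces])
      show "face_rep \<sigma> (xpow (b (snd e')) * aug_prod us) e' = ?g"
        if "e' \<in> {e' \<in> {e' \<in> fine_cells K q. fine_face e e'}. \<sigma> face_of fst e'}" for e'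
        using that yt[of "snd e'"] 1 by (auto simp: face_rep_def st fine_cells_def fine_face_def)
    qed (auto simp: face_rep_def)
    also have "{e' \<in> {e' \<in> fine_cells K q. fine_face e e'}. \<sigma> face_of fst e'} = ?M"
    proof (intro equalityI subsetI)
      fix e' assume "e' \<in> {e' \<in> {e' \<in> fine_cells K q. fine_face e e'}. \<sigma> face_of fst e'}"
      then show "e' \<in> ?M" using yt[of "snd e'"] face_refl_K
        by (cases e') (auto simp: st fine_cells_def fine_face_def)
    next
      fix e' assume e': "e' \<in> ?M"
      obtain x y where xy: "e' = (x, y)" by (cases e')
      have "1 \<le> aff_dim x" using e' 1 yt[of y] q by (auto simp: xy)
      then show "e' \<in> {e' \<in> {e' \<in> fine_cells K q. fine_face e e'}. \<sigma> face_of fst e'}"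
        using e' E(5) by (auto simp: xy st fine_cells_def fine_face_def intro: face_of_trans)
    qed
    also have "(\<Sum>e'\<in>?M. ?g) = 0"
    proof (cases "\<sigma> face_of s")
      case True
      have "card ?M = 2"
        by (rule diamond[OF \<sigma>(1) E(4) E(1) E(4) True E(5) face_refl_K[OF E(4)]])
          (use 1 E(6) \<sigma>(2) q in auto)
      then show ?thesis by (intro sum_const_even) auto
    next
      case False
      then have M: "?M = {}" using face_of_trans by blast
      show ?thesis unfolding M by simp
    qed
    finally show ?thesis by (simp add: h)
  next
    case 2
    have bnd: "bdry q r e = (\<Sum>\<rho>\<in>cofacets t. r (s, \<rho>))"
      unfolding st by (rule bdry_cofacets[OF e[unfolded st]]) (use 2 in \<open>simp add: r_def face_rep_def\<close>)
    have cof: "aff_dim \<rho> = ?N" if "\<rho> \<in> cofacets t" for \<rho> using that 2 by (simp add: cofacets_def)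
    show ?thesis
    proof (cases "\<sigma> face_of s")
      case True
      \<comment> \<open>A simplex that contains an interior simplex is interior, so t has two
        cofacets.\<close>
      have "\<sigma> \<subseteq> t" using face_of_imp_subset[OF face_of_trans[OF True E(5)]] .
      then have "\<not> t \<subseteq> frontier P" using \<sigma>(3) by auto
      moreover have "cofacets t = {\<rho> \<in> K. t face_of \<rho> \<and> aff_dim \<rho> = ?N}"
        using 2 by (auto simp: cofacets_def)
      ultimately have "card (cofacets t) = 2" using card_cofaces_interior[OF E(4) 2] by simp
      then obtain \<rho>1 \<rho>2 where \<rho>: "cofacets t = {\<rho>1, \<rho>2}" "\<rho>1 \<noteq> \<rho>2" by (auto simp: card_2_iff)
      have "xpow (b \<rho>1) * (1 + xpow (b \<rho>1 + b \<rho>2)) = xpow (b \<rho>1) + xpow (b \<rho>2)"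
        by (simp add: distrib_left flip: xpow_add)
      then have "(xpow (b \<rho>1) * (1 + xpow (b \<rho>1 + b \<rho>2))) * aug_prod us = (xpow (b \<rho>1) + xpow (b \<rho>2)) * aug_prod us"
        by (simp only:)
      then have "xpow (b \<rho>1) * aug_prod ((b \<rho>1 + b \<rho>2) # us) = xpow (b \<rho>1) * aug_prod us + xpow (b \<rho>2) * aug_prod us"
        by (simp only: aug_prod_simps mult.assoc distrib_right[of "xpow (b \<rho>1)"])
      moreover have "r (s, \<rho>) = xpow (b \<rho>) * aug_prod us" if "\<rho> \<in> cofacets t" for \<rho>
        using cof[OF that] True by (simp add: r_def face_rep_def)
      moreover have "bdry q r e = r (s, \<rho>1) + r (s, \<rho>2)" using \<rho> unfolding bnd by simp
      ultimately have "bdry q r e = xpow (b \<rho>1) * aug_prod ((b \<rho>1 + b \<rho>2) # us)" using \<rho>(1) by simp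
      then have 1: "bdry q r e \<in> aug_filt (Suc p)" "lead_part (Suc p) (bdry q r e) = wedge (ext_vec (b \<rho>1 + b \<rho>2)) (wedge_list us)"
        using xpow_aug_prod_aug_filt[of "b \<rho>1" "(b \<rho>1 + b \<rho>2) # us"] lead_part_xpow_aug_prod[of "(b \<rho>1 + b \<rho>2) # us" "b \<rho>1"] len
        by simp_all
      \<comment> \<open>The two occurrences of \<open>b t\<close> cancel, which leaves the
        difference between the two cofacets.\<close>
      have "hess_cap b (face_rep \<sigma> (wedge_list us)) e
          = wedge (wedge_list us) (ext_vec (b \<rho>1 + b t) + ext_vec (b \<rho>2 + b t))"
        using cof[of \<rho>1] cof[of \<rho>2] \<rho> True by (simp add: hess_cap_def st face_rep_def wedge_add)
      also have "ext_vec (b \<rho>1 + b t) + ext_vec (b \<rho>2 + b t) = ext_vec (b \<rho>1 + b \<rho>2)"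
        by (simp add: ext_vec_add ac_simps)
      finally show ?thesis using 1 by (simp add: wedge_commute)
    next
      case False
      then have "r (s, \<rho>) = 0" for \<rho> by (simp add: r_def face_rep_def)
      then have "bdry q r e = 0" unfolding bnd by simp
      moreover have "hess_cap b (face_rep \<sigma> (wedge_list us)) e = 0"
        using False by (simp add: hess_cap_def st face_rep_def)
      ultimately show ?thesis by simp
    qed
  next
    case 3
    \<comment> \<open>Neither a cofacet of t nor the last entry of a coface of [s, t] can be
      full-dimensional, so both sides vanish.\<close>
    have "aff_dim \<rho> \<noteq> ?N" if "\<rho> \<in> cofacets t" for \<rho> using that 3 by (auto simp: cofacets_def)
    then have h: "hess_cap b (face_rep \<sigma> (wedge_list us)) e = 0"
      by (auto simp: hess_cap_def st face_rep_def intro!: sum.neutral)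
    have "r e' = 0" if "e' \<in> fine_cells K q" "fine_face e e'" for e'
    proof -
      have "aff_dim (fst e') \<le> aff_dim s" using that(2) aff_dim_face by (auto simp: fine_face_def st)
      then have "aff_dim (snd e') \<noteq> ?N" using that(1) E(6) 3 by (auto simp: fine_cells_def)
      then show ?thesis by (simp add: r_def face_rep_def)
    qed
    then have "bdry q r e = 0" by (auto simp: bdry_def intro!: sum.neutral)
    then show ?thesis by (simp add: h)
  qed
qed

end

text \<open>Both operations are unions of classes over all representatives. The first conjunct says
  that the union on the left is a single homology class, so the equation is one between elements of
  the homology group.\<close>

theorem proposition4p6:
  fixes P :: "(real ^ 'n::finite) set" and K :: "(real ^ 'n) set set"
    and \<epsilon> :: "real ^ 'n \<Rightarrow> bit" and \<sigma> :: "(real ^ 'n) set"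
    and us :: "(bit ^ 'n) list" and n p :: nat
  assumes "CARD('n) = n + 1" and "1 \<le> n"
    and "smooth_polytope P" and "primitive_triangulation P K"
    and "\<sigma> \<in> K" and "aff_dim \<sigma> = int p" and "p \<le> n" and "\<not> \<sigma> \<subseteq> frontier P"
    and "omega_dual \<sigma> us"
  shows "partial_eps P K \<epsilon> p (int n - int p) (face_class P K \<sigma> us)
           \<in> trop_homology P K (p + 1) (int n - int p - 1) \<and>
         partial_eps P K \<epsilon> p (int n - int p) (face_class P K \<sigma> us) =
           cap P K 1 1 p (int n - int p) (hessian P K (\<lambda>v. \<epsilon> v + chi \<sigma> v)) (face_class P K \<sigma> us)"
proof -
  interpret smooth_triangulation P K
    using assms(3,4) polytope_imp_convex
    by unfold_locales (auto simp: smooth_polytope_def simple_polytope_def)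
  define q where "q = int n - int p"
  have q: "q = int CARD('n) - int p - 1" by (simp add: q_def assms(1))
  have len: "length us = p" using assms(6,9) by (simp add: omega_dual_def)
  define f where "f = face_rep \<sigma> (wedge_list us)"
  define H where "H = face_class P K \<sigma> us"
  have H: "H = trop_class P K p q (coset_chain q f)"
    by (simp add: H_def face_class_def face_cycle_rep f_def aff_dim_P assms(6) len q)
  let ?W = "hessian P K (\<lambda>v. \<epsilon> v + chi \<sigma> v)"
  let ?G = "\<lambda>b. trop_class P K (p + 1) (q - 1) (coset_chain (q - 1) (hess_cap b f))"
  \<comment> \<open>The left-hand side of the equation does not involve b, so the class of
    \<open>hess_cap b f\<close> is the same for all gradients.\<close>
  have G: "partial_eps P K \<epsilon> p q H = ?G b \<and> ?G b \<in> trop_homology P K (p + 1) (q - 1)"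
    if b: "gradient (\<lambda>v. \<epsilon> v + chi \<sigma> v) b" for b
  proof -
    let ?r = "\<lambda>e. face_rep \<sigma> (xpow (b (snd e)) * aug_prod us) e"
    have rep: "sign_rep \<epsilon> p q ?r"
      using sign_rep_face_rep[OF assms(5,6,9) b] by (simp add: q)
    have bnd: "bdry q ?r e \<in> aug_filt (Suc p)" "lead_part (Suc p) (bdry q ?r e) = hess_cap b f e"
      if "e \<in> fine_cells K (q - 1)" for e
      using bdry_face_rep[OF assms(5,6,8) len that q] by (simp_all add: f_def)
    have "coset_chain (q - 1) (\<lambda>e. lead_part (Suc p) (bdry q ?r e)) = coset_chain (q - 1) (hess_cap b f)"
      by (rule coset_chain_cong) (simp add: bnd(2))
    moreover have "(\<lambda>e. lead_part p (?r e)) = f" by (simp add: fun_eq_iff lead_part_face_rep[OF len] f_def)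
    ultimately show ?thesis
      using partial_eps_class[OF rep bnd(1)] partial_eps_homology[OF rep bnd(1)] by (simp add: H)
  qed
  obtain b0 where b0: "gradient (\<lambda>v. \<epsilon> v + chi \<sigma> v) b0" by (rule gradient_exists)
  \<comment> \<open>Each pair of representatives w, c comes with its own gradient b and its own
    chain d. The boundary of d only moves the result within its class, and \<open>G\<close> for this
    b identifies that class.\<close>
  have cap: "trop_class P K (1 + p) (q - 1) (cap_chain P K 1 q w c) = partial_eps P K \<epsilon> p q H"
    if w: "w \<in> ?W" and c: "c \<in> H" for w c
  proof -
    obtain b where b: "gradient (\<lambda>v. \<epsilon> v + chi \<sigma> v) b"
      "\<And>\<tau> \<rho>. (\<tau>, \<rho>) \<in> fine_cells K 1 \<Longrightarrow> w (\<tau>, \<rho>) = ext_vec (b \<rho> + b \<tau>)"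
      using hessian_gradient[OF w] by blast
    obtain d where d: "c = coset_chain q (\<lambda>e. f e + bdry (q + 1) d e)"
      "\<And>e. e \<in> fine_cells K (q + 1) \<Longrightarrow> d e \<in> fspan p (fst e)"
      using c unfolding H mem_trop_class by blast
    have cc: "cap_chain P K 1 q w c = coset_chain (q - 1) (hess_cap b (\<lambda>e. f e + bdry (q + 1) d e))"
      unfolding d(1) by (rule cap_chain_rep) (rule b(2))
    have "trop_class P K (1 + p) (q - 1) (coset_chain (q - 1) (hess_cap b (\<lambda>e. f e + bdry (q + 1) d e)))
        = trop_class P K (1 + p) (q - 1) (coset_chain (q - 1) (hess_cap b f))"
    proof (rule trop_class_eqI)
      show "hess_cap b d e \<in> fspan (1 + p) (fst e)" if "e \<in> fine_cells K (q - 1 + 1)" for e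
        using hess_cap_fspan[OF b(1) _ d(2), of e q] that by simp
      show "hess_cap b (\<lambda>e. f e + bdry (q + 1) d e) e + hess_cap b f e + bdry (q - 1 + 1) (hess_cap b d) e \<in> cell_ideal e"
        if "e \<in> fine_cells K (q - 1)" for e
      proof -
        have "hess_cap b (\<lambda>e. f e + bdry (q + 1) d e) e = hess_cap b f e + bdry q (hess_cap b d) e"
          using hess_cap_bdry[OF that] by (simp add: hess_cap_add)
        then show ?thesis by (simp add: ac_simps)
      qed
    qed
    then show ?thesis using G[OF b(1)] by (simp add: cc)
  qed
  \<comment> \<open>Both index sets of the union are nonempty, so the union of equal classes is that
    class.\<close>
  have "coset_chain q f \<in> H"
    unfolding H mem_trop_class by (intro exI[of _ "\<lambda>_. 0"]) (simp add: bdry_def)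
  moreover have "cap P K 1 1 p q ?W H = (\<Union>w\<in>?W. \<Union>c\<in>H. partial_eps P K \<epsilon> p q H)"
    unfolding cap_def by (intro SUP_cong refl cap)
  ultimately have "cap P K 1 1 p q ?W H = partial_eps P K \<epsilon> p q H"
    using hessian_nonempty[of "\<lambda>v. \<epsilon> v + chi \<sigma> v"] by auto
  then show ?thesis
    using G[OF b0] by (simp add: H_def q_def)
qed

end
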